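(* Let $k\in\mathbb C$, $k\ne-2$. The residue $$\widetilde S_k=\int\widetilde a(z)^{-(k+2)}V_{2(k+2)}(z)\,dz:\ \widetilde W_{0,0,k}\to\widetilde W_{-(k+2),2(k+2),k}$$ is an intertwining operator between the $\widehat{\mathfrak{sl}}_2$-modules $\widetilde W_{0,0,k}$ and $\widetilde W_{-(k+2),2(k+2),k}$.
   Context: $\mathfrak{sl}_2$ has standard basis $e,h,f$; level $k$ refers to the inner product $k\kappa_0$ with $\kappa_0(h,h)=2$; $x(z)=\sum_n(x\otimes t^n)z^{-n-1}$; $\int(\cdot)\,dz$ is the coefficient of $z^{-1}$. Bosonization. Let $p_n,q_n$ ($n\in\mathbb Z$) satisfy $[p_n,p_m]=n\delta_{n,-m}$, $[q_n,q_m]=-n\delta_{n,-m}$, $[p_n,q_m]=0$; $p(z)=\sum p_nz^{-n-1}$, $q(z)=\sum q_nz^{-n-1}$. $\Pi_{\lambda,\mu}$ is the Fock module generated by $|\lambda,\mu\rangle$ with $p_n|\lambda,\mu\rangle=\lambda\delta_{n,0}|\lambda,\mu\rangle$, $q_n|\lambda,\mu\rangle=-\mu\delta_{n,0}|\lambda,\mu\rangle$ for $n\ge0$. The vertex operators $V_{\lambda,\mu}(z)=e^{\lambda u+\mu v}:\Pi_{\lambda',\mu'}\to\Pi_{\lambda+\lambda',\mu+\mu'}$ are $$V_{\lambda,\mu}(z)=T_{\lambda,\mu}z^{\lambda\lambda'-\mu\mu'}\exp\Big(-\sum_{n<0}\frac{\lambda p_n+\mu q_n}nz^{-n}\Big)\exp\Big(-\sum_{n>0}\frac{\lambda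 p_n+\mu q_n}nz^{-n}\Big),$$ $T_{\lambda,\mu}$ sending highest weight vector to highest weight vector and commuting with $p_n,q_n$, $n\ne0$. Here $\partial_z u(z)=p(z)$, $\partial_z v(z)=q(z)$. For $\alpha\in\mathbb C$, $\Pi_\alpha=\bigoplus_{n\in\mathbb Z}\Pi_{n+\alpha,n+\alpha}$; $\Pi_0$ is a vertex algebra and $\Pi_\alpha$ a $\Pi_0$-module. The Weyl algebra $[a_n,a^*_m]=\delta_{n,-m}$ (with $a(z)=\sum a_nz^{-n-1}$, $a^*(z)=\sum a^*_nz^{-n}$) acts on each $\Pi_\alpha$ by $a(z)\mapsto\widetilde a(z)=e^{u+v}$, $a^*(z)\mapsto-:\!p(z)e^{-u-v}\!:$; this comes from the Friedan-Martinec-Shenker embedding of the Weyl vertex algebra $M$ into $\Pi_0$. For $\alpha\in\mathbb C$, $\widetilde a(z)^\alpha=e^{\alpha(u+v)}:\Pi_0\to\Pi_\alpha$. Modules. $\pi^{k+2}_\lambda$ is the Fock module of $[b_n,b_m]=2(k+2)n\delta_{n,-m}$ generated by $|\lambda\rangle$ with $b_n|\lambda\rangle=0$ ($n>0$), $b_0|\lambda\rangle=\lambda|\lambda\rangle$; $b(z)=\sum b_nz^{-n-1}$. $\widetilde W_{\alpha,\lambda,k}=\Pi_\alpha\otimes\pi^{k+2}_\lambda$, with the level $k$ action of $\widehat{\mathfrak{sl}}_2$ given by $e(z)\mapsto a(z)$, $h(z)\mapsto-2:\!a^*(z)a(z)\!:+b(z)$, $f(z)\mapsto-:\!a^*(z)^2a(z)\!:+k\partial_za^*(z)+a^*(z)b(z)$.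 Normally ordered products here denote the corresponding vertex operators: if $A$ is the vector in the Weyl vertex algebra $M$ represented by such a product, its image in $\Pi_0$ acts through the $\Pi_0$-module structure on $\Pi_\alpha$. Finally $$V_{2(k+2)}(z)=T_{2(k+2)}\exp\Big(-\sum_{n<0}\frac{b_n}nz^{-n}\Big)\exp\Big(-\sum_{n>0}\frac{b_n}nz^{-n}\Big):\pi_0^{k+2}\to\pi_{2(k+2)}^{k+2},$$ $T_{2(k+2)}$ being the shift of highest weight vectors commuting with $b_n$, $n\ne0$. Intertwining operator means homomorphism of $\widehat{\mathfrak{sl}}_2$-modules. *)

theory Defs
  imports Complex_Main "HOL-Library.Multiset" "HOL-Library.Poly_Mapping"
begin

section \<open>Complex vector spaces with a distinguished basis\<close>

type_synonym 'x fvec = "'x \<Rightarrow>\<^sub>0 complex"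

abbreviation basis :: "'x \<Rightarrow> 'x fvec"
  where "basis x \<equiv> Poly_Mapping.single x 1"

definition scale :: "complex \<Rightarrow> 'x fvec \<Rightarrow> 'x fvec"  (infixr \<open>*\<^sub>v\<close> 75)
  where "c *\<^sub>v v = Poly_Mapping.map ((*) c) v"

definition lin_ext :: "('x \<Rightarrow> 'y fvec) \<Rightarrow> 'x fvec \<Rightarrow> 'y fvec"
  where "lin_ext f v = (\<Sum>x\<in>Poly_Mapping.keys v. Poly_Mapping.lookup v x *\<^sub>v f x)"

definition spanned :: "'x set \<Rightarrow> 'x fvec set"
  where "spanned X = {v. Poly_Mapping.keys v \<subseteq> X}"

text \<open>The tensor product of the spaces with bases \<open>'x\<close> and \<open>'y\<close> is the space with basis
  \<open>'x \<times> 'y\<close>.\<close>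

definition tensor :: "'x fvec \<Rightarrow> 'y fvec \<Rightarrow> ('x \<times> 'y) fvec"  (infixr \<open>\<otimes>\<^sub>v\<close> 72)
  where "v \<otimes>\<^sub>v w = lin_ext (\<lambda>x. lin_ext (\<lambda>y. basis (x, y)) w) v"


section \<open>Operator-valued formal series\<close>

text \<open>\<open>A m\<close> is the coefficient of \<open>z\<^sup>m\<close> (not the mode of index \<open>m\<close>) of the series \<open>A(z)\<close>.
  All uses of \<^const>\<open>Sum_any\<close> below are sums with only finitely many nonzero terms for the series
  they are applied to: on each vector, these series have only finitely many negative powers
  of \<open>z\<close>, or (the annihilation parts) finitely many powers of \<open>z\<close> altogether.\<close>

type_synonym ('x, 'y) opseries = "int \<Rightarrow> 'x fvec \<Rightarrow> 'y fvec"

definition series_one :: "('x, 'x) opseries"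
  where "series_one m v = (if m = 0 then v else 0)"

definition series_comp :: "('y, 'w) opseries \<Rightarrow> ('x, 'y) opseries \<Rightarrow> ('x, 'w) opseries"
  where "series_comp A B m v = Sum_any (\<lambda>i. A i (B (m - i) v))"

primrec series_pow :: "('x, 'x) opseries \<Rightarrow> nat \<Rightarrow> ('x, 'x) opseries"
  where
    "series_pow A 0 = series_one"
  | "series_pow A (Suc j) = series_comp A (series_pow A j)"

definition series_exp :: "('x, 'x) opseries \<Rightarrow> ('x, 'x) opseries"
  where "series_exp A m v = Sum_any (\<lambda>j. (1 / fact j) *\<^sub>v series_pow A j m v)"

definition series_tensor ::
    "('x, 'x') opseries \<Rightarrow> ('y, 'y') opseries \<Rightarrow> ('x \<times> 'y, 'x' \<times> 'y') opseries"
  where "series_tensor A B m =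
    lin_ext (\<lambda>(x, y). Sum_any (\<lambda>i. A i (basis x) \<otimes>\<^sub>v B (m - i) (basis y)))"

text \<open>The divided power \<open>\<partial>\<^sub>z\<^sup>n / n!\<close>.\<close>

definition series_ddiff :: "nat \<Rightarrow> ('x, 'y) opseries \<Rightarrow> ('x, 'y) opseries"
  where "series_ddiff n A m v = (of_int (m + int n) gchoose n) *\<^sub>v A (m + int n) v"

text \<open>\<open>:A(z)B(z): = A(z)\<^sub>+ B(z) + B(z) A(z)\<^sub>-\<close>, where \<open>A(z)\<^sub>+\<close> consists of the nonnegative powers
  of \<open>z\<close>. For \<open>A(z) = \<Sum> A\<^sub>n z\<^sup>-\<^sup>n\<^sup>-\<^sup>1\<close> these are the \<open>A\<^sub>n\<close> with \<open>n < 0\<close>.\<close>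

definition normal_prod :: "('x, 'x) opseries \<Rightarrow> ('x, 'x) opseries \<Rightarrow> ('x, 'x) opseries"
  where "normal_prod A B m v =
    Sum_any (\<lambda>i. if i \<ge> 0 then A i (B (m - i) v) else B (m - i) (A i v))"

text \<open>For modes \<open>X\<^sub>n\<close>:
  \<open>exp(- \<Sum>\<^sub>n\<^sub><\<^sub>0 X\<^sub>n z\<^sup>-\<^sup>n / n) exp(- \<Sum>\<^sub>n\<^sub>>\<^sub>0 X\<^sub>n z\<^sup>-\<^sup>n / n)\<close>.\<close>

definition creation_part :: "(int \<Rightarrow> 'x fvec \<Rightarrow> 'x fvec) \<Rightarrow> ('x, 'x) opseries"
  where "creation_part X m v =
    (let n = - m in if n < 0 then (- (1 / of_int n)) *\<^sub>v X n v else 0)"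

definition annihilation_part :: "(int \<Rightarrow> 'x fvec \<Rightarrow> 'x fvec) \<Rightarrow> ('x, 'x) opseries"
  where "annihilation_part X m v =
    (let n = - m in if n > 0 then (- (1 / of_int n)) *\<^sub>v X n v else 0)"

definition normal_exp :: "(int \<Rightarrow> 'x fvec \<Rightarrow> 'x fvec) \<Rightarrow> ('x, 'x) opseries"
  where "normal_exp X =
    series_comp (series_exp (creation_part X)) (series_exp (annihilation_part X))"


section \<open>Fock modules\<close>

text \<open>A monomial in the creation operators of one boson \<open>x\<^sub>n\<close> is a multiset of naturals, an
  occurrence of \<open>n\<close> standing for the factor \<open>x\<^bsub>-n-1\<^esub>\<close>. For \<open>[x\<^sub>n, x\<^sub>m] = g n \<delta>\<^bsub>n,-m\<^esub>\<close> and
  zero mode \<open>c\<close>, the operator \<open>x\<^sub>n\<close> sends \<open>M\<close> to \<open>osc_coeff g c n M\<close> times \<open>osc_mon n M\<close>.\<close>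

definition osc_mon :: "int \<Rightarrow> nat multiset \<Rightarrow> nat multiset"
  where "osc_mon n M =
    (if n < 0 then add_mset (nat (- n) - 1) M else if n = 0 then M else M - {#nat n - 1#})"

definition osc_coeff :: "complex \<Rightarrow> complex \<Rightarrow> int \<Rightarrow> nat multiset \<Rightarrow> complex"
  where "osc_coeff g c n M =
    (if n < 0 then 1 else if n = 0 then c else g * of_int n * of_nat (count M (nat n - 1)))"

text \<open>\<open>(\<lambda>, \<mu>, A, B)\<close> is the monomial \<open>A\<close> in the \<open>p\<^sub>n\<close> times the monomial \<open>B\<close> in the \<open>q\<^sub>n\<close>
  (\<open>n < 0\<close>) applied to \<open>|\<lambda>,\<mu>\<rangle>\<close>.\<close>

type_synonym pq_basis = "complex \<times> complex \<times> nat multiset \<times> nat multiset"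

definition p_mode :: "int \<Rightarrow> pq_basis fvec \<Rightarrow> pq_basis fvec"
  where "p_mode n = lin_ext (\<lambda>(l, m, A, B).
    osc_coeff 1 l n A *\<^sub>v basis (l, m, osc_mon n A, B))"

definition q_mode :: "int \<Rightarrow> pq_basis fvec \<Rightarrow> pq_basis fvec"
  where "q_mode n = lin_ext (\<lambda>(l, m, A, B).
    osc_coeff (- 1) (- m) n B *\<^sub>v basis (l, m, A, osc_mon n B))"

definition p_series :: "(pq_basis, pq_basis) opseries"
  where "p_series m = p_mode (- m - 1)"

definition q_series :: "(pq_basis, pq_basis) opseries"
  where "q_series m = q_mode (- m - 1)"

text \<open>\<open>(\<lambda>, M)\<close> is the monomial \<open>M\<close> in the \<open>b\<^sub>n\<close> applied to \<open>|\<lambda>\<rangle>\<close>.\<close>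

type_synonym b_basis = "complex \<times> nat multiset"

definition b_mode :: "complex \<Rightarrow> int \<Rightarrow> b_basis fvec \<Rightarrow> b_basis fvec"
  where "b_mode k n = lin_ext (\<lambda>(l, M).
    osc_coeff (2 * (k + 2)) l n M *\<^sub>v basis (l, osc_mon n M))"

definition b_series :: "complex \<Rightarrow> (b_basis, b_basis) opseries"
  where "b_series k m = b_mode k (- m - 1)"


section \<open>Vertex operators\<close>

definition pq_shift :: "complex \<Rightarrow> complex \<Rightarrow> pq_basis fvec \<Rightarrow> pq_basis fvec"
  where "pq_shift l m = lin_ext (\<lambda>(l', m', A, B). basis (l + l', m + m', A, B))"

text \<open>The coefficient of \<open>z\<^sup>s\<close>, \<open>s \<in> \<complex>\<close>, in \<open>V\<^bsub>\<lambda>,\<mu>\<^esub>(z)\<close>; on \<open>\<Pi>\<^bsub>\<lambda>',\<mu>'\<^esub>\<close> the exponents lie in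
  \<open>\<lambda>\<lambda>' - \<mu>\<mu>' + \<int>\<close>.\<close>

definition pq_vertex :: "complex \<Rightarrow> complex \<Rightarrow> complex \<Rightarrow> pq_basis fvec \<Rightarrow> pq_basis fvec"
  where "pq_vertex l m s = lin_ext (\<lambda>(l', m', A, B).
    let d = s - (l * l' - m * m') in
      if d \<in> \<int>
      then pq_shift l m
        (normal_exp (\<lambda>n v. l *\<^sub>v p_mode n v + m *\<^sub>v q_mode n v) \<lfloor>Re d\<rfloor> (basis (l', m', A, B)))
      else 0)"

text \<open>The integral powers of \<open>z\<close>; on every \<open>\<Pi>\<^sub>\<alpha>\<close> the series \<open>e\<^bsup>\<beta>(u+v)\<^esup>\<close> has no others.\<close>

definition pq_vertex_int :: "complex \<Rightarrow> complex \<Rightarrow> (pq_basis, pq_basis) opseries"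
  where "pq_vertex_int l m i = pq_vertex l m (of_int i)"

definition a_series_pow :: "complex \<Rightarrow> (pq_basis, pq_basis) opseries"
  where "a_series_pow \<alpha> = pq_vertex_int \<alpha> \<alpha>"

definition b_shift :: "complex \<Rightarrow> b_basis fvec \<Rightarrow> b_basis fvec"
  where "b_shift l = lin_ext (\<lambda>(l', M). basis (l + l', M))"

text \<open>\<open>V\<^bsub>2(k+2)\<^esub>(z)\<close> on \<open>\<pi>\<^sub>0\<close>, where \<open>b\<^sub>0 = 0\<close> and no power of \<open>z\<close> arises from the zero mode.\<close>

definition b_vertex :: "complex \<Rightarrow> (b_basis, b_basis) opseries"
  where "b_vertex k m v = b_shift (2 * (k + 2)) (normal_exp (b_mode k) m v)"


section \<open>The modules \<open>\<Pi>\<^sub>\<alpha>\<close> over the vertex algebra \<open>\<Pi>\<^sub>0\<close>\<close>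

definition Pi_basis :: "complex \<Rightarrow> pq_basis set"
  where "Pi_basis \<alpha> = {(of_int n + \<alpha>, of_int n + \<alpha>, A, B) | n A B. True}"

text \<open>The vertex operator of \<open>p\<^bsub>-n\<^sub>1-1\<^esub> \<dots> q\<^bsub>-m\<^sub>1-1\<^esub> \<dots> |\<lambda>,\<mu>\<rangle>\<close> is
  \<open>:\<partial>\<^bsup>n\<^sub>1\<^esup>p(z)/n\<^sub>1! \<dots> \<partial>\<^bsup>m\<^sub>1\<^esup>q(z)/m\<^sub>1! \<dots> V\<^bsub>\<lambda>,\<mu>\<^esub>(z):\<close>. The order of the factors is irrelevant, as the
  creation operators commute and so do the annihilation operators (including \<open>p\<^sub>0, q\<^sub>0\<close>);
  sorting only fixes a choice.\<close>

definition Y_basis :: "pq_basis \<Rightarrow> (pq_basis, pq_basis) opseries"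
  where "Y_basis = (\<lambda>(l, m, A, B).
    foldr (\<lambda>n. normal_prod (series_ddiff n p_series)) (sorted_list_of_multiset A)
      (foldr (\<lambda>n. normal_prod (series_ddiff n q_series)) (sorted_list_of_multiset B)
        (pq_vertex_int l m)))"

definition Y :: "pq_basis fvec \<Rightarrow> (pq_basis, pq_basis) opseries"
  where "Y u i v = lin_ext (\<lambda>x. Y_basis x i v) u"

definition vacuum :: "pq_basis fvec"
  where "vacuum = basis (0, 0, {#}, {#})"

definition a_series :: "(pq_basis, pq_basis) opseries"
  where "a_series = pq_vertex_int 1 1"

definition astar_series :: "(pq_basis, pq_basis) opseries"
  where "astar_series m v = - normal_prod p_series (pq_vertex_int (- 1) (- 1)) m v"

definition a_mode :: "int \<Rightarrow> pq_basis fvec \<Rightarrow> pq_basis fvec"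
  where "a_mode n = a_series (- n - 1)"

definition astar_mode :: "int \<Rightarrow> pq_basis fvec \<Rightarrow> pq_basis fvec"
  where "astar_mode n = astar_series (- n)"

text \<open>The products \<open>:a\<^sup>*a:\<close> and \<open>:(a\<^sup>*)\<^sup>2a:\<close> represent the vectors \<open>a\<^sup>*\<^sub>0 a\<^bsub>-1\<^esub>|0\<rangle>\<close> and
  \<open>a\<^sup>*\<^sub>0 a\<^sup>*\<^sub>0 a\<^bsub>-1\<^esub>|0\<rangle>\<close> of the Weyl vertex algebra; their images in \<open>\<Pi>\<^sub>0\<close> are obtained by letting
  the Weyl algebra act on the vacuum of \<open>\<Pi>\<^sub>0\<close>.\<close>

definition astar_a_series :: "(pq_basis, pq_basis) opseries"
  where "astar_a_series = Y (astar_mode 0 (a_mode (- 1) vacuum))"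

definition astar2_a_series :: "(pq_basis, pq_basis) opseries"
  where "astar2_a_series = Y (astar_mode 0 (astar_mode 0 (a_mode (- 1) vacuum)))"


section \<open>The \<open>sl\<^sub>2\<close>-hat-modules \<open>W\<^bsub>\<alpha>,\<lambda>,k\<^esub>\<close>\<close>

type_synonym w_basis = "pq_basis \<times> b_basis"

definition W_space :: "complex \<Rightarrow> complex \<Rightarrow> w_basis fvec set"
  where "W_space \<alpha> l = spanned (Pi_basis \<alpha> \<times> {(l, M) | M. True})"

datatype sl2_gen = E | H | F

text \<open>\<open>Loop x n\<close> is \<open>x \<otimes> t\<^sup>n\<close>.\<close>

datatype sl2hat_basis = Loop sl2_gen int | Central

type_synonym sl2hat = "sl2hat_basis fvec"

primrec current :: "complex \<Rightarrow> sl2_gen \<Rightarrow> (w_basis, w_basis) opseries"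
  where
    "current k E = series_tensor a_series series_one"
  | "current k H = (\<lambda>m v.
      (- 2) *\<^sub>v series_tensor astar_a_series series_one m v
      + series_tensor series_one (b_series k) m v)"
  | "current k F = (\<lambda>m v.
      - series_tensor astar2_a_series series_one m v
      + k *\<^sub>v series_tensor (series_ddiff 1 astar_series) series_one m v
      + series_tensor astar_series (b_series k) m v)"

text \<open>At level \<open>k\<close> the central element acts by the scalar \<open>k\<close>.\<close>

primrec W_act_basis :: "complex \<Rightarrow> sl2hat_basis \<Rightarrow> w_basis fvec \<Rightarrow> w_basis fvec"
  where
    "W_act_basis k (Loop x n) = current k x (- n - 1)"
  | "W_act_basis k Central = (*\<^sub>v) k"

definition W_act :: "complex \<Rightarrow> sl2hat \<Rightarrow> w_basis fvec \<Rightarrow> w_basis fvec"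
  where "W_act k x v = lin_ext (\<lambda>y. W_act_basis k y v) x"

definition intertwining ::
    "'x fvec set \<Rightarrow> (sl2hat \<Rightarrow> 'x fvec \<Rightarrow> 'x fvec) \<Rightarrow>
     'y fvec set \<Rightarrow> (sl2hat \<Rightarrow> 'y fvec \<Rightarrow> 'y fvec) \<Rightarrow>
     ('x fvec \<Rightarrow> 'y fvec) \<Rightarrow> bool"
  where "intertwining V act V' act' S \<longleftrightarrow>
    (\<forall>v\<in>V. S v \<in> V') \<and>
    (\<forall>v\<in>V. \<forall>w\<in>V. S (v + w) = S v + S w) \<and>
    (\<forall>c. \<forall>v\<in>V. S (c *\<^sub>v v) = c *\<^sub>v S v) \<and>
    (\<forall>x. \<forall>v\<in>V. S (act x v) = act' x (S v))"

definition screening :: "complex \<Rightarrow> w_basis fvec \<Rightarrow> w_basis fvec"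
  where "screening k = series_tensor (a_series_pow (- (k + 2))) (b_vertex k) (- 1)"

end

theory Submission
  imports Defs
begin

text \<open>
  Put \<open>x = u + v\<close>, \<open>\<beta> = -(k + 2)\<close>, \<open>G(z) = e\<^sup>-\<^sup>x(z)\<close> and \<open>S(z) = e\<^bsup>\<beta>x\<^esup>(z) V\<^bsub>2(k+2)\<^esub>(z)\<close>. The
  screening operator is the coefficient \<open>S\<^bsub>-1\<^esub>\<close> of \<open>z\<^sup>-\<^sup>1\<close> in \<open>S(z)\<close>, and the claim is that it
  commutes with the modes of \<open>e(z)\<close>, \<open>h(z)\<close> and \<open>f(z)\<close>. The commutators rest on charges: the
  boson modes satisfy \<open>[y\<^sub>n, S(w)] = g w\<^sup>n S(w)\<close> with \<open>g = \<beta>, -\<beta>, -2\<beta>\<close> for \<open>y = p, q, b\<close>.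

  For \<open>e(z) = e\<^sup>x(z)\<close> nothing happens, because \<open>p + q\<close> is an isotropic boson: its modes commute
  with each other and have charge \<open>0\<close> on \<open>e\<^bsup>\<beta>x\<^esup>\<close>. Evaluating \<open>a\<^sup>*\<^sub>0 a\<^bsub>-1\<^esub>|0\<rangle>\<close> in \<open>\<Pi>\<^sub>0\<close> gives
  \<open>q\<^bsub>-1\<^esub>|0\<rangle>\<close> (\<open>astar_a_vector\<close>), so \<open>h(z) = -2q(z) + b(z)\<close>, whose charge is \<open>2\<beta> - 2\<beta> = 0\<close>.

  The current \<open>f(z)\<close> is where the work is. Evaluating \<open>a\<^sup>*\<^sub>0 a\<^sup>*\<^sub>0 a\<^bsub>-1\<^esub>|0\<rangle>\<close> (\<open>astar2_a_vector\<close>)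
  shows that \<open>f = :p(pG): + 2:p(qG): - :(\<partial>p)G: - k \<partial>(:pG:) - :b(pG):\<close>. Let \<open>P(z) = G(z) S(z)\<close>, a
  product of commuting fields. Moving \<open>S\<^bsub>-1\<^esub>\<close> through a normally ordered product leaves, besides
  the normally ordered product with the inner commutator, a term \<open>:SG:\<close> in which \<open>S\<close> has
  replaced the boson (\<open>normal_prod_commutator\<close>); nested terms \<open>:S(yG):\<close> are brought back to \<open>P\<close>
  by \<open>:S(yG): = :yP: - g G\<partial>S\<close> (\<open>normal_prod_quasi_assoc\<close>). Altogether
  \<open>[f, S\<^bsub>-1\<^esub>] = \<beta>(2:(p+q)P: - :bP: - (\<beta>+1) G\<partial>S - k \<partial>P)\<close>. Since \<open>\<partial>G = -:(p+q)G:\<close> and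
  \<open>\<partial>S = \<beta>:(p+q)S: + :bS:\<close>, one has \<open>G\<partial>S = \<beta>:(p+q)P: + :bP:\<close> and \<open>\<partial>P = G\<partial>S - :(p+q)P:\<close>. The
  coefficient of \<open>:(p+q)P:\<close> becomes \<open>2 - \<beta>(\<beta>+1) - k\<beta> + k = (k + 2 + \<beta>)(1 - \<beta>)\<close> and that of
  \<open>:bP:\<close> becomes \<open>-1 - (\<beta>+1) - k = -(k + 2 + \<beta>)\<close>; both vanish because \<open>\<beta> = -(k+2)\<close>. This is
  \<open>f_current_screening\<close>. The derivative rules hold without the zero modes of \<open>p + q\<close> and \<open>b\<close>,
  and those are \<open>0\<close> on \<open>W\<^bsub>0,0,k\<^esub>\<close>; this is where the source module enters.

  What remains is to establish charges and derivatives for the vertex operators from their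
  definition as exponentials. Both are proved for exponentials of series with only positive or
  only negative powers of \<open>z\<close> (\<open>charged_exp\<close>, \<open>exp_euler\<close>), hence for normally ordered
  exponentials, and are carried over to the tensor product \<open>\<Pi>\<^sub>\<alpha> \<otimes> \<pi>\<^sub>\<lambda>\<close>, on one factor of which
  each field acts.
\<close>

section \<open>Linear operators and sums with finite support\<close>

lemma lookup_scale [simp]: "Poly_Mapping.lookup (c *\<^sub>v v) x = c * Poly_Mapping.lookup v x"
  unfolding scale_def by (simp add: Poly_Mapping.map.rep_eq when_def)

global_interpretation vec: module scale
  by unfold_locales
    (auto intro!: poly_mapping_eqI simp: lookup_add algebra_simps)

abbreviation linop :: "('x fvec \<Rightarrow> 'y fvec) \<Rightarrow> bool"
  where "linop \<equiv> module_hom scale scale"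

lemma linopI:
  assumes "\<And>v w. T (v + w) = T v + T w" "\<And>c v. T (c *\<^sub>v v) = c *\<^sub>v T v"
  shows "linop T"
  using assms by (intro module_hom.intro module_hom_axioms.intro vec.module_axioms) auto

lemmas linop_simps = module_hom.add module_hom.scale module_hom.diff module_hom.neg
  module_hom.zero

lemma linop_comp: "linop (\<lambda>v. T (U v))" if "linop T" "linop U"
  using that by (auto intro!: linopI simp: linop_simps)

lemma linop_add: "linop (\<lambda>v. T v + U v)" if "linop T" "linop U"
  using that by (auto intro!: linopI simp: linop_simps vec.scale_right_distrib)

lemma linop_scale: "linop (\<lambda>v. c *\<^sub>v T v)" if "linop T"
  using that by (auto intro!: linopI simp: linop_simps vec.scale_right_distrib mult.commute)

lemma linop_uminus: "linop (\<lambda>v. - T v)" if "linop T"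
  using that by (auto intro!: linopI simp: linop_simps)

lemma linop_id: "linop (\<lambda>v. v)" and linop_zero: "linop (\<lambda>v. 0)"
  by (auto intro!: linopI)

lemma linop_if: "linop (\<lambda>v. if P then T v else U v)" if "linop T" "linop U"
  using that by (cases P) auto

lemmas linop_intros = linop_add linop_scale linop_uminus linop_id linop_zero linop_if

lemma lin_ext_superset:
  assumes "finite K" "Poly_Mapping.keys v \<subseteq> K"
  shows "lin_ext f v = (\<Sum>x\<in>K. Poly_Mapping.lookup v x *\<^sub>v f x)"
  unfolding lin_ext_def
  by (rule sum.mono_neutral_left) (use assms in \<open>auto simp: in_keys_iff\<close>)

lemma lin_ext_basis [simp]: "lin_ext f (basis x) = f x"
  by (simp add: lin_ext_def)

lemma linop_lin_ext [simp, intro]: "linop (lin_ext f)"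
proof (rule linopI)
  fix v w :: "'a fvec" and c
  let ?K = "Poly_Mapping.keys v \<union> Poly_Mapping.keys w"
  have K: "finite ?K" "Poly_Mapping.keys (v + w) \<subseteq> ?K" by (auto simp: Poly_Mapping.keys_add)
  show "lin_ext f (v + w) = lin_ext f v + lin_ext f w"
    by (subst (1 2 3) lin_ext_superset[of ?K])
      (use K in \<open>auto simp: lookup_add vec.scale_left_distrib sum.distrib\<close>)
  have "Poly_Mapping.keys (c *\<^sub>v v) \<subseteq> Poly_Mapping.keys v"
    by (auto simp: in_keys_iff)
  then show "lin_ext f (c *\<^sub>v v) = c *\<^sub>v lin_ext f v"
    by (subst (1 2) lin_ext_superset[of "Poly_Mapping.keys v"])
      (auto simp: vec.scale_sum_right)
qed

lemma lin_ext_basis_id: "lin_ext basis v = v"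
  by (rule poly_mapping_eqI)
    (auto simp: lin_ext_def lookup_sum lookup_single when_def in_keys_iff sum.If_cases
      if_distrib[of "\<lambda>y. _ * y"] cong: if_cong)

lemma linop_eq_lin_ext:
  assumes "linop T"
  shows "T v = lin_ext (\<lambda>x. T (basis x)) v"
proof -
  have "T v = T (lin_ext basis v)" by (simp add: lin_ext_basis_id)
  also have "\<dots> = lin_ext (\<lambda>x. T (basis x)) v"
    using assms by (simp add: lin_ext_def module_hom.sum module_hom.scale)
  finally show ?thesis .
qed

lemma lin_ext_cong_on: "(\<And>x. x \<in> Poly_Mapping.keys v \<Longrightarrow> f x = g x) \<Longrightarrow> lin_ext f v = lin_ext g v"
  by (simp add: lin_ext_def)

lemma spanned_0: "0 \<in> spanned K"
  by (simp add: spanned_def)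

lemma spanned_add: "v \<in> spanned K \<Longrightarrow> w \<in> spanned K \<Longrightarrow> v + w \<in> spanned K"
  using Poly_Mapping.keys_add[of v w] by (auto simp: spanned_def)

lemma spanned_scale: "v \<in> spanned K \<Longrightarrow> c *\<^sub>v v \<in> spanned K"
  by (auto simp: spanned_def in_keys_iff)

lemma spanned_uminus: "v \<in> spanned K \<Longrightarrow> - v \<in> spanned K"
  by (simp add: spanned_def)

lemma spanned_sum: "(\<And>i. i \<in> I \<Longrightarrow> f i \<in> spanned K) \<Longrightarrow> sum f I \<in> spanned K"
  by (induction I rule: infinite_finite_induct) (auto intro: spanned_0 spanned_add)

lemma spanned_Sum_any: "(\<And>i. f i \<in> spanned K) \<Longrightarrow> Sum_any f \<in> spanned K"
  by (simp add: Sum_any.expand_set spanned_sum)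

lemma spanned_basis: "basis x \<in> spanned K \<longleftrightarrow> x \<in> K"
  by (simp add: spanned_def)

lemma spanned_lin_ext: "v \<in> spanned K \<Longrightarrow> (\<And>x. x \<in> K \<Longrightarrow> f x \<in> spanned L) \<Longrightarrow> lin_ext f v \<in> spanned L"
  unfolding lin_ext_def by (intro spanned_sum spanned_scale) (auto simp: spanned_def)

lemma spanned_linop: "linop T \<Longrightarrow> v \<in> spanned K \<Longrightarrow> (\<And>x. x \<in> K \<Longrightarrow> T (basis x) \<in> spanned L) \<Longrightarrow>
    T v \<in> spanned L"
  using spanned_lin_ext[of v K "\<lambda>x. T (basis x)" L] by (simp add: linop_eq_lin_ext[of T v, symmetric])

lemma linop_eqI_on:
  assumes "linop T" "linop U" "\<And>x. x \<in> Poly_Mapping.keys v \<Longrightarrow> T (basis x) = U (basis x)"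
  shows "T v = U v"
proof -
  have "T v = lin_ext (\<lambda>x. T (basis x)) v" by (rule linop_eq_lin_ext[OF assms(1)])
  also have "\<dots> = lin_ext (\<lambda>x. U (basis x)) v" by (rule lin_ext_cong_on[OF assms(3)])
  also have "\<dots> = U v" by (rule linop_eq_lin_ext[OF assms(2), symmetric])
  finally show ?thesis .
qed

text \<open>\<open>Sum_any\<close> is \<open>0\<close> on families with infinite support, so every manipulation below has to be
  accompanied by a proof of finite support.\<close>
definition finsupp :: "('i \<Rightarrow> 'a::zero) \<Rightarrow> bool"
  where "finsupp f \<longleftrightarrow> finite {i. f i \<noteq> 0}"

lemma finsuppI: "finite K \<Longrightarrow> (\<And>i. i \<notin> K \<Longrightarrow> f i = 0) \<Longrightarrow> finsupp f"
  unfolding finsupp_def by (rule finite_subset[of _ K]) auto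

lemma finsupp_int: "(\<And>i. i < a \<or> i > b \<Longrightarrow> f i = 0) \<Longrightarrow> finsupp f" for f :: "int \<Rightarrow> 'a::zero"
  by (rule finsuppI[of "{a..b}"]) auto

lemma finsupp_mono: "finsupp f" if "finsupp g" "\<And>i. g i = 0 \<Longrightarrow> f i = 0"
  using that unfolding finsupp_def by (auto elim!: rev_finite_subset)

lemma finsupp_add: "finsupp (\<lambda>i. f i + g i)" if "finsupp f" "finsupp g"
  for f g :: "'i \<Rightarrow> 'a::monoid_add"
  using that unfolding finsupp_def
  by (rule_tac finite_subset[of _ "{i. f i \<noteq> 0} \<union> {i. g i \<noteq> 0}"]) auto

lemma finsupp_linop: "finsupp (\<lambda>i. T (f i))" if "linop T" "finsupp f"
  using that by (auto intro: finsupp_mono simp: linop_simps)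

lemma Sum_any_finsupp_add: "Sum_any (\<lambda>i. f i + g i) = Sum_any f + Sum_any g"
  if "finsupp f" "finsupp g"
  using that unfolding finsupp_def by (rule Sum_any.distrib)

lemma linop_Sum_any: "T (Sum_any f) = Sum_any (\<lambda>i. T (f i))" if "linop T" "finsupp f"
proof -
  have "Sum_any (\<lambda>i. T (f i)) = (\<Sum>i\<in>{i. f i \<noteq> 0}. T (f i))"
    by (rule Sum_any.expand_superset) (use that in \<open>auto simp: finsupp_def linop_simps\<close>)
  then show ?thesis using that by (simp add: Sum_any.expand_set module_hom.sum)
qed

lemma scale_Sum_any: "c *\<^sub>v Sum_any f = Sum_any (\<lambda>i. c *\<^sub>v f i)" if "finsupp f"
  by (rule linop_Sum_any) (use that in \<open>auto intro: linop_intros\<close>)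

lemma linop_Sum_any_ops:
  assumes "\<And>i. linop (T i)" "\<And>v. finsupp (\<lambda>i. T i v)"
  shows "linop (\<lambda>v. Sum_any (\<lambda>i. T i v))"
proof (rule linopI)
  fix v w c
  have "Sum_any (\<lambda>i. T i (v + w)) = Sum_any (\<lambda>i. T i v + T i w)"
    by (simp add: module_hom.add[OF assms(1)])
  then show "Sum_any (\<lambda>i. T i (v + w)) = Sum_any (\<lambda>i. T i v) + Sum_any (\<lambda>i. T i w)"
    using Sum_any_finsupp_add[OF assms(2) assms(2)] by simp
  have "Sum_any (\<lambda>i. T i (c *\<^sub>v v)) = Sum_any (\<lambda>i. c *\<^sub>v T i v)"
    by (simp add: module_hom.scale[OF assms(1)])
  then show "Sum_any (\<lambda>i. T i (c *\<^sub>v v)) = c *\<^sub>v Sum_any (\<lambda>i. T i v)"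
    using scale_Sum_any[OF assms(2)] by simp
qed

lemma Sum_any_pair:
  assumes "finsupp (\<lambda>(i, j). f i j)"
  shows "Sum_any (\<lambda>i. Sum_any (\<lambda>j. f i j)) = Sum_any (\<lambda>(i, j). f i j)"
proof -
  let ?K = "{p. (case p of (i, j) \<Rightarrow> f i j) \<noteq> 0}"
  show ?thesis
    by (rule Sum_any.cartesian_product[of "fst ` ?K \<times> snd ` ?K"])
      (use assms in \<open>auto simp: finsupp_def image_iff\<close>)
qed

lemma Sum_any_swap:
  assumes "finsupp (\<lambda>(i, j). f i j)"
  shows "Sum_any (\<lambda>i. Sum_any (\<lambda>j. f i j)) = Sum_any (\<lambda>j. Sum_any (\<lambda>i. f i j))"
proof -
  let ?K = "{p. (case p of (i, j) \<Rightarrow> f i j) \<noteq> 0}"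
  show ?thesis
    by (rule Sum_any.swap[of "fst ` ?K \<times> snd ` ?K"])
      (use assms in \<open>auto simp: finsupp_def image_iff\<close>)
qed

lemma Sum_any_reindex: "bij h \<Longrightarrow> Sum_any (\<lambda>i. f (h i)) = Sum_any f"
  by (rule Sum_any.reindex_cong[symmetric]) auto

lemma bij_int_reflect: "bij (\<lambda>i::int. a - i)" and bij_int_shift: "bij (\<lambda>i::int. i + a)"
  by (rule bij_betw_byWitness[of _ "\<lambda>i. a - i"], auto,
      rule bij_betw_byWitness[of _ "\<lambda>i. i - a"], auto)

section \<open>Fields and their normally ordered products\<close>

text \<open>A field in the sense of vertex algebras. Indices are exponents of \<open>z\<close>, so the truncation
  condition bounds them below on each vector.\<close>
definition vfield :: "('x, 'y) opseries \<Rightarrow> bool"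
  where "vfield A \<longleftrightarrow> (\<forall>m. linop (A m)) \<and> (\<forall>v. \<exists>N. \<forall>m<N. A m v = 0)"

definition commuting :: "('x, 'x) opseries \<Rightarrow> ('x, 'x) opseries \<Rightarrow> bool"
  where "commuting A B \<longleftrightarrow> (\<forall>i j v. A i (B j v) = B j (A i v))"

text \<open>For \<open>A(z)\<close> with coefficients \<open>A m\<close> the relation reads \<open>[Z, A(z)] = g z\<^bsup>-s\<^esup> A(z)\<close>: a boson
  mode \<open>y\<^sub>n\<close> acting on a vertex operator of charge \<open>g\<close> has \<open>s = -n\<close>, and the coefficient
  \<open>y i = y\<^bsub>-i-1\<^esub>\<close> of the boson has \<open>s = i + 1\<close>. Charge \<open>0\<close> means that \<open>Z\<close> commutes with the
  field, for any \<open>s\<close>.\<close>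
definition charged :: "('x fvec \<Rightarrow> 'x fvec) \<Rightarrow> int \<Rightarrow> complex \<Rightarrow> ('x, 'x) opseries \<Rightarrow> bool"
  where "charged Z s g A \<longleftrightarrow> (\<forall>m v. Z (A m v) = A m (Z v) + g *\<^sub>v A (m + s) v)"

lemma vfield_linop: "vfield A \<Longrightarrow> linop (A m)"
  by (simp add: vfield_def)

lemma vfield_zero: "vfield A \<Longrightarrow> A m 0 = 0"
  by (rule module_hom.zero[OF vfield_linop])

text \<open>Any lower bound would do; a fixed choice avoids eliminating an existential quantifier in
  each support estimate.\<close>
definition lowest :: "('x, 'y) opseries \<Rightarrow> 'x fvec \<Rightarrow> int"
  where "lowest A v = (SOME N. \<forall>m<N. A m v = 0)"

lemma vfield_lowest:
  assumes "vfield A" "m < lowest A v"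
  shows "A m v = 0"
proof -
  have "\<exists>N. \<forall>m<N. A m v = 0" using assms(1) by (simp add: vfield_def)
  from someI_ex[OF this] show ?thesis using assms(2) by (simp add: lowest_def)
qed

lemma vfieldI:
  assumes "\<And>m. linop (A m)" "\<And>v. \<exists>N. \<forall>m<N. A m v = 0"
  shows "vfield A"
  using assms by (simp add: vfield_def)

lemma commuting_sym: "commuting A B \<Longrightarrow> commuting B A"
  by (simp add: commuting_def)

lemma commutingD: "commuting A B \<Longrightarrow> A i (B j v) = B j (A i v)"
  by (simp add: commuting_def)

lemma charged_0I: "commuting A B \<Longrightarrow> charged (A i) s 0 B"
  by (simp add: charged_def commuting_def)

lemma vfield_add: "vfield (\<lambda>m v. A m v + B m v)" if "vfield A" "vfield B"
proof (rule vfieldI)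
  show "linop (\<lambda>v. A m v + B m v)" for m
    by (intro linop_intros) (use that in \<open>auto intro: vfield_linop\<close>)
  show "\<exists>N. \<forall>m<N. A m v + B m v = 0" for v
    by (intro exI[of _ "min (lowest A v) (lowest B v)"]) (use that in \<open>auto simp: vfield_lowest\<close>)
qed

lemma vfield_scale: "vfield (\<lambda>m v. c *\<^sub>v A m v)" if "vfield A"
proof (rule vfieldI)
  show "linop (\<lambda>v. c *\<^sub>v A m v)" for m
    by (intro linop_intros) (use that in \<open>auto intro: vfield_linop\<close>)
  show "\<exists>N. \<forall>m<N. c *\<^sub>v A m v = 0" for v
    by (intro exI[of _ "lowest A v"]) (use that in \<open>auto simp: vfield_lowest\<close>)
qed

lemma vfield_basisI:
  fixes A :: "('x, 'y) opseries"
  assumes lin: "\<And>m. linop (A m)" and "\<And>x. \<exists>N. \<forall>m<N. A m (basis x) = 0"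
  shows "vfield A"
proof (rule vfieldI[OF lin])
  fix v :: "'x fvec"
  obtain N where N: "\<And>x m. m < N x \<Longrightarrow> A m (basis x) = 0" using assms(2) by metis
  let ?N = "Min (insert 0 (N ` Poly_Mapping.keys v))"
  have "A m v = 0" if "m < ?N" for m
  proof (rule linop_eqI_on[OF lin linop_zero])
    fix x assume "x \<in> Poly_Mapping.keys v"
    then have "?N \<le> N x" by (intro Min_le) auto
    then show "A m (basis x) = 0" using that by (intro N) linarith
  qed
  then show "\<exists>N. \<forall>m<N. A m v = 0" by blast
qed

lemma series_ddiff_1: "series_ddiff 1 A m v = of_int (m + 1) *\<^sub>v A (m + 1) v"
  by (simp add: series_ddiff_def)

lemmas series_ddiff_Suc_0 = series_ddiff_1[unfolded One_nat_def]

lemma series_ddiff_0: "series_ddiff 0 A = A"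
  by (auto simp: series_ddiff_def fun_eq_iff)

lemma vfield_ddiff: "vfield (series_ddiff 1 A)" if "vfield A"
proof (rule vfieldI)
  show "linop (series_ddiff 1 A m)" for m
    unfolding series_ddiff_1[abs_def] by (intro linop_intros vfield_linop that)
  show "\<exists>N. \<forall>m<N. series_ddiff 1 A m v = 0" for v
    by (intro exI[of _ "lowest A v - 1"]) (use that in \<open>auto simp: series_ddiff_Suc_0 vfield_lowest\<close>)
qed

abbreviation np_term :: "('x, 'x) opseries \<Rightarrow> ('x, 'x) opseries \<Rightarrow> int \<Rightarrow> 'x fvec \<Rightarrow> int \<Rightarrow> 'x fvec"
  where "np_term A B m v i \<equiv> (if i \<ge> 0 then A i (B (m - i) v) else B (m - i) (A i v))"

lemma finsupp_np_term: "finsupp (np_term A B m v)" if "vfield A" "vfield B"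
proof (rule finsupp_int[of "min 0 (lowest A v)" "max 0 (m - lowest B v)"])
  fix i assume "i < min 0 (lowest A v) \<or> i > max 0 (m - lowest B v)"
  then consider "i < 0" "A i v = 0" | "i \<ge> 0" "B (m - i) v = 0"
    using vfield_lowest[OF \<open>vfield A\<close>, of i v] vfield_lowest[OF \<open>vfield B\<close>, of "m - i" v]
    by (cases "i < 0") auto
  then show "np_term A B m v i = 0"
    by cases (simp_all add: vfield_zero[OF that(1)] vfield_zero[OF that(2)])
qed

text \<open>The negative part of \<open>A\<close> has only finitely many nonzero terms on \<open>v\<close>, so finitely many
  truncation bounds of \<open>B\<close>, at the vectors \<open>A i v\<close>, give one for the product.\<close>
lemma vfield_normal_prod: "vfield (normal_prod A B)" if "vfield A" "vfield B"
proof (rule vfieldI)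
  show "linop (normal_prod A B m)" for m
    unfolding normal_prod_def[abs_def]
    using linop_comp[OF vfield_linop[OF that(1)] vfield_linop[OF that(2)]]
      linop_comp[OF vfield_linop[OF that(2)] vfield_linop[OF that(1)]]
    by (intro linop_Sum_any_ops finsupp_np_term linop_if that)
  show "\<exists>N. \<forall>m<N. normal_prod A B m v = 0" for v
  proof -
    let ?N = "lowest A v" and ?K = "\<lambda>i. lowest B (A i v)"
    \<comment> \<open>The range of \<open>i\<close> is where \<open>A i v\<close> can be nonzero with \<open>i < 0\<close>.\<close>
    let ?L = "Min (insert (lowest B v) ((\<lambda>i. ?K i + i) ` {?N..-1}))"
    have L: "?L \<le> lowest B v" "\<And>i. ?N \<le> i \<Longrightarrow> i < 0 \<Longrightarrow> ?L \<le> ?K i + i"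
      by (rule Min_le; simp)+
    have "np_term A B m v i = 0" if m: "m < ?L" for m i
    proof (cases "i \<ge> 0")
      case True
      then have "m - i < lowest B v" using m L(1) by linarith
      then show ?thesis
        using True by (simp add: vfield_lowest[OF \<open>vfield B\<close>] vfield_zero[OF \<open>vfield A\<close>])
    next
      case False
      have "A i v = 0 \<or> m - i < ?K i"
      proof (cases "i < ?N")
        case i: False
        then have "m - i < ?K i" using m L(2)[of i] False by linarith
        then show ?thesis ..
      qed (simp add: vfield_lowest[OF \<open>vfield A\<close>])
      then show ?thesis
        using False vfield_lowest[OF \<open>vfield B\<close>, of "m - i" "A i v"] vfield_zero[OF \<open>vfield B\<close>]
        by auto
    qed
    then show ?thesis by (intro exI[of _ ?L]) (simp add: normal_prod_def)
  qed
qed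

text \<open>The unordered product of two fields is in general undefined. If they commute, either
  factor may act first, and the truncation of both bounds the sum on both sides.\<close>
lemma finsupp_series_comp: "finsupp (\<lambda>i. A i (B (m - i) v))"
  if "vfield A" "vfield B" "commuting A B"
proof (rule finsupp_int[of "lowest A v" "m - lowest B v"])
  fix i assume "i < lowest A v \<or> i > m - lowest B v"
  then have "A i v = 0 \<or> B (m - i) v = 0"
    using vfield_lowest[OF that(1), of i v] vfield_lowest[OF that(2), of "m - i" v] by auto
  then show "A i (B (m - i) v) = 0"
    using vfield_zero[OF that(1)] vfield_zero[OF that(2)] commutingD[OF that(3), of i "m - i" v]
    by auto
qed

lemma normal_prod_commuting: "normal_prod A B m v = series_comp B A m v" if "commuting A B"
proof -
  have "normal_prod A B m v = Sum_any (\<lambda>i. B (m - i) (A i v))"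
    unfolding normal_prod_def by (intro Sum_any.cong) (simp add: commutingD[OF that])
  also have "\<dots> = Sum_any (\<lambda>i. B i (A (m - i) v))"
    by (subst Sum_any_reindex[OF bij_int_reflect[of m], symmetric]) simp
  finally show ?thesis by (simp add: series_comp_def)
qed

lemma series_comp_commute: "series_comp A B m v = series_comp B A m v" if "commuting A B"
  unfolding series_comp_def
  by (subst Sum_any_reindex[OF bij_int_reflect[of m], symmetric]) (simp add: commutingD[OF that])

lemma vfield_series_comp: "vfield (series_comp A B)" if "vfield A" "vfield B" "commuting A B"
proof -
  have "series_comp A B = normal_prod B A"
    using normal_prod_commuting[OF commuting_sym[OF that(3)]] by (intro ext) simp
  then show ?thesis using vfield_normal_prod[OF that(2,1)] by simp
qed

text \<open>Taking the commutator with \<open>Z\<close> is a derivation. Finiteness of the product is a hypothesis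
  because the lemma is also applied to the creation and annihilation exponentials, which do not
  commute.\<close>
lemma charged_series_comp:
  assumes Z: "linop Z" and A: "\<And>m. linop (A m)"
    and cA: "charged Z s g A" and cB: "charged Z s h B"
    and fin: "\<And>m v. finsupp (\<lambda>i. A i (B (m - i) v))"
  shows "charged Z s (g + h) (series_comp A B)"
  unfolding charged_def
proof (intro allI)
  fix m v
  have fin': "finsupp (\<lambda>i. A (i + s) (B (m - i) v))"
  proof -
    have "finite {i. A (i + s) (B (m - i) v) \<noteq> 0}"
      by (rule finite_subset[OF _ finite_imageI[OF fin[unfolded finsupp_def, of "m + s" v], of "\<lambda>i. i - s"]])
        (auto simp: image_iff intro!: exI[of _ "_ + s"])
    then show ?thesis by (simp add: finsupp_def)
  qed
  have "Z (series_comp A B m v) = Sum_any (\<lambda>i. Z (A i (B (m - i) v)))"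
    unfolding series_comp_def by (rule linop_Sum_any[OF Z fin])
  also have "\<dots> = Sum_any (\<lambda>i. (A i (B (m - i) (Z v)) + h *\<^sub>v A i (B (m + s - i) v))
      + g *\<^sub>v A (i + s) (B (m - i) v))"
    using cA cB by (simp add: charged_def module_hom.add[OF A] module_hom.scale[OF A] algebra_simps)
  also have "\<dots> = Sum_any (\<lambda>i. A i (B (m - i) (Z v))) + h *\<^sub>v Sum_any (\<lambda>i. A i (B (m + s - i) v))
      + g *\<^sub>v Sum_any (\<lambda>i. A (i + s) (B (m - i) v))"
    by (simp add: Sum_any_finsupp_add scale_Sum_any fin fin' finsupp_add
        finsupp_linop[OF linop_scale[OF linop_id]])
  also have "Sum_any (\<lambda>i. A (i + s) (B (m - i) v)) = Sum_any (\<lambda>i. A i (B (m + s - i) v))"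
    by (subst Sum_any_reindex[OF bij_int_shift[of s], symmetric]) (simp add: algebra_simps)
  finally show "Z (series_comp A B m v) = series_comp A B m (Z v) + (g + h) *\<^sub>v series_comp A B (m + s) v"
    by (simp add: series_comp_def vec.scale_left_distrib algebra_simps)
qed

lemma ddiff_series_comp:
  assumes A: "\<And>m. linop (A m)" and fin: "\<And>m v. finsupp (\<lambda>i. A i (B (m - i) v))"
  shows "series_ddiff 1 (series_comp A B) m v =
    series_comp (series_ddiff 1 A) B m v + series_comp A (series_ddiff 1 B) m v"
proof -
  let ?h = "\<lambda>i. A i (B (m + 1 - i) v)"
  have f: "finsupp (\<lambda>i. c i *\<^sub>v ?h i)" for c
    by (rule finsupp_mono[OF fin[of "m + 1" v]]) simp
  have "series_ddiff 1 (series_comp A B) m v = Sum_any (\<lambda>i. of_int (m + 1) *\<^sub>v ?h i)"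
    by (simp add: series_ddiff_Suc_0 series_comp_def scale_Sum_any[OF fin])
  also have "\<dots> = Sum_any (\<lambda>i. of_int i *\<^sub>v ?h i + of_int (m + 1 - i) *\<^sub>v ?h i)"
    by (simp add: vec.scale_left_distrib[symmetric])
  also have "\<dots> = Sum_any (\<lambda>i. of_int i *\<^sub>v ?h i) + Sum_any (\<lambda>i. of_int (m + 1 - i) *\<^sub>v ?h i)"
    by (rule Sum_any_finsupp_add[OF f f])
  also have "Sum_any (\<lambda>i. of_int i *\<^sub>v ?h i) = series_comp (series_ddiff 1 A) B m v"
    unfolding series_comp_def series_ddiff_1
    by (subst Sum_any_reindex[OF bij_int_shift[of 1], symmetric]) (simp add: algebra_simps)
  also have "Sum_any (\<lambda>i. of_int (m + 1 - i) *\<^sub>v ?h i) = series_comp A (series_ddiff 1 B) m v"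
    unfolding series_comp_def series_ddiff_1
    by (intro Sum_any.cong) (simp only: module_hom.scale[OF A] diff_add_eq)
  finally show ?thesis .
qed

lemma normal_prod_scale_left:
  assumes "vfield A" "vfield B"
  shows "normal_prod (\<lambda>m v. c *\<^sub>v A m v) B m v = c *\<^sub>v normal_prod A B m v"
  unfolding normal_prod_def scale_Sum_any[OF finsupp_np_term[OF assms]]
  by (intro Sum_any.cong) (simp add: module_hom.scale[OF vfield_linop[OF assms(2)]])

lemma normal_prod_scale_right:
  assumes "vfield A" "vfield B"
  shows "normal_prod A (\<lambda>m v. c *\<^sub>v B m v) m v = c *\<^sub>v normal_prod A B m v"
  unfolding normal_prod_def scale_Sum_any[OF finsupp_np_term[OF assms]]
  by (intro Sum_any.cong) (simp add: module_hom.scale[OF vfield_linop[OF assms(1)]])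

lemma vfield_0: "vfield (\<lambda>m v. 0)"
  by (rule vfieldI) (auto intro: linop_zero)

lemma normal_prod_zero_right: "vfield A \<Longrightarrow> normal_prod A (\<lambda>m v. 0) m v = 0"
  by (simp add: normal_prod_def vfield_zero cong: if_cong)

lemma normal_prod_add_left:
  assumes "vfield A" "vfield A'" "vfield B"
  shows "normal_prod (\<lambda>m v. A m v + A' m v) B m v = normal_prod A B m v + normal_prod A' B m v"
proof -
  have "np_term (\<lambda>m v. A m v + A' m v) B m v i = np_term A B m v i + np_term A' B m v i" for i
    by (simp add: module_hom.add[OF vfield_linop[OF assms(3)]])
  then show ?thesis
    unfolding normal_prod_def
    by (simp only: Sum_any_finsupp_add[OF finsupp_np_term[OF assms(1,3)] finsupp_np_term[OF assms(2,3)]])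
qed

lemma normal_prod_cong_left:
  "(\<And>i w. i \<ge> 0 \<Longrightarrow> A i w = A' i w) \<Longrightarrow> (\<And>i. i < 0 \<Longrightarrow> A i v = A' i v) \<Longrightarrow>
    normal_prod A B m v = normal_prod A' B m v"
  unfolding normal_prod_def by (intro Sum_any.cong) simp

lemma normal_prod_cong_on:
  assumes "\<And>m v. v \<in> U \<Longrightarrow> B m v = B' m v" "\<And>m v. v \<in> U \<Longrightarrow> A m v \<in> U" "v \<in> U"
  shows "normal_prod A B m v = normal_prod A B' m v"
  unfolding normal_prod_def by (intro Sum_any.cong) (simp add: assms)

lemma spanned_normal_prod:
  assumes "\<And>m v. v \<in> spanned K \<Longrightarrow> A m v \<in> spanned K" "\<And>m v. v \<in> spanned K \<Longrightarrow> B m v \<in> spanned K"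
    "v \<in> spanned K"
  shows "normal_prod A B m v \<in> spanned K"
  unfolding normal_prod_def by (intro spanned_Sum_any) (simp add: assms)

lemma spanned_ddiff:
  assumes "\<And>m v. v \<in> spanned K \<Longrightarrow> A m v \<in> spanned K" "v \<in> spanned K"
  shows "series_ddiff 1 A m v \<in> spanned K"
  unfolding series_ddiff_1 by (intro spanned_scale assms)

lemma normal_prod_linop_commute:
  assumes "vfield A" "vfield B" "linop Z"
    and "\<And>i v. Z (A i v) = A i (Z v)" "\<And>i v. Z (B i v) = B i (Z v)"
  shows "Z (normal_prod A B m v) = normal_prod A B m (Z v)"
  unfolding normal_prod_def linop_Sum_any[OF assms(3) finsupp_np_term[OF assms(1,2)]]
  by (intro Sum_any.cong) (simp add: assms(4,5))

lemma commuting_normal_prod: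
  assumes "vfield A" "vfield B" "vfield C" "commuting C A" "commuting C B"
  shows "commuting C (normal_prod A B)"
  unfolding commuting_def
  using normal_prod_linop_commute[OF assms(1,2) vfield_linop[OF assms(3)]] assms(4,5)
  by (simp add: commuting_def)

lemma series_comp_scale_left:
  assumes "vfield A" "vfield B" "commuting A B"
  shows "series_comp (\<lambda>m v. c *\<^sub>v A m v) B m v = c *\<^sub>v series_comp A B m v"
  unfolding series_comp_def by (simp add: scale_Sum_any[OF finsupp_series_comp[OF assms]])

text \<open>The derivative of a vertex operator produces its boson without zero mode, since the factor
  \<open>z\<close> to the power of the zero mode is not part of the normally ordered exponential.\<close>
definition no_zero_mode :: "('x, 'x) opseries \<Rightarrow> ('x, 'x) opseries"
  where "no_zero_mode A m v = (if m = - 1 then 0 else A m v)"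

lemma vfield_no_zero_mode:
  assumes "vfield A"
  shows "vfield (no_zero_mode A)"
proof (rule vfieldI)
  show "linop (no_zero_mode A m)" for m
    unfolding no_zero_mode_def[abs_def] by (intro linop_if linop_zero vfield_linop[OF assms])
  show "\<exists>N. \<forall>m<N. no_zero_mode A m v = 0" for v
    by (intro exI[of _ "lowest A v"]) (simp add: no_zero_mode_def vfield_lowest[OF assms])
qed

lemma commuting_no_zero_mode:
  assumes "vfield A" "commuting A B"
  shows "commuting A (no_zero_mode B)"
  unfolding commuting_def
proof (intro allI)
  show "A i (no_zero_mode B j v) = no_zero_mode B j (A i v)" for i j v
    by (simp add: no_zero_mode_def vfield_zero[OF assms(1)] commutingD[OF assms(2)])
qed

text \<open>In the terms with \<open>i \<ge> 0\<close> the boson coefficient stands to the left of \<open>G\<close>, in the others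
  to its right. The commutators of \<open>T\<close> with it therefore reassemble into \<open>:DG:\<close>, ordered as if
  \<open>D\<close> were the boson.\<close>
lemma normal_prod_commutator:
  assumes u: "vfield u" and G: "vfield G" and T: "linop T" and D: "vfield D" and C: "vfield C"
    and uT: "\<And>i v. u i (T v) = T (u i v) + g *\<^sub>v D i v"
    and GT: "\<And>i v. G i (T v) = T (G i v) + C i v"
  shows "normal_prod u G m (T v) =
    T (normal_prod u G m v) + normal_prod u C m v + g *\<^sub>v normal_prod D G m v"
proof -
  have "np_term u G m (T v) i = T (np_term u G m v i) + np_term u C m v i + g *\<^sub>v np_term D G m v i" for i
    by (simp add: uT GT module_hom.add[OF vfield_linop[OF u]] module_hom.add[OF vfield_linop[OF G]]
        module_hom.scale[OF vfield_linop[OF G]])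
  then have "normal_prod u G m (T v) = Sum_any (\<lambda>i. T (np_term u G m v i) + np_term u C m v i + g *\<^sub>v np_term D G m v i)"
    by (simp add: normal_prod_def)
  also have "\<dots> = T (Sum_any (np_term u G m v)) + Sum_any (np_term u C m v) + g *\<^sub>v Sum_any (np_term D G m v)"
    by (simp only: Sum_any_finsupp_add linop_Sum_any[OF T] scale_Sum_any
        finsupp_np_term finsupp_add finsupp_linop[OF T] finsupp_linop[OF linop_scale[OF linop_id]]
        u G D C)
  finally show ?thesis by (simp only: normal_prod_def)
qed

lemma finsupp_pairI:
  assumes "\<And>i j. i < a \<or> i > b \<Longrightarrow> f i j = 0" "\<And>i. finsupp (f i)"
  shows "finsupp (\<lambda>(i::int, j). f i j)"
proof (rule finsuppI[of "Sigma {a..b} (\<lambda>i. {j. f i j \<noteq> 0})"])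
  show "finite (Sigma {a..b} (\<lambda>i. {j. f i j \<noteq> 0}))"
    using assms(2) by (intro finite_SigmaI) (auto simp: finsupp_def)
qed (use assms(1) in force)

lemma finsupp_pair_swap: "finsupp (\<lambda>(i, j). f i j) \<Longrightarrow> finsupp (\<lambda>(j, i). f i j)"
  unfolding finsupp_def
  by (rule finite_subset[OF _ finite_imageI[of _ "\<lambda>(i, j). (j, i)"]]) (auto simp: image_iff)

lemma finsupp_pair_box:
  assumes "\<And>i j. i < a \<or> i > b \<or> j < a' \<or> j > b' \<Longrightarrow> f i j = 0"
  shows "finsupp (\<lambda>(i::int, j::int). f i j)"
  by (rule finsuppI[of "{a..b} \<times> {a'..b'}"]) (use assms in force)+

lemma finsupp_pair_add: "finsupp (\<lambda>(i, j). f i j) \<Longrightarrow> finsupp (\<lambda>(i, j). g i j) \<Longrightarrow>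
    finsupp (\<lambda>(i, j). f i j + g i j)" for f g :: "'i \<Rightarrow> 'j \<Rightarrow> 'a::monoid_add"
  using finsupp_add[of "\<lambda>(i, j). f i j" "\<lambda>(i, j). g i j"] by (simp add: case_prod_unfold)

text \<open>If \<open>A\<close> commutes with \<open>u\<close>, it may be moved next to \<open>B\<close> in both halves of \<open>:uB:\<close>; only an
  interchange of two sums is involved.\<close>
lemma series_comp_normal_prod:
  assumes A: "vfield A" and u: "vfield u" and B: "vfield B"
    and Au: "commuting A u" and AB: "commuting A B"
  shows "series_comp A (normal_prod u B) m v = normal_prod u (series_comp A B) m v"
proof -
  note lin = vfield_linop[OF A] vfield_linop[OF u] vfield_linop[OF B]
  note zero = lin[THEN module_hom.zero]
  define f where "f i j = (if j \<ge> 0 then A i (u j (B (m - i - j) v)) else 0)" for i j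
  define g where "g i j = (if j \<ge> 0 then 0 else A i (B (m - i - j) (u j v)))" for i j
  let ?NA = "lowest A v" and ?NB = "lowest B v"
  have f: "finsupp (\<lambda>(i, j). f i j)"
  proof (rule finsupp_pair_box[of ?NA "m - ?NB" 0 "m - ?NB - ?NA"])
    fix i j assume *: "i < ?NA \<or> i > m - ?NB \<or> j < 0 \<or> j > m - ?NB - ?NA"
    have "A i (u j (B (m - i - j) v)) = u j (B (m - i - j) (A i v))"
      by (simp add: commutingD[OF Au] commutingD[OF AB])
    moreover have "B (m - i - j) v = 0 \<or> A i v = 0 \<or> j < 0"
    proof -
      have "m - i - j < ?NB \<or> i < ?NA \<or> j < 0" using * by linarith
      then show ?thesis
        using vfield_lowest[OF A, of i v] vfield_lowest[OF B, of "m - i - j" v] by auto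
    qed
    ultimately show "f i j = 0" by (auto simp: f_def zero)
  qed
  have "finsupp (\<lambda>(j, i). g i j)"
  proof (rule finsupp_pairI[of "lowest u v" "-1"])
    show "j < lowest u v \<or> j > -1 \<Longrightarrow> g i j = 0" for i j
      by (auto simp: g_def zero vfield_lowest[OF u])
    show "finsupp (\<lambda>i. g i j)" for j
    proof (rule finsupp_mono[OF finsupp_series_comp[OF A B AB, of "m - j" "u j v"]])
      fix i assume "A i (B (m - j - i) (u j v)) = 0"
      then show "g i j = 0" by (simp add: g_def algebra_simps)
    qed
  qed
  then have g: "finsupp (\<lambda>(i, j). g i j)" by (rule finsupp_pair_swap)
  have "series_comp A (normal_prod u B) m v = Sum_any (\<lambda>i. Sum_any (\<lambda>j. f i j + g i j))"
    unfolding series_comp_def normal_prod_def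
    by (intro Sum_any.cong, subst linop_Sum_any[OF lin(1) finsupp_np_term[OF u B]])
      (auto intro!: Sum_any.cong simp: f_def g_def)
  also have "\<dots> = Sum_any (\<lambda>j. Sum_any (\<lambda>i. f i j + g i j))"
    by (rule Sum_any_swap) (rule finsupp_pair_add[OF f g])
  also have "\<dots> = normal_prod u (series_comp A B) m v"
    unfolding normal_prod_def series_comp_def
  proof (intro Sum_any.cong)
    fix j
    show "Sum_any (\<lambda>i. f i j + g i j) = (if 0 \<le> j then u j (Sum_any (\<lambda>i. A i (B (m - j - i) v)))
        else Sum_any (\<lambda>i. A i (B (m - j - i) (u j v))))"
      by (subst linop_Sum_any[OF lin(2) finsupp_series_comp[OF A B AB]])
        (auto intro!: Sum_any.cong simp: f_def g_def commutingD[OF Au] algebra_simps)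
  qed
  finally show ?thesis .
qed

lemma Sum_any_const: "finite I \<Longrightarrow> Sum_any (\<lambda>i. if i \<in> I then x else 0) = of_nat (card I) *\<^sub>v x"
  for x :: "'x fvec"
proof -
  assume I: "finite I"
  have "Sum_any (\<lambda>i. if i \<in> I then x else 0) = (\<Sum>i\<in>I. x)"
    using I by (subst Sum_any.expand_superset[of I]) auto
  also have "\<dots> = of_nat (card I) *\<^sub>v x"
    by (rule poly_mapping_eqI) (simp add: lookup_sum)
  finally show ?thesis .
qed

lemma Sum_any_diagonals:
  fixes f :: "int \<Rightarrow> int \<Rightarrow> 'a::comm_monoid_add"
  assumes fin: "finsupp (\<lambda>(i, j). f i j)"
  shows "Sum_any (\<lambda>i. Sum_any (\<lambda>j. f i j)) = Sum_any (\<lambda>t. Sum_any (\<lambda>i. f i (t - 1 - i)))"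
proof -
  have fin': "finsupp (\<lambda>(i, t). f i (t - 1 - i))"
    unfolding finsupp_def
    by (rule finite_subset[OF _ finite_imageI[OF fin[unfolded finsupp_def], of "\<lambda>(i, j). (i, i + j + 1)"]])
      (force simp: image_iff)
  have "Sum_any (\<lambda>i. Sum_any (\<lambda>j. f i j)) = Sum_any (\<lambda>i. Sum_any (\<lambda>t. f i (t - 1 - i)))"
  proof (rule Sum_any.cong)
    fix i
    show "Sum_any (f i) = Sum_any (\<lambda>t. f i (t - 1 - i))"
      using Sum_any_reindex[OF bij_int_shift[of "- 1 - i"], of "f i"] by (simp add: algebra_simps)
  qed
  also have "\<dots> = Sum_any (\<lambda>t. Sum_any (\<lambda>i. f i (t - 1 - i)))"
    by (rule Sum_any_swap[OF fin'])
  finally show ?thesis .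
qed

text \<open>Both sides are double sums over the coefficients \<open>i\<close> of \<open>S\<close> and \<open>j\<close> of \<open>u\<close>. They agree
  term by term where \<open>i\<close> and \<open>j\<close> have different signs. Where both are nonnegative or both are
  negative, the order of \<open>S\<close> and \<open>u\<close> differs, and the commutator contributes \<open>g S (i + j + 1)\<close>
  with opposite signs. On the diagonal \<open>t = i + j + 1\<close> there are \<open>\<bar>t\<bar>\<close> such pairs, whence the
  factor \<open>t\<close>, that is, the derivative of \<open>S\<close>.\<close>
lemma normal_prod_quasi_assoc:
  assumes u: "vfield u" and G: "vfield G" and S: "vfield S"
    and GS: "commuting G S" and chg: "\<And>i. charged (u i) (i + 1) g S"
  shows "normal_prod S (normal_prod u G) m v =
    normal_prod u (series_comp G S) m v - g *\<^sub>v series_comp G (series_ddiff 1 S) m v"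
proof -
  note lin = vfield_linop[OF u] vfield_linop[OF G] vfield_linop[OF S]
  note zero = lin[THEN module_hom.zero]
  have uS: "u j (S i w) = S i (u j w) + g *\<^sub>v S (i + j + 1) w" for i j w
    using chg[of j] by (simp add: charged_def algebra_simps)
  have SG: "S i (G j w) = G j (S i w)" for i j w
    using commutingD[OF GS] by simp
  \<comment> \<open>The four quadrants of the double sum for \<open>:S(uG):\<close>, first letter for the sign of \<open>i\<close>, second
    for that of \<open>j\<close>; \<open>rp\<close> and \<open>rm\<close> are the commutator terms in the two diagonal quadrants.\<close>
  define pp where "pp i j = (if 0 \<le> i \<and> 0 \<le> j then S i (u j (G (m - i - j) v)) else 0)" for i j
  define pm where "pm i j = (if 0 \<le> i \<and> j < 0 then S i (G (m - i - j) (u j v)) else 0)" for i j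
  define mp where "mp i j = (if i < 0 \<and> 0 \<le> j then u j (G (m - i - j) (S i v)) else 0)" for i j
  define mm where "mm i j = (if i < 0 \<and> j < 0 then G (m - i - j) (u j (S i v)) else 0)" for i j
  define rp where "rp i j = (if 0 \<le> i \<and> 0 \<le> j then G (m - i - j) (S (i + j + 1) v) else 0)" for i j
  define rm where "rm i j = (if i < 0 \<and> j < 0 then G (m - i - j) (S (i + j + 1) v) else 0)" for i j
  define h where "h t = G (m + 1 - t) (S t v)" for t
  have Gz: "m < lowest G w \<Longrightarrow> G m w = 0" and Sz: "m < lowest S w \<Longrightarrow> S m w = 0"
    and uz: "m < lowest u w \<Longrightarrow> u m w = 0" for m w
    using vfield_lowest u G S by blast+
  let ?B = "max 0 (m - lowest G v)"
  have f_pp: "finsupp (\<lambda>(i, j). pp i j)"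
    by (rule finsupp_pair_box[of 0 ?B 0 ?B]) (auto simp: pp_def zero Gz)
  have f_rp: "finsupp (\<lambda>(i, j). rp i j)"
    by (rule finsupp_pair_box[of 0 ?B 0 ?B]) (auto simp: rp_def zero Gz SG[symmetric])
  have f_rm: "finsupp (\<lambda>(i, j). rm i j)"
    by (rule finsupp_pair_box[of "min 0 (lowest S v)" 0 "min 0 (lowest S v)" 0])
      (auto simp: rm_def zero Sz)
  have "finsupp (\<lambda>(j, i). pm i j)"
  proof (rule finsupp_pairI[of "lowest u v" "-1"])
    show "finsupp (\<lambda>i. pm i j)" for j
      by (rule finsupp_int[of 0 "m - j - lowest G (u j v)"]) (auto simp: pm_def zero Gz)
  qed (auto simp: pm_def zero uz)
  then have f_pm: "finsupp (\<lambda>(i, j). pm i j)" by (rule finsupp_pair_swap)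
  have f_mp: "finsupp (\<lambda>(i, j). mp i j)"
  proof (rule finsupp_pairI[of "lowest S v" "-1"])
    show "finsupp (mp i)" for i
      by (rule finsupp_int[of 0 "m - i - lowest G (S i v)"]) (auto simp: mp_def zero Gz)
  qed (auto simp: mp_def zero Sz)
  have f_mm: "finsupp (\<lambda>(i, j). mm i j)"
  proof (rule finsupp_pairI[of "lowest S v" "-1"])
    show "finsupp (mm i)" for i
      by (rule finsupp_int[of "lowest u (S i v)" 0]) (auto simp: mm_def zero uz)
  qed (auto simp: mm_def zero Sz)
  define T where "T i j = (pp i j + pm i j) + (mp i j + mm i j)" for i j
  \<comment> \<open>The terms of \<open>:u(GS):\<close>.\<close>
  define T' where "T' i j = T i j + g *\<^sub>v (rp i j - rm i j)" for i j
  have f_T: "finsupp (\<lambda>(i, j). T i j)"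
    unfolding T_def by (intro finsupp_pair_add f_pp f_pm f_mp f_mm)
  have f_r: "finsupp (\<lambda>(i, j). g *\<^sub>v (rp i j - rm i j))"
    by (rule finsupp_mono[OF finsupp_pair_add[OF f_rp f_rm]], clarsimp)
      (auto simp: rp_def rm_def split: if_splits)
  have f_T': "finsupp (\<lambda>(i, j). T' i j)"
    unfolding T'_def by (intro finsupp_pair_add f_T f_r)
  have T: "normal_prod S (normal_prod u G) m v = Sum_any (\<lambda>i. Sum_any (\<lambda>j. T i j))"
    unfolding normal_prod_def
  proof (intro Sum_any.cong)
    fix i
    show "(if 0 \<le> i then S i (Sum_any (np_term u G (m - i) v)) else Sum_any (np_term u G (m - i) (S i v)))
      = Sum_any (\<lambda>j. T i j)"
      by (subst linop_Sum_any[OF lin(3) finsupp_np_term[OF u G]])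
        (auto intro!: Sum_any.cong simp: T_def pp_def pm_def mp_def mm_def)
  qed
  have T': "normal_prod u (series_comp G S) m v = Sum_any (\<lambda>j. Sum_any (\<lambda>i. T' i j))"
    unfolding normal_prod_def series_comp_commute[OF GS] unfolding series_comp_def
  proof (intro Sum_any.cong)
    fix j
    show "(if 0 \<le> j then u j (Sum_any (\<lambda>i. S i (G (m - j - i) v))) else
        Sum_any (\<lambda>i. S i (G (m - j - i) (u j v)))) = Sum_any (\<lambda>i. T' i j)"
      by (subst linop_Sum_any[OF lin(1) finsupp_series_comp[OF S G commuting_sym[OF GS]]])
        (auto intro!: Sum_any.cong simp: T'_def T_def pp_def pm_def mp_def mm_def rp_def rm_def uS SG[symmetric]
          module_hom.add[OF lin(2)] module_hom.scale[OF lin(2)] algebra_simps)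
  qed
  have f_h: "finsupp (\<lambda>t. of_int t *\<^sub>v h t)"
  proof (rule finsupp_mono[OF finsupp_series_comp[OF S G commuting_sym[OF GS], of "m + 1" v]])
    fix t assume "S t (G (m + 1 - t) v) = 0"
    then show "of_int t *\<^sub>v h t = 0" by (simp add: h_def SG)
  qed
  have diag: "Sum_any (\<lambda>i. g *\<^sub>v (rp i (t - 1 - i) - rm i (t - 1 - i))) = g *\<^sub>v (of_int t *\<^sub>v h t)" for t
  proof (cases "t > 0")
    case True
    then have "g *\<^sub>v (rp i (t - 1 - i) - rm i (t - 1 - i)) = (if i \<in> {0..<t} then g *\<^sub>v h t else 0)" for i
      by (auto simp: rp_def rm_def h_def algebra_simps)
    then show ?thesis using True by (simp only: Sum_any_const finite_atLeastLessThan_int) (simp add: mult.commute)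
  next
    case False
    then have "g *\<^sub>v (rp i (t - 1 - i) - rm i (t - 1 - i)) = (if i \<in> {t..<0} then - (g *\<^sub>v h t) else 0)" for i
      by (auto simp: rp_def rm_def h_def algebra_simps)
    then show ?thesis using False by (simp only: Sum_any_const finite_atLeastLessThan_int) (simp add: mult.commute)
  qed
  have "Sum_any (\<lambda>i. Sum_any (\<lambda>j. T' i j)) =
      Sum_any (\<lambda>i. Sum_any (\<lambda>j. T i j)) + Sum_any (\<lambda>i. Sum_any (\<lambda>j. g *\<^sub>v (rp i j - rm i j)))"
    using Sum_any_finsupp_add[OF f_T f_r] unfolding Sum_any_pair[OF f_T] Sum_any_pair[OF f_T'] Sum_any_pair[OF f_r]
    by (simp add: T'_def case_prod_unfold)
  moreover have "Sum_any (\<lambda>i. Sum_any (\<lambda>j. g *\<^sub>v (rp i j - rm i j))) = g *\<^sub>v Sum_any (\<lambda>t. of_int t *\<^sub>v h t)"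
    by (subst Sum_any_diagonals[OF f_r]) (simp only: diag scale_Sum_any[OF f_h])
  moreover have "Sum_any (\<lambda>t. of_int t *\<^sub>v h t) = series_comp G (series_ddiff 1 S) m v"
    unfolding series_comp_def h_def series_ddiff_1
    by (subst Sum_any_reindex[OF bij_int_reflect[of "m + 1"], symmetric])
      (simp add: module_hom.scale[OF lin(2)] algebra_simps)
  ultimately show ?thesis
    unfolding T T' using Sum_any_swap[OF f_T'] by simp
qed

section \<open>Exponentials of one-sided series\<close>

text \<open>Only positive powers of \<open>z\<close> for \<open>s = 1\<close> (creation part), only negative ones for \<open>s = -1\<close>
  (annihilation part). In both cases the coefficient of \<open>z\<^sup>m\<close> in \<open>A(z)\<^sup>j\<close> is zero for \<open>j > \<bar>m\<bar>\<close>,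
  so powers and exponential are finite sums independently of the vector they act on.\<close>
definition one_sided :: "int \<Rightarrow> ('x, 'y) opseries \<Rightarrow> bool"
  where "one_sided s A \<longleftrightarrow> (s = 1 \<or> s = - 1) \<and> (\<forall>m v. s * m \<le> 0 \<longrightarrow> A m v = 0)"

locale one_sided_series =
  fixes s :: int and A :: "('x, 'x) opseries"
  assumes lin: "\<And>m. linop (A m)" and sided: "one_sided s A"
begin

lemma s_cases: "s = 1 \<or> s = - 1"
  using sided by (simp add: one_sided_def)

lemma zero: "A m 0 = 0"
  by (rule module_hom.zero[OF lin])

lemma vanish: "s * m \<le> 0 \<Longrightarrow> A m v = 0"
  using sided by (simp add: one_sided_def)

lemma pow_vanish: "s * m < int j \<Longrightarrow> series_pow A j m v = 0"
proof (induction j arbitrary: m)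
  case 0
  then show ?case by (auto simp: series_one_def)
next
  case (Suc j)
  have "A i (series_pow A j (m - i) v) = 0" for i
  proof (cases "s * i \<le> 0")
    case False
    then have "s * (m - i) < int j" using Suc.prems by (simp add: right_diff_distrib)
    then show ?thesis by (simp add: Suc.IH zero)
  qed (rule vanish)
  then show ?case by (simp add: series_comp_def)
qed

lemma finsupp_pow:
  "finsupp (\<lambda>i. A i (series_pow A j (m - i) v))"
  "finsupp (\<lambda>i. of_int i *\<^sub>v A i (series_pow A j (m - i) v))"
proof -
  have "A i (series_pow A j (m - i) v) = 0" if "i < - \<bar>m\<bar> \<or> \<bar>m\<bar> < i" for i
  proof (cases "s * i \<le> 0")
    case False
    then have "s * (m - i) < int j" using that s_cases by auto
    then show ?thesis by (simp add: pow_vanish zero)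
  qed (rule vanish)
  then show "finsupp (\<lambda>i. A i (series_pow A j (m - i) v))"
    by (intro finsupp_int[of "- \<bar>m\<bar>" "\<bar>m\<bar>"])
  then show "finsupp (\<lambda>i. of_int i *\<^sub>v A i (series_pow A j (m - i) v))"
    by (rule finsupp_mono) simp
qed

lemma linop_pow: "linop (series_pow A j m)"
proof (induction j arbitrary: m)
  case 0
  then show ?case unfolding series_pow.simps series_one_def[abs_def]
    by (intro linop_if linop_id linop_zero)
next
  case (Suc j)
  then show ?case unfolding series_pow.simps series_comp_def[abs_def]
    by (intro linop_Sum_any_ops finsupp_pow linop_comp[OF lin])
qed

lemma finsupp_exp: "finsupp (\<lambda>j. c j *\<^sub>v series_pow A j m v)"
  by (rule finsuppI[of "{..nat \<bar>m\<bar>}"]) (use s_cases in \<open>auto simp: pow_vanish\<close>)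

lemma linop_exp: "linop (series_exp A m)"
  unfolding series_exp_def[abs_def]
  by (intro linop_Sum_any_ops finsupp_exp linop_scale linop_pow)

lemma exp_vanish: "s * m < 0 \<Longrightarrow> series_exp A m v = 0"
  by (simp add: series_exp_def pow_vanish)

text \<open>Used twice: with the degree filtration, to see that annihilation exponentials are
  truncated, and with a constant family, to see that invariant subspaces are preserved.\<close>
lemma pow_filtered:
  assumes "\<And>m N v. v \<in> spanned (U N) \<Longrightarrow> A m v \<in> spanned (U (N + m))" "v \<in> spanned (U N)"
  shows "series_pow A j m v \<in> spanned (U (N + m))"
  using assms(2)
proof (induction j arbitrary: m)
  case 0
  then show ?case by (simp add: series_one_def spanned_0)
next
  case (Suc j)
  have "A i (series_pow A j (m - i) v) \<in> spanned (U (N + (m - i) + i))" for i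
    using assms(1) Suc by blast
  then show ?case by (simp add: series_comp_def spanned_Sum_any)
qed

lemma exp_filtered:
  assumes "\<And>m N v. v \<in> spanned (U N) \<Longrightarrow> A m v \<in> spanned (U (N + m))" "v \<in> spanned (U N)"
  shows "series_exp A m v \<in> spanned (U (N + m))"
  unfolding series_exp_def by (intro spanned_Sum_any spanned_scale pow_filtered assms)

text \<open>The commutator of \<open>Z\<close> with \<open>A(z)\<close> is the scalar series \<open>g z\<^sup>r\<close>, so the derivation rule
  gives \<open>[Z, A(z)\<^sup>j] = j g z\<^sup>r A(z)\<^bsup>j-1\<^esup>\<close>.\<close>
lemma pow_commutator:
  assumes Z: "linop Z"
    and ZA: "\<And>m v. Z (A m v) = A m (Z v) + (if m = r then g *\<^sub>v v else 0)"
  shows "Z (series_pow A j m v) =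
    series_pow A j m (Z v) + (of_nat j * g) *\<^sub>v series_pow A (j - 1) (m - r) v"
proof (induction j arbitrary: m)
  case 0
  then show ?case by (simp add: series_one_def module_hom.zero[OF Z])
next
  case (Suc j)
  let ?P = "series_pow A"
  let ?g = "of_nat j * g"
  have 1: "finsupp (\<lambda>i. ?g *\<^sub>v A i (?P (j - 1) (m - i - r) v))"
    by (rule finsupp_mono[OF finsupp_pow(1)[of "j - 1" "m - r" v]]) (simp add: algebra_simps)
  have 2: "finsupp (\<lambda>i. if i = r then g *\<^sub>v ?P j (m - i) v else 0)"
    by (rule finsuppI[of "{r}"]) auto
  have "Z (?P (Suc j) m v) = Sum_any (\<lambda>i. Z (A i (?P j (m - i) v)))"
    by (simp add: series_comp_def linop_Sum_any[OF Z finsupp_pow(1)])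
  also have "\<dots> = Sum_any (\<lambda>i. A i (?P j (m - i) (Z v)) + ?g *\<^sub>v A i (?P (j - 1) (m - i - r) v)
      + (if i = r then g *\<^sub>v ?P j (m - i) v else 0))"
    by (rule Sum_any.cong) (simp add: ZA Suc module_hom.add[OF lin] module_hom.scale[OF lin])
  also have "\<dots> = ?P (Suc j) m (Z v) + Sum_any (\<lambda>i. ?g *\<^sub>v A i (?P (j - 1) (m - i - r) v))
      + g *\<^sub>v ?P j (m - r) v"
    by (simp only: Sum_any_finsupp_add[OF finsupp_add[OF finsupp_pow(1) 1] 2]
        Sum_any_finsupp_add[OF finsupp_pow(1) 1] Sum_any.delta) (simp add: series_comp_def)
  also have "Sum_any (\<lambda>i. ?g *\<^sub>v A i (?P (j - 1) (m - i - r) v)) = ?g *\<^sub>v ?P j (m - r) v"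
  proof (cases j)
    case (Suc j')
    have "Sum_any (\<lambda>i. ?g *\<^sub>v A i (?P (j - 1) (m - i - r) v)) =
        Sum_any (\<lambda>i. ?g *\<^sub>v A i (?P j' (m - r - i) v))"
      by (simp add: Suc algebra_simps)
    also have "\<dots> = ?g *\<^sub>v ?P j (m - r) v"
      by (simp add: Suc series_comp_def scale_Sum_any[OF finsupp_pow(1)])
    finally show ?thesis .
  qed simp
  finally show ?case by (simp add: algebra_simps vec.scale_left_distrib)
qed

text \<open>The exponential series reproduces itself when differentiated term by term.\<close>
lemma Sum_any_exp_shift:
  "Sum_any (\<lambda>j. (1 / fact j) *\<^sub>v (of_nat j *\<^sub>v series_pow A (j - 1) m v)) = series_exp A m v"
proof -
  let ?f = "\<lambda>j. (1 / fact j) *\<^sub>v series_pow A j m v"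
  let ?g = "\<lambda>j. (1 / fact j) *\<^sub>v (of_nat j *\<^sub>v series_pow A (j - 1) m v)"
  let ?N = "nat \<bar>m\<bar>"
  have v: "series_pow A j m v = 0" if "j > ?N" for j
    using that s_cases by (intro pow_vanish) auto
  have "Sum_any ?g = sum ?g {..Suc ?N}"
  proof (rule Sum_any.expand_superset)
    show "{j. ?g j \<noteq> 0} \<subseteq> {..Suc ?N}"
    proof
      fix j assume "j \<in> {j. ?g j \<noteq> 0}"
      then have "series_pow A (j - 1) m v \<noteq> 0" by auto
      then have "j - 1 \<le> ?N" by (rule contrapos_np) (simp add: v)
      then show "j \<in> {..Suc ?N}" by simp
    qed
  qed simp
  also have "\<dots> = sum ?f {..?N}"
    by (subst sum.atMost_Suc_shift) (simp add: field_simps of_nat_eq_0_iff del: of_nat_Suc)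
  also have "\<dots> = Sum_any ?f"
    by (rule Sum_any.expand_superset[symmetric])
      (use v in \<open>auto simp: not_le[symmetric] intro: ccontr[of "_ \<le> _"]\<close>)
  finally show ?thesis by (simp add: series_exp_def)
qed

text \<open>Summation of \<open>[Z, A(z)\<^sup>j] / j!\<close> over \<open>j\<close>.\<close>
lemma charged_exp:
  assumes Z: "linop Z"
    and ZA: "\<And>m v. Z (A m v) = A m (Z v) + (if m = r then g *\<^sub>v v else 0)"
  shows "charged Z (- r) g (series_exp A)"
  unfolding charged_def
proof (intro allI)
  fix m v
  let ?h = "\<lambda>j. (1 / fact j) *\<^sub>v (of_nat j *\<^sub>v series_pow A (j - 1) (m - r) v)"
  have f: "finsupp ?h"
    by (rule finsuppI[of "{..Suc (nat \<bar>m - r\<bar>)}"]) (use s_cases in \<open>auto simp: pow_vanish\<close>)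
  have "Z (series_exp A m v) = Sum_any (\<lambda>j. Z ((1 / fact j) *\<^sub>v series_pow A j m v))"
    unfolding series_exp_def by (rule linop_Sum_any[OF Z finsupp_exp])
  also have "\<dots> = Sum_any (\<lambda>j. (1 / fact j) *\<^sub>v series_pow A j m (Z v) + g *\<^sub>v ?h j)"
    by (rule Sum_any.cong)
      (simp add: module_hom.scale[OF Z] pow_commutator[OF Z ZA] vec.scale_right_distrib algebra_simps)
  also have "\<dots> = series_exp A m (Z v) + g *\<^sub>v Sum_any ?h"
    unfolding scale_Sum_any[OF f]
    by (subst Sum_any_finsupp_add[OF finsupp_exp finsupp_linop[OF linop_scale[OF linop_id] f]])
      (simp add: series_exp_def)
  finally show "Z (series_exp A m v) = series_exp A m (Z v) + g *\<^sub>v series_exp A (m + - r) v"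
    unfolding Sum_any_exp_shift by simp
qed

text \<open>With \<open>\<theta> = z\<partial>\<close>: since the coefficients of \<open>A\<close> commute, \<open>\<theta>(A\<^sup>j) = j (\<theta>A) A\<^bsup>j-1\<^esup>\<close>. The Euler
  operator is used instead of \<open>\<partial>\<close> because \<open>\<theta>A\<close> is again one-sided.\<close>
lemma pow_euler:
  assumes comm: "commuting A A"
  shows "of_int m *\<^sub>v series_pow A j m v =
    of_nat j *\<^sub>v Sum_any (\<lambda>i. of_int i *\<^sub>v A i (series_pow A (j - 1) (m - i) v))"
proof (induction j arbitrary: m)
  case 0
  then show ?case by (simp add: series_one_def)
next
  case (Suc j)
  let ?P = "series_pow A"
  let ?D = "\<lambda>i w. of_int i *\<^sub>v A i w"
  have f1: "finsupp (\<lambda>i. ?D i (?P j (m - i) v))" by (rule finsupp_pow)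
  have f2: "finsupp (\<lambda>i. A i (of_int (m - i) *\<^sub>v ?P j (m - i) v))"
    by (rule finsupp_mono[OF finsupp_pow(1)[of j m v]]) (simp add: module_hom.scale[OF lin])
  have "of_int m *\<^sub>v ?P (Suc j) m v = Sum_any (\<lambda>i. of_int m *\<^sub>v A i (?P j (m - i) v))"
    by (simp add: series_comp_def scale_Sum_any[OF finsupp_pow(1)])
  also have "\<dots> = Sum_any (\<lambda>i. ?D i (?P j (m - i) v) + A i (of_int (m - i) *\<^sub>v ?P j (m - i) v))"
    by (rule Sum_any.cong) (simp add: module_hom.scale[OF lin] vec.scale_left_distrib[symmetric])
  also have "\<dots> = Sum_any (\<lambda>i. ?D i (?P j (m - i) v)) + Sum_any (\<lambda>i. A i (of_int (m - i) *\<^sub>v ?P j (m - i) v))"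
    by (rule Sum_any_finsupp_add[OF f1 f2])
  also have "Sum_any (\<lambda>i. A i (of_int (m - i) *\<^sub>v ?P j (m - i) v)) =
      of_nat j *\<^sub>v Sum_any (\<lambda>i. ?D i (?P j (m - i) v))"
  proof (cases j)
    case (Suc j')
    let ?f = "\<lambda>i l. of_nat j *\<^sub>v A i (?D l (?P j' (m - i - l) v))"
    have f: "finsupp (\<lambda>(i, l). ?f i l)"
    proof (rule finsupp_pair_box[of "- \<bar>m\<bar>" "\<bar>m\<bar>" "- \<bar>m\<bar>" "\<bar>m\<bar>"])
      fix i l assume *: "i < - \<bar>m\<bar> \<or> \<bar>m\<bar> < i \<or> l < - \<bar>m\<bar> \<or> \<bar>m\<bar> < l"
      consider "s * i \<le> 0" | "s * l \<le> 0" | "s * (m - i - l) < int j'"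
        using * s_cases by force
      then show "?f i l = 0" by cases (simp_all add: vanish pow_vanish zero)
    qed
    have "Sum_any (\<lambda>i. A i (of_int (m - i) *\<^sub>v ?P j (m - i) v)) = Sum_any (\<lambda>i. Sum_any (?f i))"
    proof (rule Sum_any.cong)
      fix i
      have "A i (of_int (m - i) *\<^sub>v ?P j (m - i) v) =
          of_nat j *\<^sub>v A i (Sum_any (\<lambda>l. ?D l (?P j' (m - i - l) v)))"
        by (subst Suc.IH) (simp only: Suc module_hom.scale[OF lin] diff_Suc_1)
      then show "A i (of_int (m - i) *\<^sub>v ?P j (m - i) v) = Sum_any (?f i)"
        by (simp only: linop_Sum_any[OF lin finsupp_pow(2)] scale_Sum_any[OF finsupp_linop[OF lin finsupp_pow(2)]])
    qed
    also have "\<dots> = Sum_any (\<lambda>l. Sum_any (\<lambda>i. ?f i l))"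
      by (rule Sum_any_swap[OF f])
    also have "\<dots> = Sum_any (\<lambda>l. of_nat j *\<^sub>v ?D l (?P j (m - l) v))"
    proof (rule Sum_any.cong)
      fix l
      have "of_nat j *\<^sub>v ?D l (?P j (m - l) v) =
          Sum_any (\<lambda>i. of_nat j *\<^sub>v ?D l (A i (?P j' (m - l - i) v)))"
        unfolding Suc series_pow.simps series_comp_def
        by (rule linop_Sum_any[OF _ finsupp_pow(1)]) (intro linop_scale lin)
      also have "\<dots> = Sum_any (\<lambda>i. ?f i l)"
        by (rule Sum_any.cong)
          (simp add: module_hom.scale[OF lin] commutingD[OF comm, of l] algebra_simps)
      finally show "Sum_any (\<lambda>i. ?f i l) = of_nat j *\<^sub>v ?D l (?P j (m - l) v)" by simp
    qed
    finally show ?thesis by (simp only: scale_Sum_any[OF f1])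
  qed (simp add: series_one_def module_hom.scale[OF lin] zero if_distrib cong: if_cong)
  finally show ?case by (simp add: vec.scale_left_distrib add.commute)
qed

lemma exp_euler:
  assumes comm: "commuting A A"
  shows "of_int m *\<^sub>v series_exp A m v = Sum_any (\<lambda>i. of_int i *\<^sub>v A i (series_exp A (m - i) v))"
proof -
  let ?P = "series_pow A"
  let ?f = "\<lambda>j i. (1 / fact j) *\<^sub>v (of_nat j *\<^sub>v (of_int i *\<^sub>v A i (?P (j - 1) (m - i) v)))"
  have f: "finsupp (\<lambda>(j, i). ?f j i)"
  proof (rule finsuppI[of "{..Suc (nat \<bar>m\<bar>)} \<times> {- \<bar>m\<bar>..\<bar>m\<bar>}"], goal_cases)
    case (2 p)
    obtain j i where p: "p = (j, i)" by force
    from 2 have "j > Suc (nat \<bar>m\<bar>) \<or> i < - \<bar>m\<bar> \<or> i > \<bar>m\<bar>" unfolding p by auto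
    then have "s * i \<le> 0 \<or> s * (m - i) < int (j - 1)"
      using s_cases by (elim disjE) (simp_all, arith+)
    then show ?case unfolding p by (elim disjE) (simp_all add: vanish pow_vanish zero)
  qed simp
  have "of_int m *\<^sub>v series_exp A m v = Sum_any (\<lambda>j. (1 / fact j) *\<^sub>v (of_int m *\<^sub>v ?P j m v))"
    unfolding series_exp_def scale_Sum_any[OF finsupp_exp]
    by (rule Sum_any.cong) (simp add: mult.commute)
  also have "\<dots> = Sum_any (\<lambda>j. Sum_any (?f j))"
    unfolding pow_euler[OF comm]
    by (rule Sum_any.cong, rule linop_Sum_any[OF _ finsupp_pow(2)]) (intro linop_scale linop_id)
  also have "\<dots> = Sum_any (\<lambda>i. Sum_any (\<lambda>j. ?f j i))"
    by (rule Sum_any_swap[OF f])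
  also have "\<dots> = Sum_any (\<lambda>i. of_int i *\<^sub>v A i (series_exp A (m - i) v))"
  proof (rule Sum_any.cong)
    fix i
    have "finsupp (\<lambda>j. (1 / fact j) *\<^sub>v (of_nat j *\<^sub>v series_pow A (j - 1) (m - i) v))"
      by (rule finsuppI[of "{..Suc (nat \<bar>m - i\<bar>)}"]) (use s_cases in \<open>auto simp: pow_vanish\<close>)
    from linop_Sum_any[OF linop_scale[OF lin] this, of "of_int i" i, unfolded Sum_any_exp_shift]
    show "Sum_any (\<lambda>j. ?f j i) = of_int i *\<^sub>v A i (series_exp A (m - i) v)"
      by (simp add: module_hom.scale[OF lin] algebra_simps)
  qed
  finally show ?thesis .
qed

end

section \<open>Normally ordered exponentials of oscillators\<close>

text \<open>The degree serves only to show that each vector is annihilated by all sufficiently high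
  modes and by all sufficiently negative coefficients of the annihilation exponential.\<close>
definition degree_le :: "('x \<Rightarrow> nat) \<Rightarrow> int \<Rightarrow> 'x set"
  where "degree_le deg N = {x. int (deg x) \<le> N}"

lemma spanned_degree_neg: "N < 0 \<Longrightarrow> v \<in> spanned (degree_le deg N) \<Longrightarrow> v = 0"
  by (auto simp: spanned_def degree_le_def)

lemma ex_degree_bound: "\<exists>N. v \<in> spanned (degree_le deg N)"
proof -
  have "v \<in> spanned (degree_le deg (int (Max (deg ` Poly_Mapping.keys v))))"
    by (auto simp: spanned_def degree_le_def)
  then show ?thesis ..
qed

text \<open>\<open>\<Sum>\<^bsub>n \<noteq> 0\<^esub> X\<^sub>n z\<^bsup>-n-1\<^esup>\<close>, the derivative of the exponent of the vertex operator.\<close>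
definition oscillator_series :: "(int \<Rightarrow> 'x fvec \<Rightarrow> 'x fvec) \<Rightarrow> ('x, 'x) opseries"
  where "oscillator_series X m v = (if m = - 1 then 0 else X (- m - 1) v)"

locale oscillators =
  fixes X :: "int \<Rightarrow> 'x fvec \<Rightarrow> 'x fvec" and deg :: "'x \<Rightarrow> nat"
  assumes lin: "\<And>n. linop (X n)"
    and same_sign: "\<And>n m v. 0 < n * m \<Longrightarrow> X n (X m v) = X m (X n v)"
    and lowering: "\<And>n x. 0 < n \<Longrightarrow> X n (basis x) \<in> spanned (degree_le deg (int (deg x) - n))"
begin

abbreviation "cre \<equiv> creation_part X"

abbreviation "ann \<equiv> annihilation_part X"

lemma cre_eq: "cre m v = (if m > 0 then (1 / of_int m) *\<^sub>v X (- m) v else 0)"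
  and ann_eq: "ann m v = (if m < 0 then (1 / of_int m) *\<^sub>v X (- m) v else 0)"
  by (simp_all add: creation_part_def annihilation_part_def Let_def)

sublocale cre: one_sided_series 1 cre
proof (rule one_sided_series.intro)
  show "linop (cre m)" for m
    unfolding cre_eq[abs_def] by (intro linop_if linop_scale lin linop_zero)
qed (simp add: one_sided_def cre_eq)

sublocale ann: one_sided_series "-1" ann
proof (rule one_sided_series.intro)
  show "linop (ann m)" for m
    unfolding ann_eq[abs_def] by (intro linop_if linop_scale lin linop_zero)
qed (simp add: one_sided_def ann_eq)

lemma commuting_cre: "commuting cre cre" and commuting_ann: "commuting ann ann"
  by (auto simp: commuting_def cre_eq ann_eq module_hom.scale[OF lin] module_hom.zero[OF lin]
      same_sign mult_neg_neg mult.commute intro!: arg_cong[of _ _ "scale _"])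

lemma lowering_spanned:
  assumes "v \<in> spanned (degree_le deg N)" "0 < n"
  shows "X n v \<in> spanned (degree_le deg (N - n))"
  by (rule spanned_linop[OF lin assms(1)])
    (use lowering[OF assms(2)] in \<open>fastforce simp: spanned_def degree_le_def\<close>)

lemma exp_ann_degree:
  assumes "v \<in> spanned (degree_le deg N)"
  shows "series_exp ann m v \<in> spanned (degree_le deg (N + m))"
proof (rule ann.exp_filtered[of "degree_le deg", OF _ assms])
  fix m N v assume "v \<in> spanned (degree_le deg N)"
  then show "ann m v \<in> spanned (degree_le deg (N + m))"
    using lowering_spanned[of v N "- m"] by (auto simp: ann_eq intro!: spanned_scale spanned_0)
qed

lemma annihilated: "\<exists>N. (\<forall>n>N. X n v = 0) \<and> (\<forall>m < - N. series_exp ann m v = 0)"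
proof -
  obtain N where N: "v \<in> spanned (degree_le deg N)" using ex_degree_bound by blast
  have "X n v = 0" if "n > \<bar>N\<bar>" for n
    using lowering_spanned[OF N, of n] that by (intro spanned_degree_neg[of "N - n" _ deg]) auto
  moreover have "series_exp ann m v = 0" if "m < - \<bar>N\<bar>" for m
    using exp_ann_degree[OF N, of m] that by (intro spanned_degree_neg[of "N + m" _ deg]) auto
  ultimately show ?thesis by blast
qed

lemma finsupp_normal_exp: "finsupp (\<lambda>i. series_exp cre i (series_exp ann (m - i) v))"
proof -
  obtain N where N: "\<forall>m < - N. series_exp ann m v = 0" using annihilated by blast
  show ?thesis
    by (rule finsupp_int[of 0 "m + N"])
      (auto simp: cre.exp_vanish N module_hom.zero[OF cre.linop_exp])
qed

lemma vfield_normal_exp: "vfield (normal_exp X)"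
proof (rule vfieldI)
  show "linop (normal_exp X m)" for m
    unfolding normal_exp_def series_comp_def[abs_def]
    by (intro linop_Sum_any_ops finsupp_normal_exp linop_comp[OF cre.linop_exp ann.linop_exp])
  fix v
  obtain N where N: "\<forall>m < - N. series_exp ann m v = 0" using annihilated by blast
  have "series_exp cre i (series_exp ann (m - i) v) = 0" if "m < - N" for m i
    using that N by (cases "i < 0") (auto simp: cre.exp_vanish module_hom.zero[OF cre.linop_exp])
  then show "\<exists>N. \<forall>m<N. normal_exp X m v = 0"
    by (intro exI[of _ "- N"]) (simp add: normal_exp_def series_comp_def)
qed

lemma vfield_oscillator_series: "vfield (oscillator_series X)"
proof (rule vfieldI)
  show "linop (oscillator_series X m)" for m
    unfolding oscillator_series_def[abs_def] by (intro linop_if linop_zero lin)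
  fix v
  obtain N where "\<forall>n>N. X n v = 0" using annihilated by blast
  then show "\<exists>N. \<forall>m<N. oscillator_series X m v = 0"
    by (intro exI[of _ "- N - 1"]) (simp add: oscillator_series_def)
qed

lemma normal_exp_commute:
  assumes Z: "linop Z" and "\<And>n v. n \<noteq> 0 \<Longrightarrow> Z (X n v) = X n (Z v)"
  shows "charged Z s 0 (normal_exp X)"
proof -
  have "charged Z (- (- s)) 0 (series_exp cre)"
    by (rule cre.charged_exp[OF Z])
      (simp add: cre_eq module_hom.scale[OF Z] module_hom.zero[OF Z] module_hom.neg[OF Z] assms(2))
  moreover have "charged Z (- (- s)) 0 (series_exp ann)"
    by (rule ann.charged_exp[OF Z])
      (simp add: ann_eq module_hom.scale[OF Z] module_hom.zero[OF Z] module_hom.neg[OF Z] assms(2))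
  ultimately have "charged Z s 0 (series_exp cre)" "charged Z s 0 (series_exp ann)" by simp_all
  from charged_series_comp[OF Z cre.linop_exp this finsupp_normal_exp]
  show ?thesis by (simp add: normal_exp_def)
qed

text \<open>A positive mode sees only the creation part and a negative one only the annihilation
  part.\<close>
lemma normal_exp_charged:
  assumes Z: "linop Z" and r: "r \<noteq> 0"
    and ZX: "\<And>n v. Z (X n v) = X n (Z v) + (if n = - r then (g * of_int r) *\<^sub>v v else 0)"
  shows "charged Z (- r) g (normal_exp X)"
proof -
  have "charged Z (- r) (if r > 0 then g else 0) (series_exp cre)"
    by (rule cre.charged_exp[OF Z])
      (use r in \<open>auto simp: cre_eq ZX module_hom.scale[OF Z] module_hom.zero[OF Z] vec.scale_right_distrib\<close>)
  moreover have "charged Z (- r) (if r < 0 then g else 0) (series_exp ann)"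
    by (rule ann.charged_exp[OF Z])
      (use r in \<open>auto simp: ann_eq ZX module_hom.scale[OF Z] module_hom.zero[OF Z] vec.scale_right_distrib\<close>)
  ultimately have "charged Z (- r) ((if r > 0 then g else 0) + (if r < 0 then g else 0)) (normal_exp X)"
    unfolding normal_exp_def by (rule charged_series_comp[OF Z cre.linop_exp _ _ finsupp_normal_exp])
  then show ?thesis using r by (auto split: if_splits)
qed

lemma exp_ann_commute: "n > 0 \<Longrightarrow> X n (series_exp ann m v) = series_exp ann m (X n v)"
proof -
  assume n: "n > 0"
  have "charged (X n) (- 0) 0 (series_exp ann)"
    by (rule ann.charged_exp[OF lin])
      (use n in \<open>auto simp: ann_eq module_hom.scale[OF lin] module_hom.zero[OF lin]
        intro!: same_sign arg_cong[of _ _ "scale _"] mult_pos_pos\<close>)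
  then show ?thesis by (simp add: charged_def)
qed

text \<open>The Euler operator applied to the creation exponential brings down creation modes, which
  may stay on the left.\<close>
lemma series_comp_cre_euler:
  "Sum_any (\<lambda>i. (of_int i *\<^sub>v series_exp cre i (series_exp ann (m - i) v))) =
    Sum_any (\<lambda>l. if l > 0 then X (- l) (normal_exp X (m - l) v) else 0)"
proof -
  let ?f = "\<lambda>i l. if l > 0 then X (- l) (series_exp cre (i - l) (series_exp ann (m - i) v)) else 0"
  obtain N where N: "\<forall>m < - N. series_exp ann m v = 0" using annihilated by blast
  have zero: "X n 0 = 0" "series_exp cre n 0 = 0" for n
    by (simp_all add: module_hom.zero[OF lin] module_hom.zero[OF cre.linop_exp])
  have f: "finsupp (\<lambda>(i, l). ?f i l)"
  proof (rule finsupp_pair_box[of 0 "m + N" 0 "m + N"])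
    fix i l assume "i < 0 \<or> m + N < i \<or> l < 0 \<or> m + N < l"
    then consider "l \<le> 0" | "i - l < 0" | "m - i < - N" by linarith
    then show "?f i l = 0" by cases (simp_all add: N cre.exp_vanish zero)
  qed
  have "of_int i *\<^sub>v series_exp cre i w =
      Sum_any (\<lambda>l. if l > 0 then X (- l) (series_exp cre (i - l) w) else 0)" for i w
    unfolding cre.exp_euler[OF commuting_cre] by (rule Sum_any.cong) (simp add: cre_eq)
  then have "Sum_any (\<lambda>i. of_int i *\<^sub>v series_exp cre i (series_exp ann (m - i) v)) =
      Sum_any (\<lambda>i. Sum_any (?f i))" by simp
  also have "\<dots> = Sum_any (\<lambda>l. Sum_any (\<lambda>i. ?f i l))" by (rule Sum_any_swap[OF f])
  also have "\<dots> = Sum_any (\<lambda>l. if l > 0 then X (- l) (normal_exp X (m - l) v) else 0)"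
  proof (rule Sum_any.cong)
    fix l
    have "normal_exp X (m - l) v = Sum_any (\<lambda>i. series_exp cre (i - l) (series_exp ann (m - i) v))"
      unfolding normal_exp_def series_comp_def
      using Sum_any_reindex[OF bij_int_shift[of "- l"], of "\<lambda>i. series_exp cre i (series_exp ann (m - l - i) v)"]
      by (simp add: algebra_simps)
    moreover have "finsupp (\<lambda>i. series_exp cre (i - l) (series_exp ann (m - i) v))"
      by (rule finsupp_int[of l "m + N"]) (auto simp: N cre.exp_vanish zero)
    ultimately show "Sum_any (\<lambda>i. ?f i l) = (if l > 0 then X (- l) (normal_exp X (m - l) v) else 0)"
      by (simp add: linop_Sum_any[OF lin])
  qed
  finally show ?thesis .
qed

text \<open>The Euler operator applied to the annihilation exponential brings down annihilation modes;
  they commute with that exponential and can be moved to the right, as normal ordering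
  requires.\<close>
lemma series_comp_ann_euler:
  "Sum_any (\<lambda>i. series_exp cre i (of_int (m - i) *\<^sub>v series_exp ann (m - i) v)) =
    Sum_any (\<lambda>l. if l < 0 then normal_exp X (m - l) (X (- l) v) else 0)"
proof -
  let ?f = "\<lambda>i l. if l < 0 then series_exp cre i (series_exp ann (m - i - l) (X (- l) v)) else 0"
  obtain N where N: "\<forall>n>N. X n v = 0" using annihilated by blast
  have zero: "series_exp ann n 0 = 0" "series_exp cre n 0 = 0" for n
    by (simp_all add: module_hom.zero[OF ann.linop_exp] module_hom.zero[OF cre.linop_exp])
  have row: "finsupp (\<lambda>i. ?f i l)" for l
    by (rule finsupp_mono[OF finsupp_normal_exp[of "m - l" "X (- l) v"]]) (simp add: algebra_simps)
  have "finsupp (\<lambda>(l, i). ?f i l)"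
    by (rule finsupp_pairI[of "- N" 0, OF _ row]) (auto simp: N zero)
  then have f: "finsupp (\<lambda>(i, l). ?f i l)" by (rule finsupp_pair_swap)
  have eul: "of_int n *\<^sub>v series_exp ann n v =
      Sum_any (\<lambda>l. if l < 0 then series_exp ann (n - l) (X (- l) v) else 0)" for n
    unfolding ann.exp_euler[OF commuting_ann]
    by (rule Sum_any.cong) (simp add: ann_eq exp_ann_commute)
  have fin: "finsupp (\<lambda>l. if l < 0 then series_exp ann (n - l) (X (- l) v) else 0)" for n
    by (rule finsupp_int[of "- N" 0]) (auto simp: N zero)
  have "Sum_any (\<lambda>i. series_exp cre i (of_int (m - i) *\<^sub>v series_exp ann (m - i) v)) =
      Sum_any (\<lambda>i. Sum_any (?f i))"
    unfolding eul linop_Sum_any[OF cre.linop_exp fin] by (intro Sum_any.cong) (simp add: zero)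
  also have "\<dots> = Sum_any (\<lambda>l. Sum_any (\<lambda>i. ?f i l))" by (rule Sum_any_swap[OF f])
  also have "\<dots> = Sum_any (\<lambda>l. if l < 0 then normal_exp X (m - l) (X (- l) v) else 0)"
    by (rule Sum_any.cong) (simp add: normal_exp_def series_comp_def algebra_simps)
  finally show ?thesis .
qed

text \<open>The product rule turns the two preceding identities into \<open>\<partial>V = :XV:\<close>, the index shift by
  one converting \<open>z\<partial>\<close> into \<open>\<partial>\<close>.\<close>
lemma normal_exp_ddiff:
  "series_ddiff 1 (normal_exp X) m v = normal_prod (oscillator_series X) (normal_exp X) m v"
proof -
  let ?V = "normal_exp X" and ?a = "oscillator_series X"
  let ?e = "\<lambda>i. series_exp cre i (series_exp ann (m + 1 - i) v)"
  have "series_ddiff 1 ?V m v = of_int (m + 1) *\<^sub>v Sum_any ?e"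
    by (simp only: series_ddiff_1) (simp add: normal_exp_def series_comp_def)
  also have "\<dots> = Sum_any (\<lambda>i. of_int i *\<^sub>v ?e i
      + series_exp cre i (of_int (m + 1 - i) *\<^sub>v series_exp ann (m + 1 - i) v))"
    unfolding scale_Sum_any[OF finsupp_normal_exp]
    by (rule Sum_any.cong)
      (simp add: module_hom.scale[OF cre.linop_exp] vec.scale_left_distrib[symmetric])
  also have "\<dots> = Sum_any (\<lambda>i. of_int i *\<^sub>v ?e i)
      + Sum_any (\<lambda>i. series_exp cre i (of_int (m + 1 - i) *\<^sub>v series_exp ann (m + 1 - i) v))"
    by (rule Sum_any_finsupp_add; rule finsupp_mono[OF finsupp_normal_exp[of "m + 1" v]])
      (simp_all add: module_hom.scale[OF cre.linop_exp])
  also have "\<dots> = Sum_any (\<lambda>l. if l > 0 then X (- l) (?V (m + 1 - l) v) else 0)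
      + Sum_any (\<lambda>l. if l < 0 then ?V (m + 1 - l) (X (- l) v) else 0)"
    by (simp only: series_comp_cre_euler series_comp_ann_euler)
  also have "\<dots> = Sum_any (\<lambda>i. if i \<ge> 0 then ?a i (?V (m - i) v) else 0)
      + Sum_any (\<lambda>i. if i < 0 then ?V (m - i) (?a i v) else 0)"
  proof (rule arg_cong2[of _ _ _ _ "(+)"])
    show "Sum_any (\<lambda>l. if l > 0 then X (- l) (?V (m + 1 - l) v) else 0) =
        Sum_any (\<lambda>i. if i \<ge> 0 then ?a i (?V (m - i) v) else 0)"
      by (subst Sum_any_reindex[OF bij_int_shift[of 1], symmetric], rule Sum_any.cong)
        (auto simp: oscillator_series_def algebra_simps)
    show "Sum_any (\<lambda>l. if l < 0 then ?V (m + 1 - l) (X (- l) v) else 0) =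
        Sum_any (\<lambda>i. if i < 0 then ?V (m - i) (?a i v) else 0)"
      by (subst Sum_any_reindex[OF bij_int_shift[of 1], symmetric], rule Sum_any.cong)
        (auto simp: oscillator_series_def algebra_simps vfield_zero[OF vfield_normal_exp])
  qed
  also have "\<dots> = normal_prod ?a ?V m v"
  proof -
    have "finsupp (np_term ?a ?V m v)"
      by (rule finsupp_np_term[OF vfield_oscillator_series vfield_normal_exp])
    then have "finsupp (\<lambda>i. if i \<ge> 0 then ?a i (?V (m - i) v) else 0)"
      "finsupp (\<lambda>i. if i < 0 then ?V (m - i) (?a i v) else 0)"
      by (rule finsupp_mono; simp split: if_splits)+
    from Sum_any_finsupp_add[OF this, symmetric] show ?thesis
      unfolding normal_prod_def by (simp cong: if_cong) (rule Sum_any.cong, simp)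
  qed
  finally show ?thesis .
qed

lemma vfield_modes: "vfield (\<lambda>m. X (- m - 1))"
proof (rule vfieldI[OF lin])
  fix v
  obtain N where "\<forall>n>N. X n v = 0" using annihilated by blast
  then show "\<exists>N. \<forall>m<N. X (- m - 1) v = 0"
    by (intro exI[of _ "- N - 1"]) simp
qed

text \<open>On a vector killed by all annihilation modes only the creation part acts, with expansion
  \<open>1 + z X\<^bsub>-1\<^esub> + \<dots>\<close>.\<close>
lemma normal_exp_highest_weight:
  assumes hw: "\<And>n. n > 0 \<Longrightarrow> X n v = 0"
  shows "m < 0 \<Longrightarrow> normal_exp X m v = 0" "normal_exp X 0 v = v" "normal_exp X 1 v = X (- 1) v"
proof -
  have pow: "series_pow ann j m v = (if j = 0 \<and> m = 0 then v else 0)" for j m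
  proof (induction j arbitrary: m)
    case (Suc j)
    have "ann i (if P then v else 0) = 0" for i P
      using hw by (simp add: ann_eq module_hom.zero[OF lin])
    then show ?case by (simp add: series_comp_def Suc)
  qed (simp add: series_one_def)
  have "series_exp ann m v = Sum_any (\<lambda>j::nat. if j = 0 then (if m = 0 then v else 0) else 0)" for m
    unfolding series_exp_def by (intro Sum_any.cong) (simp add: pow)
  then have ann: "series_exp ann m v = (if m = 0 then v else 0)" for m
    by (simp only: Sum_any.delta)
  have "normal_exp X m v = Sum_any (\<lambda>i. if i = m then series_exp cre i v else 0)" for m
    unfolding normal_exp_def series_comp_def
    by (intro Sum_any.cong) (simp add: ann module_hom.zero[OF cre.linop_exp])
  then have *: "normal_exp X m v = series_exp cre m v" for m
    by (simp only: Sum_any.delta)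
  show "m < 0 \<Longrightarrow> normal_exp X m v = 0" by (simp add: * cre.exp_vanish)
  have "series_exp cre 0 v = Sum_any (\<lambda>j::nat. if j = 0 then v else 0)"
    unfolding series_exp_def by (intro Sum_any.cong) (simp add: cre.pow_vanish series_one_def)
  then have 0: "series_exp cre 0 v = v" by simp
  then show "normal_exp X 0 v = v" by (simp add: *)
  have "of_int 1 *\<^sub>v series_exp cre 1 v = Sum_any (\<lambda>i::int. if i = 1 then X (- 1) v else 0)"
    unfolding cre.exp_euler[OF commuting_cre]
  proof (rule Sum_any.cong)
    fix i :: int
    consider "i \<le> 0" | "i = 1" | "i > 1" by linarith
    then show "of_int i *\<^sub>v cre i (series_exp cre (1 - i) v) = (if i = 1 then X (- 1) v else 0)"
      by cases (simp_all add: 0 cre_eq cre.exp_vanish module_hom.zero[OF lin])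
  qed
  then show "normal_exp X 1 v = X (- 1) v" by (simp add: *)
qed

end

text \<open>Here \<open>T\<close> is the shift of highest weight vectors. The zero modes of the bosons need not
  commute with it; their commutator with \<open>T\<close> is the case \<open>r = 0\<close> of the charge relation.\<close>
locale shifted_oscillators = oscillators X deg for X :: "int \<Rightarrow> 'x fvec \<Rightarrow> 'x fvec" and deg +
  fixes T :: "'x fvec \<Rightarrow> 'x fvec"
  assumes linT: "linop T" and commT: "\<And>n v. n \<noteq> 0 \<Longrightarrow> T (X n v) = X n (T v)"
begin

definition vertex :: "('x, 'x) opseries"
  where "vertex m v = T (normal_exp X m v)"

lemma vfield_vertex: "vfield vertex"
proof (rule vfieldI)
  show "linop (vertex m)" for m
    unfolding vertex_def[abs_def] by (rule linop_comp[OF linT vfield_linop[OF vfield_normal_exp]])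
  show "\<exists>N. \<forall>m<N. vertex m v = 0" for v
    by (intro exI[of _ "lowest (normal_exp X) v"])
      (simp add: vertex_def vfield_lowest[OF vfield_normal_exp] module_hom.zero[OF linT])
qed

lemma vertex_ddiff: "series_ddiff 1 vertex m v = normal_prod (oscillator_series X) vertex m v"
proof -
  have "series_ddiff 1 vertex m v = T (series_ddiff 1 (normal_exp X) m v)"
    by (simp only: series_ddiff_1 vertex_def module_hom.scale[OF linT])
  also have "\<dots> = T (Sum_any (np_term (oscillator_series X) (normal_exp X) m v))"
    by (simp only: normal_exp_ddiff normal_prod_def)
  also have "\<dots> = Sum_any (np_term (oscillator_series X) vertex m v)"
    unfolding linop_Sum_any[OF linT finsupp_np_term[OF vfield_oscillator_series vfield_normal_exp]]
    by (rule Sum_any.cong)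
      (simp add: oscillator_series_def vertex_def commT module_hom.zero[OF linT])
  finally show ?thesis by (simp only: normal_prod_def)
qed

lemma vertex_commute:
  assumes "linop Z" "\<And>n v. n \<noteq> 0 \<Longrightarrow> Z (X n v) = X n (Z v)" "\<And>v. Z (T v) = T (Z v)"
  shows "Z (vertex m v) = vertex m (Z v)"
  using normal_exp_commute[OF assms(1,2), of 0] by (simp add: vertex_def charged_def assms(3))

lemma vertex_charged:
  assumes Z: "linop Z"
    and ZX: "\<And>n v. n \<noteq> 0 \<Longrightarrow> Z (X n v) = X n (Z v) + (if n = - r then (g * of_int r) *\<^sub>v v else 0)"
    and ZX0: "\<And>v. r \<noteq> 0 \<Longrightarrow> Z (X 0 v) = X 0 (Z v)"
    and ZT: "\<And>v. Z (T v) = T (Z v) + (if r = 0 then g *\<^sub>v T v else 0)"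
  shows "charged Z (- r) g vertex"
proof (cases "r = 0")
  case True
  have "charged Z 0 0 (normal_exp X)"
    by (rule normal_exp_commute[OF Z]) (use ZX True in simp)
  then show ?thesis using True by (simp add: charged_def vertex_def ZT)
next
  case False
  have "charged Z (- r) g (normal_exp X)"
  proof (rule normal_exp_charged[OF Z False])
    show "Z (X n v) = X n (Z v) + (if n = - r then (g * of_int r) *\<^sub>v v else 0)" for n v
      using ZX ZX0 False by (cases "n = 0") auto
  qed
  then show ?thesis
    using False by (simp add: charged_def vertex_def ZT module_hom.add[OF linT] module_hom.scale[OF linT])
qed

lemma vertex_spanned:
  assumes X: "\<And>n v. v \<in> spanned K \<Longrightarrow> X n v \<in> spanned K"
    and T: "\<And>v. v \<in> spanned K \<Longrightarrow> T v \<in> spanned L" and v: "v \<in> spanned K"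
  shows "vertex m v \<in> spanned L"
proof -
  have "series_exp cre i w \<in> spanned K" if "w \<in> spanned K" for i w
    by (rule cre.exp_filtered[of "\<lambda>_. K", OF _ that])
      (auto simp: cre_eq intro: X spanned_scale spanned_0)
  moreover have "series_exp ann i v \<in> spanned K" for i
    by (rule ann.exp_filtered[of "\<lambda>_. K", OF _ v])
      (auto simp: ann_eq intro: X spanned_scale spanned_0)
  ultimately show ?thesis
    unfolding vertex_def normal_exp_def series_comp_def by (intro T spanned_Sum_any) blast
qed

lemma vertex_highest_weight:
  assumes hw: "\<And>n. n > 0 \<Longrightarrow> X n v = 0"
  shows "m < 0 \<Longrightarrow> vertex m v = 0" "vertex 0 v = T v" "vertex 1 v = X (- 1) (T v)"
  using normal_exp_highest_weight[OF hw] by (simp_all add: vertex_def module_hom.zero[OF linT] commT)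

end

section \<open>Fields on a tensor product\<close>

text \<open>Tensoring with a second factor turns a space into a sum of copies \<open>\<iota> z\<close> of it, on each of
  which \<open>L T\<close> acts as \<open>T\<close>. All constructions with fields are compatible with this; the locale
  treats the two factors of a tensor product at once.\<close>
locale amplification =
  fixes L :: "('x fvec \<Rightarrow> 'x fvec) \<Rightarrow> 'w fvec \<Rightarrow> 'w fvec" and \<iota> :: "'z \<Rightarrow> 'x fvec \<Rightarrow> 'w fvec"
  assumes linop_L: "linop (L T)" and linop_\<iota>: "linop (\<iota> z)"
    and L_\<iota>: "linop T \<Longrightarrow> L T (\<iota> z v) = \<iota> z (T v)"
    and exhaust: "\<exists>z x. basis w = \<iota> z (basis x)"
begin

lemma eqI:
  assumes "linop X" "linop X'" "\<And>z v. X (\<iota> z v) = X' (\<iota> z v)"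
  shows "X w = X' w"
proof (rule linop_eqI_on[OF assms(1,2)])
  show "X (basis x) = X' (basis x)" for x
    using exhaust[of x] assms(3) by auto
qed

lemma L_comp:
  assumes "linop T" "linop U"
  shows "L (\<lambda>v. T (U v)) w = L T (L U w)"
  by (rule eqI[OF linop_L linop_comp[OF linop_L linop_L]])
    (simp add: L_\<iota> assms linop_comp[OF assms])

lemma L_add: "linop T \<Longrightarrow> linop U \<Longrightarrow> L (\<lambda>v. T v + U v) w = L T w + L U w"
  by (rule eqI[OF linop_L linop_add[OF linop_L linop_L]])
    (simp add: L_\<iota> linop_add module_hom.add[OF linop_\<iota>])

lemma L_scale: "linop T \<Longrightarrow> L (\<lambda>v. c *\<^sub>v T v) w = c *\<^sub>v L T w"
  by (rule eqI[OF linop_L linop_scale[OF linop_L]])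
    (simp add: L_\<iota> linop_scale module_hom.scale[OF linop_\<iota>])

lemma L_zero: "L (\<lambda>v. 0) w = 0"
  by (rule eqI[OF linop_L linop_zero]) (simp add: L_\<iota> linop_zero module_hom.zero[OF linop_\<iota>])

lemma vfield_L:
  assumes "vfield A"
  shows "vfield (\<lambda>m. L (A m))"
proof (rule vfield_basisI[OF linop_L])
  fix w
  obtain z x where w: "basis w = \<iota> z (basis x)" using exhaust by blast
  show "\<exists>N. \<forall>m<N. L (A m) (basis w) = 0"
    by (intro exI[of _ "lowest A (basis x)"])
      (simp add: w L_\<iota> vfield_linop[OF assms] vfield_lowest[OF assms] module_hom.zero[OF linop_\<iota>])
qed

lemma L_normal_prod:
  assumes "vfield A" "vfield B"
  shows "L (normal_prod A B m) w = normal_prod (\<lambda>m. L (A m)) (\<lambda>m. L (B m)) m w"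
proof (rule eqI[OF linop_L vfield_linop[OF vfield_normal_prod[OF vfield_L vfield_L]]])
  note AB = vfield_normal_prod[OF assms]
  fix z v
  have "L (normal_prod A B m) (\<iota> z v) = \<iota> z (Sum_any (np_term A B m v))"
    by (simp only: L_\<iota>[OF vfield_linop[OF AB]] normal_prod_def)
  also have "\<dots> = normal_prod (\<lambda>m. L (A m)) (\<lambda>m. L (B m)) m (\<iota> z v)"
    unfolding linop_Sum_any[OF linop_\<iota> finsupp_np_term[OF assms]] normal_prod_def
    by (intro Sum_any.cong) (simp add: L_\<iota> vfield_linop[OF assms(1)] vfield_linop[OF assms(2)])
  finally show "L (normal_prod A B m) (\<iota> z v) = normal_prod (\<lambda>m. L (A m)) (\<lambda>m. L (B m)) m (\<iota> z v)" .
qed (rule assms)+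

lemma L_charged:
  assumes Z: "linop Z" and A: "\<And>m. linop (A m)" and "charged Z s g A"
  shows "charged (L Z) s g (\<lambda>m. L (A m))"
  unfolding charged_def
proof (intro allI)
  fix m w
  have "Z (A m v) = A m (Z v) + g *\<^sub>v A (m + s) v" for v using assms(3) by (simp add: charged_def)
  then have "L (\<lambda>v. Z (A m v)) w = L (\<lambda>v. A m (Z v) + g *\<^sub>v A (m + s) v) w" by simp
  also have "\<dots> = L (\<lambda>v. A m (Z v)) w + L (\<lambda>v. g *\<^sub>v A (m + s) v) w"
    by (rule L_add[OF linop_comp[OF A Z] linop_scale[OF A]])
  finally show "L Z (L (A m) w) = L (A m) (L Z w) + g *\<^sub>v L (A (m + s)) w"
    by (simp only: L_comp[OF Z A] L_comp[OF A Z] L_scale[OF A])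
qed

lemma L_commuting:
  assumes "vfield A" "vfield B" "commuting A B"
  shows "commuting (\<lambda>m. L (A m)) (\<lambda>m. L (B m))"
  unfolding commuting_def
proof (intro allI)
  fix i j w
  have "L (\<lambda>v. A i (B j v)) w = L (\<lambda>v. B j (A i v)) w" by (simp add: commutingD[OF assms(3)])
  then show "L (A i) (L (B j) w) = L (B j) (L (A i) w)"
    by (simp only: L_comp vfield_linop[OF assms(1)] vfield_linop[OF assms(2)])
qed

lemma L_ddiff: "vfield A \<Longrightarrow> L (series_ddiff 1 A m) w = series_ddiff 1 (\<lambda>m. L (A m)) m w"
  unfolding series_ddiff_1 series_ddiff_1[abs_def] by (rule L_scale[OF vfield_linop])

lemma L_no_zero_mode: "L (no_zero_mode A m) w = no_zero_mode (\<lambda>m. L (A m)) m w"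
  by (simp add: no_zero_mode_def[abs_def] L_zero)

end

lemma tensor_basis: "basis x \<otimes>\<^sub>v basis y = basis (x, y)"
  by (simp add: tensor_def)

lemma linop_tensor_left: "linop (\<lambda>v. v \<otimes>\<^sub>v w)"
  unfolding tensor_def by (rule linop_lin_ext)

lemma linop_tensor_right: "linop (\<lambda>w. v \<otimes>\<^sub>v w)"
proof -
  have lin: "linop (\<lambda>w. \<Sum>x\<in>K. Poly_Mapping.lookup v x *\<^sub>v lin_ext (\<lambda>y. basis (x, y)) w)" if "finite K" for K
    using that
  proof induction
    case (insert x K)
    from linop_add[OF linop_scale[OF linop_lin_ext] insert.IH] show ?case
      using insert.hyps by simp
  qed (simp add: linop_zero)
  show ?thesis unfolding tensor_def lin_ext_def[of _ v] by (rule lin) simp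
qed

definition lift1 :: "('x fvec \<Rightarrow> 'x' fvec) \<Rightarrow> ('x \<times> 'y) fvec \<Rightarrow> ('x' \<times> 'y) fvec"
  where "lift1 T = lin_ext (\<lambda>(x, y). T (basis x) \<otimes>\<^sub>v basis y)"

definition lift2 :: "('y fvec \<Rightarrow> 'y' fvec) \<Rightarrow> ('x \<times> 'y) fvec \<Rightarrow> ('x \<times> 'y') fvec"
  where "lift2 U = lin_ext (\<lambda>(x, y). basis x \<otimes>\<^sub>v U (basis y))"

lemma lift_basis: "lift1 T (basis (x, y)) = T (basis x) \<otimes>\<^sub>v basis y"
    "lift2 U (basis (x, y)) = basis x \<otimes>\<^sub>v U (basis y)"
  by (simp_all add: lift1_def lift2_def)

lemma linop_lift: "linop (lift1 T)" "linop (lift2 U)"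
  unfolding lift1_def lift2_def by (rule linop_lin_ext)+

lemma lift1_tensor: "linop T \<Longrightarrow> lift1 T (v \<otimes>\<^sub>v w) = T v \<otimes>\<^sub>v w"
proof (rule linop_eqI_on[of "\<lambda>v. lift1 T (v \<otimes>\<^sub>v w)" "\<lambda>v. T v \<otimes>\<^sub>v w"])
  fix x
  show "lift1 T (basis x \<otimes>\<^sub>v w) = T (basis x) \<otimes>\<^sub>v w"
    by (rule linop_eqI_on[of "\<lambda>w. lift1 T (basis x \<otimes>\<^sub>v w)" "\<lambda>w. T (basis x) \<otimes>\<^sub>v w"])
      (simp_all add: tensor_basis lift_basis linop_comp[OF linop_lift(1) linop_tensor_right] linop_tensor_right)
qed (simp_all add: linop_comp[OF linop_lift(1) linop_tensor_left] linop_comp[OF linop_tensor_left])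

lemma lift2_tensor: "linop U \<Longrightarrow> lift2 U (v \<otimes>\<^sub>v w) = v \<otimes>\<^sub>v U w"
proof (rule linop_eqI_on[of "\<lambda>v. lift2 U (v \<otimes>\<^sub>v w)" "\<lambda>v. v \<otimes>\<^sub>v U w"])
  fix x assume U: "linop U"
  show "lift2 U (basis x \<otimes>\<^sub>v w) = basis x \<otimes>\<^sub>v U w"
    by (rule linop_eqI_on[of "\<lambda>w. lift2 U (basis x \<otimes>\<^sub>v w)" "\<lambda>w. basis x \<otimes>\<^sub>v U w"])
      (simp_all add: tensor_basis lift_basis linop_comp[OF linop_lift(2) linop_tensor_right]
        linop_comp[OF linop_tensor_right U])
qed (simp_all add: linop_comp[OF linop_lift(2) linop_tensor_left] linop_tensor_left)

global_interpretation l1: amplification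
  "lift1 :: ('x fvec \<Rightarrow> 'x fvec) \<Rightarrow> ('x \<times> 'y) fvec \<Rightarrow> ('x \<times> 'y) fvec" "\<lambda>y v. v \<otimes>\<^sub>v basis y"
proof (rule amplification.intro[OF linop_lift(1) linop_tensor_left lift1_tensor])
  show "\<exists>y x. basis w = basis x \<otimes>\<^sub>v basis y" for w :: "'x \<times> 'y"
    by (intro exI[of _ "snd w"] exI[of _ "fst w"]) (simp add: tensor_basis)
qed

global_interpretation l2: amplification
  "lift2 :: ('y fvec \<Rightarrow> 'y fvec) \<Rightarrow> ('x \<times> 'y) fvec \<Rightarrow> ('x \<times> 'y) fvec" "\<lambda>x w. basis x \<otimes>\<^sub>v w"
proof (rule amplification.intro[OF linop_lift(2) linop_tensor_right lift2_tensor])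
  show "\<exists>x y. basis w = basis x \<otimes>\<^sub>v basis y" for w :: "'x \<times> 'y"
    by (intro exI[of _ "fst w"] exI[of _ "snd w"]) (simp add: tensor_basis)
qed

lemma lift1_lift2: "linop T \<Longrightarrow> linop U \<Longrightarrow> lift1 T (lift2 U v) = lift2 U (lift1 T v)"
proof (rule linop_eqI_on[of "\<lambda>v. lift1 T (lift2 U v)" "\<lambda>v. lift2 U (lift1 T v)"])
  fix x assume "linop T" "linop U"
  then show "lift1 T (lift2 U (basis x)) = lift2 U (lift1 T (basis x))"
    by (cases x) (simp add: lift_basis lift1_tensor lift2_tensor)
qed (intro linop_comp[OF linop_lift(1) linop_lift(2)] linop_comp[OF linop_lift(2) linop_lift(1)])+

lemma commuting_lift: "vfield A \<Longrightarrow> vfield B \<Longrightarrow> commuting (\<lambda>m. lift1 (A m)) (\<lambda>m. lift2 (B m))"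
  by (simp add: commuting_def lift1_lift2 vfield_linop)

lemma series_tensor_one_right: "series_tensor A series_one m = lift1 (A m)"
proof -
  have eq: "Sum_any (\<lambda>i. A i (basis x) \<otimes>\<^sub>v series_one (m - i) (basis y)) = A m (basis x) \<otimes>\<^sub>v basis y" for x and y :: 'y
  proof -
    have "Sum_any (\<lambda>i. A i (basis x) \<otimes>\<^sub>v series_one (m - i) (basis y)) =
        Sum_any (\<lambda>i. if i = m then A i (basis x) \<otimes>\<^sub>v basis y else 0)"
      by (rule Sum_any.cong) (simp add: series_one_def module_hom.zero[OF linop_tensor_right])
    then show ?thesis by simp
  qed
  show ?thesis by (simp add: series_tensor_def lift1_def case_prod_unfold eq)
qed

lemma series_tensor_one_left: "series_tensor series_one B m = lift2 (B m)"
proof -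
  have eq: "Sum_any (\<lambda>i. series_one i (basis x) \<otimes>\<^sub>v B (m - i) (basis y)) = basis x \<otimes>\<^sub>v B m (basis y)" for x :: 'x and y
  proof -
    have "Sum_any (\<lambda>i. series_one i (basis x) \<otimes>\<^sub>v B (m - i) (basis y)) =
        Sum_any (\<lambda>i. if i = 0 then basis x \<otimes>\<^sub>v B (m - i) (basis y) else 0)"
      by (rule Sum_any.cong) (simp add: series_one_def module_hom.zero[OF linop_tensor_left])
    then show ?thesis by simp
  qed
  show ?thesis by (simp add: series_tensor_def lift2_def case_prod_unfold eq)
qed

lemma series_tensor_eq:
  fixes A :: "('x, 'x) opseries" and B :: "('y, 'y) opseries"
  assumes A: "vfield A" and B: "vfield B"
  shows "series_tensor A B m v = series_comp (\<lambda>m. lift1 (A m)) (\<lambda>m. lift2 (B m)) m v"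
proof (rule linop_eqI_on[of "series_tensor A B m"])
  show "linop (series_tensor A B m)" by (simp add: series_tensor_def linop_lin_ext)
  show "linop (series_comp (\<lambda>m. lift1 (A m)) (\<lambda>m. lift2 (B m)) m)"
    by (rule vfield_linop[OF vfield_series_comp[OF l1.vfield_L[OF A] l2.vfield_L[OF B] commuting_lift[OF A B]]])
  show "series_tensor A B m (basis x) = series_comp (\<lambda>m. lift1 (A m)) (\<lambda>m. lift2 (B m)) m (basis x)" for x
    by (cases x)
      (simp add: series_tensor_def series_comp_def lift_basis lift1_tensor vfield_linop[OF A])
qed

lemma series_tensor_cong_on:
  assumes "v \<in> spanned (K \<times> M)" "\<And>m x. x \<in> K \<Longrightarrow> A m (basis x) = A' m (basis x)"
  shows "series_tensor A B m v = series_tensor A' B m v"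
  unfolding series_tensor_def
  by (rule lin_ext_cong_on) (use assms in \<open>auto simp: spanned_def intro!: Sum_any.cong\<close>)

lemma lift1_cong_on:
  assumes "v \<in> spanned (K \<times> M)" "\<And>x. x \<in> K \<Longrightarrow> T (basis x) = T' (basis x)"
  shows "lift1 T v = lift1 T' v"
  unfolding lift1_def
  by (rule lin_ext_cong_on) (use assms in \<open>auto simp: spanned_def\<close>)

lemma spanned_tensor: "v \<in> spanned K \<Longrightarrow> w \<in> spanned M \<Longrightarrow> v \<otimes>\<^sub>v w \<in> spanned (K \<times> M)"
  unfolding tensor_def
  by (rule spanned_lin_ext, assumption, rule spanned_lin_ext, assumption) (simp add: spanned_basis)

lemma spanned_lift1:
  assumes "v \<in> spanned (K \<times> M)" "\<And>x. x \<in> K \<Longrightarrow> T (basis x) \<in> spanned K'"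
  shows "lift1 T v \<in> spanned (K' \<times> M)"
  unfolding lift1_def
  by (rule spanned_lin_ext[OF assms(1)]) (auto intro!: spanned_tensor assms(2) simp: spanned_basis)

lemma spanned_lift2:
  assumes "v \<in> spanned (K \<times> M)" "\<And>y. y \<in> M \<Longrightarrow> U (basis y) \<in> spanned M'"
  shows "lift2 U v \<in> spanned (K \<times> M')"
  unfolding lift2_def
  by (rule spanned_lin_ext[OF assms(1)]) (auto intro!: spanned_tensor assms(2) simp: spanned_basis)

section \<open>The commutator of the current \<open>f(z)\<close> with the screening current\<close>

text \<open>What the computation of \<open>[f, S\<^bsub>-1\<^esub>]\<close> uses about the fields. The coefficient conventions
  give \<open>[y i, S (-1)] = g S i\<close> for a boson \<open>y\<close> of charge \<open>g\<close>, so commutators with the residue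
  reproduce the series \<open>S\<close> itself.\<close>
locale screening_system =
  fixes p q b G S :: "('x, 'x) opseries" and k \<beta> :: complex
  assumes fields: "vfield p" "vfield q" "vfield b" "vfield G" "vfield S"
    and \<beta>: "\<beta> = - (k + 2)"
    and charge_S: "\<And>i. charged (p i) (i + 1) \<beta> S" "\<And>i. charged (q i) (i + 1) (- \<beta>) S"
      "\<And>i. charged (b i) (i + 1) (- 2 * \<beta>) S"
    and G_comm: "commuting G S" "commuting G b" "commuting G (\<lambda>m v. p m v + q m v)"
    and ddiff_G: "\<And>m v. series_ddiff 1 G m v = - normal_prod (no_zero_mode (\<lambda>m v. p m v + q m v)) G m v"
    and ddiff_S: "\<And>m v. series_ddiff 1 S m v =
      \<beta> *\<^sub>v normal_prod (no_zero_mode (\<lambda>m v. p m v + q m v)) S m v + normal_prod (no_zero_mode b) S m v"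
begin

abbreviation "c \<equiv> no_zero_mode (\<lambda>m v. p m v + q m v)"

abbreviation "b' \<equiv> no_zero_mode b"

abbreviation "P \<equiv> series_comp G S"

abbreviation "T \<equiv> S (- 1)"

definition f_current :: "('x, 'x) opseries"
  where "f_current m v = normal_prod p (normal_prod p G) m v + 2 *\<^sub>v normal_prod p (normal_prod q G) m v
    - normal_prod (series_ddiff 1 p) G m v - k *\<^sub>v series_ddiff 1 (normal_prod p G) m v
    - normal_prod b (normal_prod p G) m v"

lemma vfield_c: "vfield c" and vfield_b': "vfield b'" and vfield_P: "vfield P"
  by (intro vfield_no_zero_mode vfield_add vfield_series_comp fields G_comm)+

lemma linop_T: "linop T"
  by (rule vfield_linop[OF fields(5)])

lemma mode_T:
  "p i (T v) = T (p i v) + \<beta> *\<^sub>v S i v" "q i (T v) = T (q i v) + (- \<beta>) *\<^sub>v S i v"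
  "b i (T v) = T (b i v) + (- 2 * \<beta>) *\<^sub>v S i v" "G i (T v) = T (G i v)"
  using charge_S[of i] G_comm(1) unfolding charged_def commuting_def by simp_all

lemma commuting_c: "commuting S c" "commuting G c" "commuting G b'"
proof -
  have "p i (S m v) + q i (S m v) = S m (p i v + q i v)" for i m v
    using charge_S(1,2)[of i] by (simp add: charged_def module_hom.add[OF vfield_linop[OF fields(5)]])
  then have "commuting S (\<lambda>m v. p m v + q m v)" by (simp add: commuting_def)
  then show "commuting S c" by (rule commuting_no_zero_mode[OF fields(5)])
qed (rule commuting_no_zero_mode[OF fields(4)] G_comm)+

lemma S_G: "normal_prod S G m v = P m v"
  by (rule normal_prod_commuting[OF commuting_sym[OF G_comm(1)]])

lemma G_T: "G i (T v) = T (G i v) + 0"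
  by (simp add: mode_T(4))

lemma commutator_uG:
  assumes u: "vfield u" and uT: "\<And>i v. u i (T v) = T (u i v) + g *\<^sub>v S i v"
  shows "normal_prod u G m (T v) = T (normal_prod u G m v) + g *\<^sub>v P m v"
  using normal_prod_commutator[OF u fields(4) linop_T fields(5) vfield_0 uT G_T, of m v]
  by (simp only: S_G normal_prod_zero_right[OF u] add_0_right)

text \<open>The first correction is the inner commutator \<open>[:uG:, S\<^bsub>-1\<^esub>] = g P\<close>, the second is
  \<open>h :S(uG):\<close> rewritten by quasi-associativity.\<close>
lemma commutator_wuG:
  assumes w: "vfield w" and wT: "\<And>i v. w i (T v) = T (w i v) + h *\<^sub>v S i v"
    and u: "vfield u" and chg: "\<And>i. charged (u i) (i + 1) g S"
  shows "normal_prod w (normal_prod u G) m (T v) = T (normal_prod w (normal_prod u G) m v)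
    + g *\<^sub>v normal_prod w P m v + h *\<^sub>v (normal_prod u P m v - g *\<^sub>v series_comp G (series_ddiff 1 S) m v)"
proof -
  have "u i (T v) = T (u i v) + g *\<^sub>v S i v" for i v
    using chg[of i] by (simp add: charged_def)
  note uG = commutator_uG[OF u this]
  show ?thesis
    using normal_prod_commutator[OF w vfield_normal_prod[OF u fields(4)] linop_T fields(5)
        vfield_scale[OF vfield_P] wT uG, of m v]
    by (simp only: normal_prod_scale_right[OF w vfield_P]
        normal_prod_quasi_assoc[OF u fields(4,5) G_comm(1) chg])
qed

text \<open>The bosonic coefficient \<open>(i + 1) p (i + 1)\<close> of \<open>\<partial>p\<close> has commutator \<open>\<beta> (i + 1) S (i + 1)\<close>,
  the coefficient of \<open>\<beta> \<partial>S\<close>.\<close>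
lemma commutator_ddiff_p:
  "normal_prod (series_ddiff 1 p) G m (T v) =
    T (normal_prod (series_ddiff 1 p) G m v) + \<beta> *\<^sub>v series_comp G (series_ddiff 1 S) m v"
proof -
  have "commuting (series_ddiff 1 S) G"
    using commuting_sym[OF G_comm(1)]
    by (simp add: commuting_def series_ddiff_Suc_0 module_hom.scale[OF vfield_linop[OF fields(4)]])
  note SG = normal_prod_commuting[OF this]
  have "p i (T v) = T (p i v) + \<beta> *\<^sub>v S i v" for i v by (rule mode_T)
  then have dp: "series_ddiff 1 p i (T v) = T (series_ddiff 1 p i v) + \<beta> *\<^sub>v series_ddiff 1 S i v" for i v
    by (simp add: series_ddiff_Suc_0 module_hom.scale[OF linop_T] vec.scale_right_distrib mult.commute)
  show ?thesis
    using normal_prod_commutator[OF vfield_ddiff[OF fields(1)] fields(4) linop_T vfield_ddiff[OF fields(5)]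
        vfield_0 dp G_T, of m v]
    by (simp only: SG normal_prod_zero_right[OF vfield_ddiff[OF fields(1)]] add_0_right)
qed

lemma G_ddiff_S:
  "series_comp G (series_ddiff 1 S) m v = \<beta> *\<^sub>v normal_prod c P m v + normal_prod b' P m v"
proof -
  have comm: "commuting G (normal_prod c S)" "commuting G (normal_prod b' S)"
    by (intro commuting_normal_prod vfield_c vfield_b' fields commuting_c G_comm)+
  have "series_comp G (series_ddiff 1 S) m v =
      Sum_any (\<lambda>i. \<beta> *\<^sub>v G i (normal_prod c S (m - i) v) + G i (normal_prod b' S (m - i) v))"
    unfolding series_comp_def ddiff_S
    by (simp add: module_hom.add[OF vfield_linop[OF fields(4)]] module_hom.scale[OF vfield_linop[OF fields(4)]])
  also have "\<dots> = \<beta> *\<^sub>v series_comp G (normal_prod c S) m v + series_comp G (normal_prod b' S) m v"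
    unfolding series_comp_def
    by (simp add: Sum_any_finsupp_add scale_Sum_any finsupp_linop[OF linop_scale[OF linop_id]]
        finsupp_series_comp[OF fields(4) vfield_normal_prod[OF vfield_c fields(5)] comm(1)]
        finsupp_series_comp[OF fields(4) vfield_normal_prod[OF vfield_b' fields(5)] comm(2)])
  finally show ?thesis
    by (simp add: series_comp_normal_prod[OF fields(4) vfield_c fields(5) commuting_c(2) G_comm(1)]
        series_comp_normal_prod[OF fields(4) vfield_b' fields(5) commuting_c(3) G_comm(1)])
qed

lemma ddiff_P:
  "series_ddiff 1 P m v = series_comp G (series_ddiff 1 S) m v - normal_prod c P m v"
proof -
  have SG: "series_comp S G = P"
    using series_comp_commute[OF G_comm(1)] by (intro ext) simp
  have comm: "commuting S (normal_prod c G)"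
    by (intro commuting_normal_prod vfield_c fields commuting_c commuting_sym[OF G_comm(1)])
  have "series_comp (series_ddiff 1 G) S m v = - series_comp (normal_prod c G) S m v"
    unfolding series_comp_def ddiff_G
    using scale_Sum_any[OF finsupp_series_comp[OF vfield_normal_prod[OF vfield_c fields(4)] fields(5)
          commuting_sym[OF comm]], of "- 1" m v]
    by simp
  also have "series_comp (normal_prod c G) S m v = series_comp S (normal_prod c G) m v"
    by (rule series_comp_commute[OF commuting_sym[OF comm]])
  also have "\<dots> = normal_prod c P m v"
    unfolding SG[symmetric]
    by (rule series_comp_normal_prod[OF fields(5) vfield_c fields(4) commuting_c(1) commuting_sym[OF G_comm(1)]])
  finally show ?thesis
    using ddiff_series_comp[of G S, OF vfield_linop[OF fields(4)] finsupp_series_comp[OF fields(4,5) G_comm(1)]]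
    by (simp del: One_nat_def)
qed

text \<open>The hypotheses are that the zero modes of \<open>p + q\<close> and \<open>b\<close> kill \<open>v\<close>. Only then may the
  bosons without zero modes from the derivative rules be replaced by \<open>p + q\<close> and \<open>b\<close>: in \<open>:yP:\<close>
  the zero mode of \<open>y\<close> is applied to \<open>v\<close> first.\<close>
lemma f_current_screening:
  assumes "p (- 1) v + q (- 1) v = 0" "b (- 1) v = 0"
  shows "f_current m (T v) = T (f_current m v)"
proof -
  have cP: "normal_prod c P m v = normal_prod p P m v + normal_prod q P m v" for m
    unfolding normal_prod_add_left[OF fields(1,2) vfield_P, symmetric]
    by (rule normal_prod_cong_left) (use assms in \<open>auto simp: no_zero_mode_def\<close>)
  have bP: "normal_prod b' P m v = normal_prod b P m v"
    by (rule normal_prod_cong_left) (use assms in \<open>auto simp: no_zero_mode_def\<close>)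
  have dpG: "series_ddiff 1 (normal_prod p G) m (T v) =
      T (series_ddiff 1 (normal_prod p G) m v) + \<beta> *\<^sub>v series_ddiff 1 P m v"
    using commutator_uG[OF fields(1) mode_T(1)]
    by (simp add: series_ddiff_Suc_0 module_hom.scale[OF linop_T] vec.scale_right_distrib mult.commute)
  \<comment> \<open>Once \<open>k\<close> is eliminated, the remaining claim is, in each coordinate, a polynomial
    identity.\<close>
  have k: "k = - \<beta> - 2" using \<beta> by simp
  show ?thesis
    unfolding f_current_def
      commutator_wuG[OF fields(1) mode_T(1) fields(1) charge_S(1)]
      commutator_wuG[OF fields(1) mode_T(1) fields(2) charge_S(2)]
      commutator_wuG[OF fields(3) mode_T(3) fields(1) charge_S(1)]
      commutator_ddiff_p dpG ddiff_P G_ddiff_S cP bP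
    by (rule poly_mapping_eqI)
      (simp only: k module_hom.add[OF linop_T] module_hom.diff[OF linop_T] module_hom.scale[OF linop_T]
        lookup_add lookup_minus lookup_scale, algebra)
qed

end

section \<open>The Fock modules\<close>

text \<open>The Heisenberg relation, with an arbitrary embedding \<open>f\<close> of monomials so that it applies
  to the bosons \<open>p\<close>, \<open>q\<close> and \<open>b\<close> alike. The only nontrivial case is a creation and an
  annihilation mode: removing what has just been added raises the multiplicity by one if the two
  indices match.\<close>
lemma osc_commutator:
  "(osc_coeff g c m M * osc_coeff g c n (osc_mon m M)) *\<^sub>v basis (f (osc_mon n (osc_mon m M))) =
   (osc_coeff g c n M * osc_coeff g c m (osc_mon n M)) *\<^sub>v basis (f (osc_mon m (osc_mon n M))) +
   (if n = - m then (g * of_int n) *\<^sub>v basis (f M) else 0)"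
proof -
  have pos_neg: "(osc_coeff g c m M * osc_coeff g c n (osc_mon m M)) *\<^sub>v basis (f (osc_mon n (osc_mon m M))) =
   (osc_coeff g c n M * osc_coeff g c m (osc_mon n M)) *\<^sub>v basis (f (osc_mon m (osc_mon n M))) +
   (if n = - m then (g * of_int n) *\<^sub>v basis (f M) else 0)" if "n > 0" "m < 0" for n m
  proof -
    define a b where "a = nat n - 1" and "b = nat (- m) - 1"
    have ab: "a = b \<longleftrightarrow> n = - m" using that by (auto simp: a_def b_def)
    have eq: "osc_mon n (osc_mon m M) = add_mset b M - {#a#}" "osc_mon m (osc_mon n M) = add_mset b (M - {#a#})"
      "osc_coeff g c m M = 1" "osc_coeff g c m (osc_mon n M) = 1"
      "osc_coeff g c n M = g * of_int n * of_nat (count M a)"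
      "osc_coeff g c n (osc_mon m M) = g * of_int n * of_nat (count (add_mset b M) a)"
      using that by (simp_all add: osc_mon_def osc_coeff_def a_def b_def)
    show ?thesis
      unfolding eq ab[symmetric]
      by (cases "a \<in># M") (auto simp: vec.scale_left_distrib algebra_simps not_in_iff)
  qed
  consider "n > 0 \<and> m < 0" | "n < 0 \<and> m > 0" | "n > 0 \<and> m > 0" | "n < 0 \<and> m < 0" | "n = 0" | "m = 0" by linarith
  then show ?thesis
  proof cases
    case 1
    then show ?thesis by (intro pos_neg) auto
  next
    case 2
    then show ?thesis using pos_neg[of m n] by auto
  next
    case 3
    define a b where "a = nat n - 1" and "b = nat m - 1"
    have "osc_mon n (osc_mon m M) = osc_mon m (osc_mon n M)"
      using 3 by (simp add: osc_mon_def add_mset_commute)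
    moreover have "osc_coeff g c m M * osc_coeff g c n (osc_mon m M) =
        (g * of_int m * (g * of_int n)) * of_nat (count M b * count (M - {#b#}) a)"
      "osc_coeff g c n M * osc_coeff g c m (osc_mon n M) =
        (g * of_int m * (g * of_int n)) * of_nat (count M a * count (M - {#a#}) b)"
      using 3 by (simp_all add: osc_coeff_def osc_mon_def a_def b_def)
    moreover have "count M b * count (M - {#b#}) a = count M a * count (M - {#a#}) b"
      by (cases "a = b") simp_all
    moreover have "n \<noteq> - m" using 3 by simp
    ultimately show ?thesis by (simp only: if_False add_0_right)
  next
    case 4
    then show ?thesis by (simp add: osc_mon_def osc_coeff_def add_mset_commute)
  next
    case 5
    then show ?thesis by (cases "m = 0") (simp_all add: osc_mon_def osc_coeff_def mult.commute)
  next
    case 6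
    then show ?thesis by (cases "n = 0") (simp_all add: osc_mon_def osc_coeff_def mult.commute)
  qed
qed

definition osc_degree :: "nat multiset \<Rightarrow> nat"
  where "osc_degree M = sum_mset (image_mset Suc M)"

text \<open>The degree drops only if the part to be removed occurs in \<open>M\<close>; otherwise multiset
  difference returns \<open>M\<close> itself, and the coefficient is \<open>0\<close>.\<close>
lemma osc_lowering:
  assumes "n > 0"
  shows "osc_coeff g c n M = 0 \<or> osc_degree M = osc_degree (osc_mon n M) + nat n"
proof (cases "nat n - 1 \<in># M")
  case True
  then obtain M' where "M = add_mset (nat n - 1) M'" by (metis insert_DiffM)
  then show ?thesis using assms by (simp add: osc_mon_def osc_degree_def)
qed (use assms in \<open>simp add: osc_coeff_def not_in_iff\<close>)

lemma p_mode_basis: "p_mode n (basis (l, m, A, B)) = osc_coeff 1 l n A *\<^sub>v basis (l, m, osc_mon n A, B)"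
  and q_mode_basis: "q_mode n (basis (l, m, A, B)) = osc_coeff (- 1) (- m) n B *\<^sub>v basis (l, m, A, osc_mon n B)"
  and b_mode_basis: "b_mode k n (basis (l, M)) = osc_coeff (2 * (k + 2)) l n M *\<^sub>v basis (l, osc_mon n M)"
  by (simp_all add: p_mode_def q_mode_def b_mode_def)

lemma linop_modes: "linop (p_mode n)" "linop (q_mode n)" "linop (b_mode k n)"
  by (simp_all add: p_mode_def q_mode_def b_mode_def linop_lin_ext)

lemma linop_shifts: "linop (pq_shift l m)" "linop (b_shift l)"
  by (simp_all add: pq_shift_def b_shift_def linop_lin_ext)

lemma mode_zero [simp]: "p_mode n 0 = 0" "q_mode n 0 = 0" "b_mode k n 0 = 0"
    "pq_shift l m 0 = 0" "b_shift l 0 = 0"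
  using linop_modes linop_shifts by (blast intro: module_hom.zero)+

lemmas mode_linear = linop_modes[THEN module_hom.scale] linop_modes[THEN module_hom.add]
  linop_shifts[THEN module_hom.scale] linop_shifts[THEN module_hom.add]

lemma p_mode_commutator:
  "p_mode n (p_mode m v) = p_mode m (p_mode n v) + (if n = - m then of_int n *\<^sub>v v else 0)"
proof (rule linop_eqI_on[of "\<lambda>v. p_mode n (p_mode m v)"])
  fix x :: pq_basis
  obtain l a A B where x: "x = (l, a, A, B)" by (cases x)
  show "p_mode n (p_mode m (basis x)) =
      p_mode m (p_mode n (basis x)) + (if n = - m then of_int n *\<^sub>v basis x else 0)"
    using osc_commutator[of 1 l m A n "\<lambda>A. (l, a, A, B)"]
    unfolding x by (simp only: p_mode_basis mode_linear vec.scale_scale mult_1)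
qed (intro linop_add linop_if linop_scale linop_id linop_zero
    linop_comp[OF linop_modes(1) linop_modes(1)])+

lemma q_mode_commutator:
  "q_mode n (q_mode m v) = q_mode m (q_mode n v) + (if n = - m then - of_int n *\<^sub>v v else 0)"
proof (rule linop_eqI_on[of "\<lambda>v. q_mode n (q_mode m v)"])
  fix x :: pq_basis
  obtain l a A B where x: "x = (l, a, A, B)" by (cases x)
  show "q_mode n (q_mode m (basis x)) =
      q_mode m (q_mode n (basis x)) + (if n = - m then - of_int n *\<^sub>v basis x else 0)"
    using osc_commutator[of "- 1" "- a" m B n "\<lambda>B. (l, a, A, B)"]
    unfolding x by (simp only: q_mode_basis mode_linear vec.scale_scale mult_minus1)
qed (intro linop_add linop_if linop_scale linop_id linop_zero
    linop_comp[OF linop_modes(2) linop_modes(2)])+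

lemma p_q_mode_commute: "p_mode n (q_mode m v) = q_mode m (p_mode n v)"
proof (rule linop_eqI_on[of "\<lambda>v. p_mode n (q_mode m v)"])
  fix x :: pq_basis
  show "p_mode n (q_mode m (basis x)) = q_mode m (p_mode n (basis x))"
    by (cases x) (simp add: p_mode_basis q_mode_basis mode_linear mult.commute)
qed (intro linop_comp[OF linop_modes(1) linop_modes(2)] linop_comp[OF linop_modes(2) linop_modes(1)])+

lemma b_mode_commutator:
  "b_mode k n (b_mode k m v) = b_mode k m (b_mode k n v)
    + (if n = - m then (2 * (k + 2) * of_int n) *\<^sub>v v else 0)"
proof (rule linop_eqI_on[of "\<lambda>v. b_mode k n (b_mode k m v)"])
  fix x :: b_basis
  obtain l M where x: "x = (l, M)" by (cases x)
  show "b_mode k n (b_mode k m (basis x)) = b_mode k m (b_mode k n (basis x))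
      + (if n = - m then (2 * (k + 2) * of_int n) *\<^sub>v basis x else 0)"
    using osc_commutator[of "2 * (k + 2)" l m M n "\<lambda>M. (l, M)"]
    unfolding x by (simp only: b_mode_basis mode_linear vec.scale_scale)
qed (intro linop_add linop_if linop_scale linop_id linop_zero
    linop_comp[OF linop_modes(3) linop_modes(3)])+

definition pq_degree :: "pq_basis \<Rightarrow> nat"
  where "pq_degree = (\<lambda>(l, m, A, B). osc_degree A + osc_degree B)"

definition b_degree :: "b_basis \<Rightarrow> nat"
  where "b_degree = (\<lambda>(l, M). osc_degree M)"

lemma p_mode_lowering: "n > 0 \<Longrightarrow> p_mode n (basis x) \<in> spanned (degree_le pq_degree (int (pq_degree x) - n))"
  and q_mode_lowering: "n > 0 \<Longrightarrow> q_mode n (basis x) \<in> spanned (degree_le pq_degree (int (pq_degree x) - n))"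
proof -
  assume n: "n > 0"
  obtain l a A B where x: "x = (l, a, A, B)" by (cases x)
  show "p_mode n (basis x) \<in> spanned (degree_le pq_degree (int (pq_degree x) - n))"
    using osc_lowering[OF n, of 1 l A] n
    by (elim disjE) (simp_all add: x p_mode_basis pq_degree_def degree_le_def spanned_basis spanned_0 spanned_scale)
  show "q_mode n (basis x) \<in> spanned (degree_le pq_degree (int (pq_degree x) - n))"
    using osc_lowering[OF n, of "- 1" "- a" B] n
    by (elim disjE) (simp_all add: x q_mode_basis pq_degree_def degree_le_def spanned_basis spanned_0 spanned_scale)
qed

lemma b_mode_lowering: "n > 0 \<Longrightarrow> b_mode k n (basis x) \<in> spanned (degree_le b_degree (int (b_degree x) - n))"
proof -
  assume n: "n > 0"
  obtain l M where x: "x = (l, M)" by (cases x)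
  show ?thesis
    using osc_lowering[OF n, of "2 * (k + 2)" l M] n
    by (elim disjE) (simp_all add: x b_mode_basis b_degree_def degree_le_def spanned_basis spanned_0 spanned_scale)
qed

text \<open>The modes of \<open>l(p(z) + q(z))\<close>, in the form in which they enter \<open>V\<^bsub>l,l\<^esub>(z)\<close>.\<close>
definition c_mode :: "complex \<Rightarrow> int \<Rightarrow> pq_basis fvec \<Rightarrow> pq_basis fvec"
  where "c_mode l n v = l *\<^sub>v p_mode n v + l *\<^sub>v q_mode n v"

text \<open>The contributions of \<open>p\<close> and \<open>q\<close> to the commutator have opposite signs and cancel.\<close>
lemma c_mode_commute: "c_mode l n (c_mode l' m v) = c_mode l' m (c_mode l n v)"
  using p_mode_commutator[of n m v] q_mode_commutator[of n m v]
  by (auto simp: c_mode_def mode_linear p_q_mode_commute algebra_simps vec.scale_right_distrib)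

lemma p_c_commutator:
  "p_mode r (c_mode l n v) = c_mode l n (p_mode r v) + (if n = - r then (l * of_int r) *\<^sub>v v else 0)"
  using p_mode_commutator[of r n v]
  by (auto simp: c_mode_def mode_linear p_q_mode_commute algebra_simps vec.scale_right_distrib)

lemma q_c_commutator:
  "q_mode r (c_mode l n v) = c_mode l n (q_mode r v) + (if n = - r then (- l * of_int r) *\<^sub>v v else 0)"
  using q_mode_commutator[of r n v]
  by (auto simp: c_mode_def mode_linear p_q_mode_commute algebra_simps vec.scale_right_distrib)

lemma pq_shift_basis: "pq_shift l m (basis (l', m', A, B)) = basis (l + l', m + m', A, B)"
  and b_shift_basis: "b_shift l (basis (l', M)) = basis (l + l', M)"
  by (simp_all add: pq_shift_def b_shift_def)

lemma p_shift_commutator: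
  "p_mode n (pq_shift l m v) = pq_shift l m (p_mode n v) + (if n = 0 then l *\<^sub>v pq_shift l m v else 0)"
proof (rule linop_eqI_on[of "\<lambda>v. p_mode n (pq_shift l m v)"])
  fix x :: pq_basis
  show "p_mode n (pq_shift l m (basis x)) = pq_shift l m (p_mode n (basis x))
      + (if n = 0 then l *\<^sub>v pq_shift l m (basis x) else 0)"
    by (cases x) (simp add: p_mode_basis pq_shift_basis mode_linear osc_coeff_def osc_mon_def
        vec.scale_left_distrib)
qed (intro linop_add linop_if linop_scale linop_zero linop_shifts
    linop_comp[OF linop_modes(1) linop_shifts(1)] linop_comp[OF linop_shifts(1) linop_modes(1)])+

lemma q_shift_commutator:
  "q_mode n (pq_shift l m v) = pq_shift l m (q_mode n v) + (if n = 0 then - m *\<^sub>v pq_shift l m v else 0)"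
proof (rule linop_eqI_on[of "\<lambda>v. q_mode n (pq_shift l m v)"])
  fix x :: pq_basis
  show "q_mode n (pq_shift l m (basis x)) = pq_shift l m (q_mode n (basis x))
      + (if n = 0 then - m *\<^sub>v pq_shift l m (basis x) else 0)"
    by (cases x) (simp add: q_mode_basis pq_shift_basis mode_linear osc_coeff_def osc_mon_def
        vec.scale_left_diff_distrib)
qed (intro linop_add linop_if linop_scale linop_zero linop_shifts
    linop_comp[OF linop_modes(2) linop_shifts(1)] linop_comp[OF linop_shifts(1) linop_modes(2)])+

lemma b_shift_commutator:
  "b_mode k n (b_shift l v) = b_shift l (b_mode k n v) + (if n = 0 then l *\<^sub>v b_shift l v else 0)"
proof (rule linop_eqI_on[of "\<lambda>v. b_mode k n (b_shift l v)"])
  fix x :: b_basis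
  show "b_mode k n (b_shift l (basis x)) = b_shift l (b_mode k n (basis x))
      + (if n = 0 then l *\<^sub>v b_shift l (basis x) else 0)"
    by (cases x) (simp add: b_mode_basis b_shift_basis mode_linear osc_coeff_def osc_mon_def
        vec.scale_left_distrib)
qed (intro linop_add linop_if linop_scale linop_zero linop_shifts
    linop_comp[OF linop_modes(3) linop_shifts(2)] linop_comp[OF linop_shifts(2) linop_modes(3)])+

lemma pq_shift_shift: "pq_shift l m (pq_shift l' m' v) = pq_shift l' m' (pq_shift l m v)"
proof (rule linop_eqI_on[of "\<lambda>v. pq_shift l m (pq_shift l' m' v)"])
  show "pq_shift l m (pq_shift l' m' (basis x)) = pq_shift l' m' (pq_shift l m (basis x))" for x
    by (cases x) (simp add: pq_shift_basis add.left_commute)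
qed (intro linop_comp[OF linop_shifts(1) linop_shifts(1)])+

lemma c_shift_commute: "c_mode l n (pq_shift m m v) = pq_shift m m (c_mode l n v)"
  by (simp add: c_mode_def mode_linear p_shift_commutator q_shift_commutator vec.scale_right_distrib
      algebra_simps)

lemma linop_c_mode: "linop (c_mode l n)"
  unfolding c_mode_def[abs_def] by (intro linop_add linop_scale linop_modes)

lemma same_sign_neq: "0 < n * m \<Longrightarrow> n \<noteq> - m" for n m :: int
  by (auto simp: zero_less_mult_iff)

interpretation p: oscillators p_mode pq_degree
proof (rule oscillators.intro[OF linop_modes(1)])
  show "p_mode n (p_mode m v) = p_mode m (p_mode n v)" if "0 < n * m" for n m v
    using p_mode_commutator[of n m v] same_sign_neq[OF that] by simp
qed (rule p_mode_lowering)

interpretation q: oscillators q_mode pq_degree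
proof (rule oscillators.intro[OF linop_modes(2)])
  show "q_mode n (q_mode m v) = q_mode m (q_mode n v)" if "0 < n * m" for n m v
    using q_mode_commutator[of n m v] same_sign_neq[OF that] by simp
qed (rule q_mode_lowering)

global_interpretation c: shifted_oscillators "c_mode l" pq_degree "pq_shift l l" for l
proof (rule shifted_oscillators.intro[OF oscillators.intro shifted_oscillators_axioms.intro])
  show "c_mode l n (basis x) \<in> spanned (degree_le pq_degree (int (pq_degree x) - n))" if "0 < n" for n x
    unfolding c_mode_def using that
    by (intro spanned_add spanned_scale p_mode_lowering q_mode_lowering)
qed (simp_all add: linop_c_mode c_mode_commute linop_shifts c_shift_commute)

global_interpretation b: shifted_oscillators "b_mode k" b_degree "b_shift (2 * (k + 2))" for k
proof (rule shifted_oscillators.intro[OF oscillators.intro shifted_oscillators_axioms.intro])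
  show "b_mode k n (b_mode k m v) = b_mode k m (b_mode k n v)" if "0 < n * m" for n m v
    using b_mode_commutator[of k n m v] same_sign_neq[OF that] by simp
qed (simp_all add: linop_modes b_mode_lowering linop_shifts b_shift_commutator)

text \<open>\<open>V\<^bsub>l,l\<^esub>(z)\<close> without its power of \<open>z\<close>. On \<open>\<Pi>\<^bsub>\<lambda>,\<lambda>\<^esub>\<close> that power is \<open>z\<^bsup>l\<lambda>-l\<lambda>\<^esup> = 1\<close>, so the two
  agree on every \<open>\<Pi>\<^sub>\<alpha>\<close>, while this one satisfies the commutation relations on the whole space.\<close>
definition pq_charge :: "complex \<Rightarrow> (pq_basis, pq_basis) opseries"
  where "pq_charge l = shifted_oscillators.vertex (c_mode l) (pq_shift l l)"

lemma pq_charge_eq: "pq_charge l = c.vertex l"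
  by (simp add: pq_charge_def)

lemma b_vertex_eq: "b_vertex k = b.vertex k"
  by (intro ext) (simp only: b_vertex_def b.vertex_def)

lemma vfield_p: "vfield p_series" and vfield_q: "vfield q_series" and vfield_b: "vfield (b_series k)"
  using p.vfield_modes q.vfield_modes b.vfield_modes
  by (simp_all add: p_series_def[abs_def] q_series_def[abs_def] b_series_def[abs_def])

lemma vfield_pq_charge: "vfield (pq_charge l)" and vfield_b_vertex: "vfield (b_vertex k)"
  unfolding pq_charge_eq b_vertex_eq by (rule c.vfield_vertex, rule b.vfield_vertex)

lemma pq_charge_p: "charged (p_series i) (i + 1) l (pq_charge l)"
proof -
  have "charged (p_mode (- i - 1)) (- (- i - 1)) l (c.vertex l)"
    by (rule c.vertex_charged)
      (auto simp: linop_modes p_c_commutator p_shift_commutator)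
  then show ?thesis by (simp add: p_series_def pq_charge_eq add.commute)
qed

lemma pq_charge_q: "charged (q_series i) (i + 1) (- l) (pq_charge l)"
proof -
  have "charged (q_mode (- i - 1)) (- (- i - 1)) (- l) (c.vertex l)"
    by (rule c.vertex_charged)
      (auto simp: linop_modes q_c_commutator q_shift_commutator)
  then show ?thesis by (simp add: q_series_def pq_charge_eq add.commute)
qed

lemma b_vertex_charge: "charged (b_series k i) (i + 1) (2 * (k + 2)) (b_vertex k)"
proof -
  have "charged (b_mode k (- i - 1)) (- (- i - 1)) (2 * (k + 2)) (b.vertex k)"
    by (rule b.vertex_charged)
      (auto simp: linop_modes b_shift_commutator intro: trans[OF b_mode_commutator])
  then show ?thesis unfolding b_series_def b_vertex_eq by (simp add: add.commute)
qed

lemma pq_charge_c_commute: "pq_charge l i (c_mode l' n v) = c_mode l' n (pq_charge l i v)"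
  using pq_charge_p[of "- n - 1" l] pq_charge_q[of "- n - 1" l]
  by (simp add: charged_def p_series_def q_series_def c_mode_def vec.scale_right_distrib
      module_hom.add[OF vfield_linop[OF vfield_pq_charge]] module_hom.scale[OF vfield_linop[OF vfield_pq_charge]]
      vec.scale_right_diff_distrib)

text \<open>\<open>V\<^bsub>l,l\<^esub>\<close> commutes with all modes of \<open>p + q\<close>, its charges with respect to \<open>p\<close> and \<open>q\<close> being
  opposite, and the other vertex operator is built from these modes and a shift.\<close>
lemma pq_charge_commuting: "commuting (pq_charge l) (pq_charge l')"
proof -
  have shift: "pq_charge l i (pq_shift l' l' v) = pq_shift l' l' (pq_charge l i v)" for i v
    unfolding pq_charge_eq
    by (rule c.vertex_commute[OF linop_shifts(1), symmetric]) (simp_all add: c_shift_commute pq_shift_shift)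
  have "pq_charge l i (c.vertex l' j v) = c.vertex l' j (pq_charge l i v)" for i j v
    by (rule c.vertex_commute[OF vfield_linop[OF vfield_pq_charge] pq_charge_c_commute shift])
  then show ?thesis by (simp add: commuting_def pq_charge_eq)
qed

lemma pq_charge_ddiff:
  "series_ddiff 1 (pq_charge l) m v = normal_prod (oscillator_series (c_mode l)) (pq_charge l) m v"
  unfolding pq_charge_eq by (rule c.vertex_ddiff)

lemma b_vertex_ddiff:
  "series_ddiff 1 (b_vertex k) m v = normal_prod (oscillator_series (b_mode k)) (b_vertex k) m v"
  unfolding b_vertex_eq by (rule b.vertex_ddiff)

section \<open>The fields on the modules \<open>\<Pi>\<^sub>\<alpha>\<close>\<close>

lemma Pi_basis_modes:
  assumes "v \<in> spanned (Pi_basis \<alpha>)"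
  shows "p_mode n v \<in> spanned (Pi_basis \<alpha>)" "q_mode n v \<in> spanned (Pi_basis \<alpha>)"
  by (rule spanned_linop[OF linop_modes(1) assms] spanned_linop[OF linop_modes(2) assms];
      auto simp: Pi_basis_def p_mode_basis q_mode_basis intro!: spanned_scale; auto simp: spanned_def)+

lemma pq_charge_Pi_basis:
  assumes "v \<in> spanned (Pi_basis \<alpha>)"
  shows "pq_charge l m v \<in> spanned (Pi_basis (l + \<alpha>))"
  unfolding pq_charge_eq
proof (rule c.vertex_spanned[OF _ _ assms])
  show "c_mode l n w \<in> spanned (Pi_basis \<alpha>)" if "w \<in> spanned (Pi_basis \<alpha>)" for n w
    unfolding c_mode_def by (intro spanned_add spanned_scale Pi_basis_modes that)
  show "pq_shift l l w \<in> spanned (Pi_basis (l + \<alpha>))" if "w \<in> spanned (Pi_basis \<alpha>)" for w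
    by (rule spanned_linop[OF linop_shifts(1) that])
      (auto simp: Pi_basis_def pq_shift_basis spanned_basis add.left_commute)
qed

text \<open>The exponent \<open>l l' - l m'\<close> of \<open>z\<close> vanishes on basis vectors with \<open>l' = m'\<close>.\<close>
lemma pq_vertex_int_Pi:
  assumes "v \<in> spanned (Pi_basis \<alpha>)"
  shows "pq_vertex_int l l i v = pq_charge l i v"
proof (rule linop_eqI_on[of "pq_vertex_int l l i" "pq_charge l i"])
  show "linop (pq_vertex_int l l i)"
    unfolding pq_vertex_int_def pq_vertex_def by (rule linop_lin_ext)
  show "linop (pq_charge l i)" by (rule vfield_linop[OF vfield_pq_charge])
  fix x assume "x \<in> Poly_Mapping.keys v"
  then have "x \<in> Pi_basis \<alpha>" using assms by (auto simp: spanned_def)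
  then obtain a A B where x: "x = (a, a, A, B)" by (auto simp: Pi_basis_def)
  have "(\<lambda>n v. l *\<^sub>v p_mode n v + l *\<^sub>v q_mode n v) = c_mode l"
    by (intro ext) (simp add: c_mode_def)
  then show "pq_vertex_int l l i (basis x) = pq_charge l i (basis x)"
    by (simp add: x pq_vertex_int_def pq_vertex_def Let_def pq_charge_eq c.vertex_def)
qed

lemma pq_series_Pi:
  assumes "v \<in> spanned (Pi_basis \<alpha>)"
  shows "p_series n v \<in> spanned (Pi_basis \<alpha>)" "q_series n v \<in> spanned (Pi_basis \<alpha>)"
    "series_ddiff 1 p_series n v \<in> spanned (Pi_basis \<alpha>)"
  using assms by (auto simp: p_series_def q_series_def series_ddiff_Suc_0 intro: Pi_basis_modes spanned_scale)

abbreviation (input) G_series :: "(pq_basis, pq_basis) opseries"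
  where "G_series \<equiv> pq_charge (- 1)"

lemma a_series_Pi: "v \<in> spanned (Pi_basis \<alpha>) \<Longrightarrow> a_series m v = pq_charge 1 m v"
  by (simp add: a_series_def pq_vertex_int_Pi)

lemma astar_series_Pi:
  "v \<in> spanned (Pi_basis \<alpha>) \<Longrightarrow> astar_series m v = - normal_prod p_series G_series m v"
  unfolding astar_series_def
  by (subst normal_prod_cong_on[of "spanned (Pi_basis \<alpha>)" _ G_series])
    (auto simp: pq_vertex_int_Pi pq_series_Pi)

abbreviation hw :: "complex \<Rightarrow> pq_basis fvec"
  where "hw l \<equiv> basis (l, l, {#}, {#})"

lemma hw_modes: "n > 0 \<Longrightarrow> p_mode n (hw l) = 0" "n > 0 \<Longrightarrow> q_mode n (hw l) = 0"
    "n > 0 \<Longrightarrow> c_mode a n (hw l) = 0" "p_mode 0 (hw l) = l *\<^sub>v hw l"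
  by (simp_all add: p_mode_basis q_mode_basis c_mode_def osc_coeff_def osc_mon_def)

lemma pq_charge_hw:
  "m < 0 \<Longrightarrow> pq_charge a m (hw l) = 0" "pq_charge a 0 (hw l) = hw (a + l)"
  "pq_charge a 1 (hw l) = c_mode a (- 1) (hw (a + l))"
  using c.vertex_highest_weight[OF hw_modes(3)] by (simp_all add: pq_charge_eq pq_shift_basis)

lemma hw_Pi: "hw (of_int n) \<in> spanned (Pi_basis 0)"
  by (auto simp: spanned_basis Pi_basis_def)

text \<open>Of \<open>:pG:\<close> at \<open>z\<^sup>0\<close> only two terms survive on \<open>|1,1\<rangle>\<close>: \<open>p\<^bsub>-1\<^esub>\<close> with the leading coefficient
  of \<open>G\<close>, and the eigenvalue \<open>1\<close> of \<open>p\<^sub>0\<close> with the coefficient \<open>-(p\<^bsub>-1\<^esub> + q\<^bsub>-1\<^esub>)\<close> of \<open>z\<close> in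
  \<open>G\<close>.\<close>
lemma astar_a_vector: "astar_mode 0 (a_mode (- 1) vacuum) = basis (0, 0, {#}, {#0#})"
proof -
  have a: "a_mode (- 1) vacuum = hw 1"
    using a_series_Pi[OF hw_Pi[of 0], of 0] pq_charge_hw(2)[of 1 0]
    by (simp add: a_mode_def vacuum_def)
  have "normal_prod p_series G_series 0 (hw 1) = (\<Sum>i\<in>{-1, 0}. np_term p_series G_series 0 (hw 1) i)"
    unfolding normal_prod_def
  proof (rule Sum_any.expand_superset)
    have "np_term p_series G_series 0 (hw 1) i = 0" if "i < - 1 \<or> i > 0" for i
      using that by (auto simp: p_series_def hw_modes pq_charge_hw vfield_zero[OF vfield_pq_charge])
    then show "{i. np_term p_series G_series 0 (hw 1) i \<noteq> 0} \<subseteq> {-1, 0}" by force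
  qed simp
  also have "\<dots> = - basis (0, 0, {#}, {#0#})"
    by (simp add: p_series_def hw_modes pq_charge_hw c_mode_def p_mode_basis q_mode_basis osc_coeff_def osc_mon_def)
  finally show ?thesis
    using astar_series_Pi[OF hw_Pi[of 1], of 0] by (simp add: a astar_mode_def)
qed

text \<open>The charge of \<open>q\<close> on \<open>G\<close> reduces the action of \<open>G\<close> on \<open>q\<^bsub>-1\<^esub>|0\<rangle>\<close> to its action on the
  vacuum.\<close>
lemma astar2_a_vector:
  "astar_mode 0 (astar_mode 0 (a_mode (- 1) vacuum)) =
    basis (- 1, - 1, {#1#}, {#}) - basis (- 1, - 1, {#0, 0#}, {#})
    - 2 *\<^sub>v basis (- 1, - 1, {#0#}, {#0#})"
proof -
  let ?w = "q_series 0 (hw 0)"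
  have w: "?w = basis (0, 0, {#}, {#0#})"
    by (simp add: q_series_def q_mode_basis osc_coeff_def osc_mon_def)
  have G: "G_series m ?w = q_series 0 (G_series m (hw 0)) - G_series (m + 1) (hw 0)" for m
    using pq_charge_q[of 0 "- 1"] by (simp add: charged_def)
  have p: "p_series i ?w = q_series 0 (p_series i (hw 0))" for i
    by (simp add: p_series_def q_series_def p_q_mode_commute)
  have "normal_prod p_series G_series 0 ?w = (\<Sum>i\<in>{0, 1}. np_term p_series G_series 0 ?w i)"
    unfolding normal_prod_def
  proof (rule Sum_any.expand_superset)
    have "np_term p_series G_series 0 ?w i = 0" if "i < 0 \<or> i > 1" for i
    proof (cases "i < 0")
      case True
      then have "p_series i (hw 0) = 0"
        using hw_modes(1)[of "- i - 1" 0] hw_modes(4)[of 0] by (cases "i = - 1") (auto simp: p_series_def)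
      then show ?thesis using True
        by (simp add: p vfield_zero[OF vfield_pq_charge] vfield_zero[OF vfield_q])
    next
      case False
      then show ?thesis using that
        by (simp add: G pq_charge_hw vfield_zero[OF vfield_p] vfield_zero[OF vfield_q])
    qed
    then show "{i. np_term p_series G_series 0 ?w i \<noteq> 0} \<subseteq> {0, 1}" by force
  qed simp
  also have "\<dots> = p_series 0 (q_series 0 (hw (- 1)) - c_mode (- 1) (- 1) (hw (- 1))) - p_series 1 (hw (- 1))"
    using pq_charge_hw[where a = "- 1" and l = 0]
    by (simp add: G vfield_zero[OF vfield_q] module_hom.neg[OF vfield_linop[OF vfield_p]])
  also have "\<dots> = basis (- 1, - 1, {#0, 0#}, {#}) + 2 *\<^sub>v basis (- 1, - 1, {#0#}, {#0#})
      - basis (- 1, - 1, {#1#}, {#})"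
    by (rule poly_mapping_eqI)
      (simp add: p_series_def q_series_def c_mode_def p_mode_basis q_mode_basis osc_coeff_def osc_mon_def
        mode_linear linop_modes[THEN module_hom.diff] linop_modes[THEN module_hom.neg] lookup_add lookup_minus)
  finally show ?thesis
    using astar_series_Pi[of ?w 0 0] pq_series_Pi(2)[of "hw 0" 0 0] hw_Pi[of 0]
    unfolding astar_a_vector w[symmetric] unfolding astar_mode_def by simp
qed

text \<open>The derivative of \<open>V\<^bsub>0,0\<^esub>(z)\<close> is zero, so only the constant term is left.\<close>
lemma pq_charge_0: "pq_charge 0 = series_one"
proof (intro ext)
  fix m v
  have c: "c_mode 0 n w = 0" for n w by (simp add: c_mode_def)
  have "pq_charge 0 0 v = v"
  proof (rule linop_eqI_on[OF vfield_linop[OF vfield_pq_charge] linop_id])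
    show "pq_charge 0 0 (basis x) = basis x" for x
      using c.vertex_highest_weight(2)[where l = 0 and v = "basis x"] c by (cases x) (simp add: pq_charge_eq pq_shift_basis)
  qed
  moreover have "pq_charge 0 m v = 0" if "m \<noteq> 0"
  proof -
    have osc: "oscillator_series (c_mode 0) i w = 0" for i w by (simp add: oscillator_series_def c)
    have "series_ddiff 1 (pq_charge 0) (m - 1) v = 0"
      by (simp add: osc pq_charge_ddiff[unfolded One_nat_def] normal_prod_def vfield_zero[OF vfield_pq_charge]
        cong: if_cong)
    then have "of_int m *\<^sub>v pq_charge 0 m v = 0" by (simp add: series_ddiff_Suc_0)
    then have "(1 / of_int m) *\<^sub>v of_int m *\<^sub>v pq_charge 0 m v = 0" by simp
    then show ?thesis using that by simp
  qed
  ultimately show "pq_charge 0 m v = series_one m v" by (simp add: series_one_def)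
qed

lemma normal_prod_one: "vfield A \<Longrightarrow> normal_prod A series_one m v = A m v"
proof -
  assume A: "vfield A"
  have "normal_prod A series_one m v = Sum_any (\<lambda>i. if i = m then A i v else 0)"
    unfolding normal_prod_def
    by (intro Sum_any.cong) (simp add: series_one_def vfield_zero[OF A])
  then show ?thesis by simp
qed

lemma Y_basis_simps:
  "Y_basis (l, m, {#}, {#n#}) = normal_prod (series_ddiff n q_series) (pq_vertex_int l m)"
  "Y_basis (l, m, {#n#}, {#}) = normal_prod (series_ddiff n p_series) (pq_vertex_int l m)"
  "Y_basis (l, m, {#0, 0#}, {#}) = normal_prod p_series (normal_prod p_series (pq_vertex_int l m))"
  "Y_basis (l, m, {#0#}, {#0#}) = normal_prod p_series (normal_prod q_series (pq_vertex_int l m))"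
  by (simp_all add: Y_basis_def series_ddiff_0)

lemma astar_a_series_Pi:
  assumes "v \<in> spanned (Pi_basis \<alpha>)"
  shows "astar_a_series m v = q_series m v"
proof -
  have "astar_a_series m v = normal_prod q_series (pq_vertex_int 0 0) m v"
    by (simp add: astar_a_series_def astar_a_vector Y_def Y_basis_simps series_ddiff_0)
  also have "\<dots> = normal_prod q_series (pq_charge 0) m v"
    by (rule normal_prod_cong_on[of "spanned (Pi_basis \<alpha>)"])
      (use assms in \<open>auto simp: pq_vertex_int_Pi pq_series_Pi\<close>)
  finally show ?thesis by (simp add: pq_charge_0 normal_prod_one vfield_q)
qed

lemma astar2_a_series_Pi:
  assumes "v \<in> spanned (Pi_basis \<alpha>)"
  shows "astar2_a_series m v = normal_prod (series_ddiff 1 p_series) G_series m v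
    - normal_prod p_series (normal_prod p_series G_series) m v
    - 2 *\<^sub>v normal_prod p_series (normal_prod q_series G_series) m v"
proof -
  let ?U = "spanned (Pi_basis \<alpha>)" and ?G = "pq_vertex_int (- 1) (- 1)"
  note lin = linop_lin_ext[of "\<lambda>x. Y_basis x m v", THEN module_hom.diff]
    linop_lin_ext[of "\<lambda>x. Y_basis x m v", THEN module_hom.scale]
  have "astar2_a_series m v = normal_prod (series_ddiff 1 p_series) ?G m v
    - normal_prod p_series (normal_prod p_series ?G) m v
    - 2 *\<^sub>v normal_prod p_series (normal_prod q_series ?G) m v"
    unfolding astar2_a_series_def astar2_a_vector Y_def lin lin_ext_basis Y_basis_simps ..
  moreover have 1: "normal_prod A ?G n w = normal_prod A G_series n w"
    if "w \<in> ?U" "A \<in> {series_ddiff 1 p_series, p_series, q_series}" for A n w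
    using that by (intro normal_prod_cong_on[of ?U]) (auto simp: pq_vertex_int_Pi pq_series_Pi simp del: One_nat_def)
  moreover have "normal_prod p_series (normal_prod A ?G) m v = normal_prod p_series (normal_prod A G_series) m v"
    if "A \<in> {p_series, q_series}" for A
    using that assms by (rule_tac normal_prod_cong_on[of ?U]) (auto simp: 1 pq_series_Pi)
  ultimately show ?thesis using assms by simp
qed

section \<open>The modules \<open>W\<^bsub>\<alpha>,\<lambda>,k\<^esub>\<close> and the screening operator\<close>

abbreviation pW :: "(w_basis, w_basis) opseries" where "pW \<equiv> \<lambda>m. lift1 (p_series m)"

abbreviation qW :: "(w_basis, w_basis) opseries" where "qW \<equiv> \<lambda>m. lift1 (q_series m)"

abbreviation bW :: "complex \<Rightarrow> (w_basis, w_basis) opseries" where "bW k \<equiv> \<lambda>m. lift2 (b_series k m)"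

abbreviation chW :: "complex \<Rightarrow> (w_basis, w_basis) opseries" where "chW l \<equiv> \<lambda>m. lift1 (pq_charge l m)"

abbreviation vbW :: "complex \<Rightarrow> (w_basis, w_basis) opseries" where "vbW k \<equiv> \<lambda>m. lift2 (b_vertex k m)"

text \<open>The generating series of the screening operator. As for \<open>pq_charge\<close>, it is defined on the
  whole space; its coefficient of \<open>z\<^sup>-\<^sup>1\<close> is the screening operator on \<open>W\<^bsub>0,0,k\<^esub>\<close>.\<close>
definition screening_series :: "complex \<Rightarrow> (w_basis, w_basis) opseries"
  where "screening_series k = series_comp (chW (- (k + 2))) (vbW k)"

lemmas vfield_W = l1.vfield_L[OF vfield_p] l1.vfield_L[OF vfield_q] l2.vfield_L[OF vfield_b]
  l1.vfield_L[OF vfield_pq_charge] l2.vfield_L[OF vfield_b_vertex]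

lemma chW_ddiff:
  "series_ddiff 1 (chW l) m v = l *\<^sub>v normal_prod (no_zero_mode (\<lambda>m v. pW m v + qW m v)) (chW l) m v"
proof -
  let ?c = "no_zero_mode (\<lambda>m v. p_series m v + q_series m v)"
  have c: "vfield ?c" by (intro vfield_no_zero_mode vfield_add vfield_p vfield_q)
  have "oscillator_series (c_mode l) = (\<lambda>m v. l *\<^sub>v ?c m v)"
    by (intro ext) (simp add: oscillator_series_def no_zero_mode_def c_mode_def p_series_def q_series_def
        vec.scale_right_distrib)
  then have "series_ddiff 1 (pq_charge l) m = (\<lambda>v. l *\<^sub>v normal_prod ?c (pq_charge l) m v)"
    by (intro ext) (simp only: pq_charge_ddiff normal_prod_scale_left[OF c vfield_pq_charge])
  then have "series_ddiff 1 (chW l) m v = lift1 (\<lambda>v. l *\<^sub>v normal_prod ?c (pq_charge l) m v) v"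
    by (simp only: l1.L_ddiff[OF vfield_pq_charge, symmetric])
  also have "\<dots> = l *\<^sub>v normal_prod (\<lambda>m. lift1 (?c m)) (chW l) m v"
    by (simp only: l1.L_scale[OF vfield_linop[OF vfield_normal_prod[OF c vfield_pq_charge]]]
        l1.L_normal_prod[OF c vfield_pq_charge])
  also have "(\<lambda>m. lift1 (?c m) :: w_basis fvec \<Rightarrow> _) = no_zero_mode (\<lambda>m v. pW m v + qW m v)"
    by (intro ext) (simp only: l1.L_no_zero_mode no_zero_mode_def l1.L_add[OF vfield_linop[OF vfield_p] vfield_linop[OF vfield_q]])
  finally show ?thesis .
qed

lemma vbW_ddiff: "series_ddiff 1 (vbW k) m v = normal_prod (no_zero_mode (bW k)) (vbW k) m v"
proof -
  have b: "vfield (no_zero_mode (b_series k))" by (intro vfield_no_zero_mode vfield_b)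
  have "oscillator_series (b_mode k) = no_zero_mode (b_series k)"
    by (intro ext) (simp add: oscillator_series_def no_zero_mode_def b_series_def)
  then have "series_ddiff 1 (b_vertex k) m = normal_prod (no_zero_mode (b_series k)) (b_vertex k) m"
    by (intro ext) (simp only: b_vertex_ddiff)
  then have "series_ddiff 1 (vbW k) m v = lift2 (normal_prod (no_zero_mode (b_series k)) (b_vertex k) m) v"
    by (simp only: l2.L_ddiff[OF vfield_b_vertex, symmetric])
  also have "\<dots> = normal_prod (\<lambda>m. lift2 (no_zero_mode (b_series k) m)) (vbW k) m v"
    by (rule l2.L_normal_prod[OF b vfield_b_vertex])
  also have "(\<lambda>m. lift2 (no_zero_mode (b_series k) m) :: w_basis fvec \<Rightarrow> _) = no_zero_mode (bW k)"
    by (intro ext) (simp only: l2.L_no_zero_mode)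
  finally show ?thesis .
qed

lemma charged_screening:
  assumes Z: "linop Z" and "charged Z s g (chW (- (k + 2)))" "charged Z s h (vbW k)"
  shows "charged Z s (g + h) (screening_series k)"
  unfolding screening_series_def
  by (rule charged_series_comp[OF Z linop_lift(1) assms(2,3)])
    (rule finsupp_series_comp[OF vfield_W(4,5) commuting_lift[OF vfield_pq_charge vfield_b_vertex]])

lemma commuting_chW: "commuting (chW l) (screening_series k)"
  using charged_screening[OF linop_lift(1)
      charged_0I[OF l1.L_commuting[OF vfield_pq_charge vfield_pq_charge pq_charge_commuting]]
      charged_0I[OF commuting_lift[OF vfield_pq_charge vfield_b_vertex]]]
  by (simp add: charged_def commuting_def)

lemma screening_charge_p: "charged (pW i) (i + 1) (- (k + 2)) (screening_series k)"
  and screening_charge_q: "charged (qW i) (i + 1) (k + 2) (screening_series k)"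
  and screening_charge_b: "charged (bW k i) (i + 1) (2 * (k + 2)) (screening_series k)"
proof -
  note lin = vfield_linop[OF vfield_p] vfield_linop[OF vfield_q] vfield_linop[OF vfield_b]
    vfield_linop[OF vfield_pq_charge] vfield_linop[OF vfield_b_vertex]
  show "charged (pW i) (i + 1) (- (k + 2)) (screening_series k)"
    using charged_screening[OF linop_lift(1) l1.L_charged[OF lin(1,4) pq_charge_p]
        charged_0I[OF commuting_lift[OF vfield_p vfield_b_vertex]]] by simp
  show "charged (qW i) (i + 1) (k + 2) (screening_series k)"
    using charged_screening[OF linop_lift(1) l1.L_charged[OF lin(2,4) pq_charge_q]
        charged_0I[OF commuting_lift[OF vfield_q vfield_b_vertex]]]
    by (simp only: minus_minus add_0_right)
  show "charged (bW k i) (i + 1) (2 * (k + 2)) (screening_series k)"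
    using charged_screening[OF linop_lift(2)
        charged_0I[OF commuting_sym[OF commuting_lift[OF vfield_pq_charge vfield_b]]]
        l2.L_charged[OF lin(3,5) b_vertex_charge]] by (simp only: add_0_left)
qed

text \<open>Product rule for the factors \<open>e\<^bsup>\<beta>x\<^esup>\<close> and \<open>V\<^bsub>2(k+2)\<^esub>\<close>, each boson being moved out of the
  factor it commutes with.\<close>
lemma screening_ddiff:
  "series_ddiff 1 (screening_series k) m v =
    - (k + 2) *\<^sub>v normal_prod (no_zero_mode (\<lambda>m v. pW m v + qW m v)) (screening_series k) m v
    + normal_prod (no_zero_mode (bW k)) (screening_series k) m v"
proof -
  let ?c = "no_zero_mode (\<lambda>m v. pW m v + qW m v)" and ?b = "no_zero_mode (bW k)"
  let ?A = "chW (- (k + 2))" and ?B = "vbW k"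
  have c: "vfield ?c" and b: "vfield ?b"
    by (intro vfield_no_zero_mode vfield_add vfield_W)+
  have AB: "commuting ?A ?B" by (rule commuting_lift[OF vfield_pq_charge vfield_b_vertex])
  have "commuting ?B pW" "commuting ?B qW"
    by (intro commuting_sym[OF commuting_lift] vfield_p vfield_q vfield_b_vertex)+
  then have "commuting ?B (\<lambda>m v. pW m v + qW m v)"
    by (simp add: commuting_def module_hom.add[OF linop_lift(2)])
  then have Bc: "commuting ?B ?c" by (rule commuting_no_zero_mode[OF vfield_W(5)])
  have Ab: "commuting ?A ?b"
    by (intro commuting_no_zero_mode vfield_W commuting_lift vfield_pq_charge vfield_b)
  have BcA: "commuting ?B (normal_prod ?c ?A)"
    by (intro commuting_normal_prod c vfield_W Bc commuting_sym[OF AB])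
  have cA: "vfield (normal_prod ?c ?A)" by (intro vfield_normal_prod c vfield_W)
  have "series_ddiff 1 (screening_series k) m v =
      series_comp (series_ddiff 1 ?A) ?B m v + series_comp ?A (series_ddiff 1 ?B) m v"
    unfolding screening_series_def
    by (rule ddiff_series_comp[OF linop_lift(1) finsupp_series_comp[OF vfield_W(4,5) AB]])
  also have "series_comp (series_ddiff 1 ?A) ?B m v = - (k + 2) *\<^sub>v series_comp (normal_prod ?c ?A) ?B m v"
    unfolding series_comp_def chW_ddiff
    by (rule scale_Sum_any[OF finsupp_series_comp[OF cA vfield_W(5) commuting_sym[OF BcA]], symmetric])
  also have "series_comp (normal_prod ?c ?A) ?B m v = series_comp ?B (normal_prod ?c ?A) m v"
    by (rule series_comp_commute[OF commuting_sym[OF BcA]])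
  also have "\<dots> = normal_prod ?c (series_comp ?B ?A) m v"
    by (rule series_comp_normal_prod[OF vfield_W(5) c vfield_W(4) Bc commuting_sym[OF AB]])
  also have "series_comp ?B ?A = screening_series k"
    unfolding screening_series_def by (intro ext) (rule series_comp_commute[OF commuting_sym[OF AB]])
  also have "series_comp ?A (series_ddiff 1 ?B) m v = series_comp ?A (normal_prod ?b ?B) m v"
    unfolding series_comp_def vbW_ddiff ..
  also have "\<dots> = normal_prod ?b (screening_series k) m v"
    unfolding screening_series_def by (rule series_comp_normal_prod[OF vfield_W(4) b vfield_W(5) Ab AB])
  finally show ?thesis .
qed

lemma vfield_screening: "vfield (screening_series k)"
  unfolding screening_series_def
  by (rule vfield_series_comp[OF vfield_W(4,5) commuting_lift[OF vfield_pq_charge vfield_b_vertex]])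

interpretation W: screening_system pW qW "bW k" "chW (- 1)" "screening_series k" k "- (k + 2)" for k
proof (rule screening_system.intro)
  have "charged (pW i) (i + 1) (- 1) (chW (- 1))" for i
    by (rule l1.L_charged[OF vfield_linop[OF vfield_p] vfield_linop[OF vfield_pq_charge] pq_charge_p])
  moreover have "charged (qW i) (i + 1) (- (- 1)) (chW (- 1))" for i
    by (rule l1.L_charged[OF vfield_linop[OF vfield_q] vfield_linop[OF vfield_pq_charge] pq_charge_q])
  ultimately have "pW i (chW (- 1) j v) + qW i (chW (- 1) j v) = chW (- 1) j (pW i v + qW i v)" for i j v
    by (simp add: charged_def module_hom.add[OF linop_lift(1)])
  then show "commuting (chW (- 1)) (\<lambda>m v. pW m v + qW m v)" by (simp add: commuting_def)
  show "series_ddiff 1 (chW (- 1)) m v = - normal_prod (no_zero_mode (\<lambda>m v. pW m v + qW m v)) (chW (- 1)) m v"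
    for m v using chW_ddiff[of "- 1"] by simp
  show "charged (qW i) (i + 1) (- (- (k + 2))) (screening_series k)" for i
    using screening_charge_q[of i k] by (simp only: minus_minus)
  show "charged (bW k i) (i + 1) (- 2 * - (k + 2)) (screening_series k)" for i
    using screening_charge_b[of k i] by (simp add: add.commute)
qed (rule vfield_W vfield_screening refl screening_charge_p commuting_chW screening_ddiff
    commuting_lift[OF vfield_pq_charge vfield_b])+

lemma basis_Pi: "x \<in> Pi_basis \<alpha> \<Longrightarrow> basis x \<in> spanned (Pi_basis \<alpha>)"
  by (simp add: spanned_basis)

lemma current_E: "v \<in> W_space \<alpha> l \<Longrightarrow> current k E m v = chW 1 m v"
  unfolding W_space_def current.simps series_tensor_one_right
  by (erule lift1_cong_on) (simp add: a_series_Pi[OF basis_Pi])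

lemma current_H: "v \<in> W_space \<alpha> l \<Longrightarrow> current k H m v = (- 2) *\<^sub>v qW m v + bW k m v"
  unfolding W_space_def current.simps series_tensor_one_right series_tensor_one_left
  by (subst lift1_cong_on[of _ _ _ _ "q_series m"]) (auto simp: astar_a_series_Pi[OF basis_Pi])

text \<open>On \<open>W\<^bsub>\<alpha>,\<lambda>,k\<^esub>\<close> the three summands of \<open>f(z)\<close> are \<open>:p(pG): + 2:p(qG): - :(\<partial>p)G:\<close>,
  \<open>-k \<partial>(:pG:)\<close> and \<open>-:b(pG):\<close>.\<close>
lemma current_F:
  assumes v: "v \<in> W_space \<alpha> l"
  shows "current k F m v = W.f_current k m v"
proof -
  let ?G = "pq_charge (- 1)"
  note v' = v[unfolded W_space_def]
  have pG: "vfield (normal_prod p_series ?G)" and qG: "vfield (normal_prod q_series ?G)"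
    by (intro vfield_normal_prod vfield_p vfield_q vfield_pq_charge)+
  note dp = vfield_ddiff[OF vfield_p]
  have lift_pG: "(\<lambda>m. lift1 (normal_prod p_series ?G m)) = normal_prod pW (chW (- 1))"
    and lift_qG: "(\<lambda>m. lift1 (normal_prod q_series ?G m)) = normal_prod qW (chW (- 1))"
    by (intro ext l1.L_normal_prod vfield_p vfield_q vfield_pq_charge)+
  have "lift1 (astar2_a_series m) v = lift1 (\<lambda>w. normal_prod (series_ddiff 1 p_series) ?G m w
      + ((- 1) *\<^sub>v normal_prod p_series (normal_prod p_series ?G) m w
      + (- 2) *\<^sub>v normal_prod p_series (normal_prod q_series ?G) m w)) v"
    by (rule lift1_cong_on[OF v']) (simp add: astar2_a_series_Pi[OF basis_Pi])
  also have "\<dots> = normal_prod (series_ddiff 1 pW) (chW (- 1)) m v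
      + ((- 1) *\<^sub>v normal_prod pW (normal_prod pW (chW (- 1))) m v
      + (- 2) *\<^sub>v normal_prod pW (normal_prod qW (chW (- 1))) m v)"
  proof -
    have ddp: "(\<lambda>m. lift1 (series_ddiff 1 p_series m) :: w_basis fvec \<Rightarrow> _) = series_ddiff 1 pW"
      by (intro ext l1.L_ddiff vfield_p)
    note lin = vfield_normal_prod[OF dp vfield_pq_charge, THEN vfield_linop]
      vfield_normal_prod[OF vfield_p pG, THEN vfield_linop]
      vfield_normal_prod[OF vfield_p qG, THEN vfield_linop]
    show ?thesis
      by (simp only: l1.L_add[OF lin(1) linop_add[OF linop_scale[OF lin(2)] linop_scale[OF lin(3)]]]
          l1.L_add[OF linop_scale[OF lin(2)] linop_scale[OF lin(3)]] l1.L_scale[OF lin(2)] l1.L_scale[OF lin(3)]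
          l1.L_normal_prod[OF dp vfield_pq_charge] l1.L_normal_prod[OF vfield_p pG]
          l1.L_normal_prod[OF vfield_p qG] ddp lift_pG lift_qG)
  qed
  finally have 1: "series_tensor astar2_a_series series_one m v = \<dots>"
    by (simp only: series_tensor_one_right)
  have "lift1 (series_ddiff 1 astar_series m) v = lift1 (\<lambda>w. (- 1) *\<^sub>v series_ddiff 1 (normal_prod p_series ?G) m w) v"
    by (rule lift1_cong_on[OF v']) (simp only: series_ddiff_1 astar_series_Pi[OF basis_Pi]
        vec.scale_minus_left vec.scale_minus_right vec.scale_one)
  also have "\<dots> = (- 1) *\<^sub>v series_ddiff 1 (normal_prod pW (chW (- 1))) m v"
    by (simp only: l1.L_scale[OF vfield_linop[OF vfield_ddiff[OF pG]]] l1.L_ddiff[OF pG] lift_pG)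
  finally have 2: "series_tensor (series_ddiff 1 astar_series) series_one m v = \<dots>"
    by (simp only: series_tensor_one_right)
  have "series_tensor astar_series (b_series k) m v =
      series_tensor (\<lambda>m w. (- 1) *\<^sub>v normal_prod p_series ?G m w) (b_series k) m v"
    by (rule series_tensor_cong_on[OF v']) (simp add: astar_series_Pi[OF basis_Pi])
  also have "\<dots> = series_comp (\<lambda>m w. (- 1) *\<^sub>v lift1 (normal_prod p_series ?G m) w) (bW k) m v"
    unfolding series_tensor_eq[OF vfield_scale[OF pG] vfield_b] l1.L_scale[OF vfield_linop[OF pG]] ..
  also have "\<dots> = (- 1) *\<^sub>v series_comp (\<lambda>m. lift1 (normal_prod p_series ?G m)) (bW k) m v"
    by (rule series_comp_scale_left[OF l1.vfield_L[OF pG] vfield_W(3) commuting_lift[OF pG vfield_b]])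
  also have "\<dots> = (- 1) *\<^sub>v normal_prod (bW k) (normal_prod pW (chW (- 1))) m v"
    unfolding lift_pG[symmetric]
    by (simp only: normal_prod_commuting[OF commuting_sym[OF commuting_lift[OF pG vfield_b]]])
  finally have 3: "series_tensor astar_series (b_series k) m v = \<dots>" .
  show ?thesis
    unfolding current.simps 1 2 3 W.f_current_def
    by (rule poly_mapping_eqI) (simp add: lookup_add lookup_minus)
qed

lemma Pi_basis_shift: "Pi_basis (of_int n + \<alpha>) = Pi_basis \<alpha>"
proof (intro equalityI subsetI)
  fix x assume "x \<in> Pi_basis (of_int n + \<alpha>)"
  then obtain j A B where "x = (of_int j + (of_int n + \<alpha>), of_int j + (of_int n + \<alpha>), A, B)"
    by (auto simp: Pi_basis_def)
  then show "x \<in> Pi_basis \<alpha>" by (auto simp: Pi_basis_def intro!: exI[of _ "j + n"])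
next
  fix x assume "x \<in> Pi_basis \<alpha>"
  then obtain j A B where "x = (of_int j + \<alpha>, of_int j + \<alpha>, A, B)"
    by (auto simp: Pi_basis_def)
  then show "x \<in> Pi_basis (of_int n + \<alpha>)" by (auto simp: Pi_basis_def intro!: exI[of _ "j - n"])
qed

lemma W_space_fields:
  assumes v: "v \<in> W_space \<alpha> l"
  shows "pW m v \<in> W_space \<alpha> l" "qW m v \<in> W_space \<alpha> l" "bW k m v \<in> W_space \<alpha> l"
    "chW (of_int n) m v \<in> W_space \<alpha> l"
proof -
  note v' = v[unfolded W_space_def]
  show "pW m v \<in> W_space \<alpha> l" "qW m v \<in> W_space \<alpha> l"
    unfolding W_space_def by (rule spanned_lift1[OF v'], rule pq_series_Pi[OF basis_Pi], assumption)+
  show "bW k m v \<in> W_space \<alpha> l"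
    unfolding W_space_def
    by (rule spanned_lift2[OF v']) (auto simp: b_series_def b_mode_basis spanned_basis intro!: spanned_scale)
  show "chW (of_int n) m v \<in> W_space \<alpha> l"
    unfolding W_space_def
    by (rule spanned_lift1[OF v'])
      (use pq_charge_Pi_basis[OF basis_Pi, of _ \<alpha> "of_int n" m] in \<open>simp add: Pi_basis_shift\<close>)
qed

text \<open>The screening operator is identified with \<open>screening_series\<close> on \<open>W\<^bsub>0,0,k\<^esub>\<close>, so a
  commutator with a current makes sense only once the currents are known to preserve this
  space.\<close>
lemma current_W_space:
  assumes v: "v \<in> W_space \<alpha> l"
  shows "current k x m v \<in> W_space \<alpha> l"
proof -
  have G: "chW (- 1) m v \<in> W_space \<alpha> l" if "v \<in> W_space \<alpha> l" for m v
    using W_space_fields(4)[OF that, of "- 1" m] by simp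
  note W = W_space_fields(1-3)[unfolded W_space_def] G[unfolded W_space_def]
  show ?thesis
  proof (cases x)
    case E
    show ?thesis unfolding E current_E[OF v] using W_space_fields(4)[OF v, of 1 m] by simp
  next
    case H
    show ?thesis
      unfolding H current_H[OF v] using W_space_fields(2,3)[OF v] unfolding W_space_def
      by (intro spanned_add spanned_scale)
  next
    case F
    have diff: "v - w \<in> spanned K" if "v \<in> spanned K" "w \<in> spanned K" for v w :: "w_basis fvec" and K
      using spanned_add[OF that(1) spanned_uminus[OF that(2)]] by simp
    show ?thesis
      unfolding F current_F[OF v] W.f_current_def unfolding W_space_def
      by (intro diff spanned_add spanned_scale spanned_normal_prod spanned_ddiff W; (assumption | rule v[unfolded W_space_def]))
  qed
qed

text \<open>On \<open>\<Pi>\<^bsub>\<lambda>,\<lambda>\<^esub>\<close> the modes \<open>p\<^sub>0\<close> and \<open>q\<^sub>0\<close> act by \<open>\<lambda>\<close> and \<open>-\<lambda>\<close>; on \<open>\<pi>\<^sub>0\<close> the mode \<open>b\<^sub>0\<close> is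
  \<open>0\<close>.\<close>
lemma W_space_zero_modes:
  assumes v: "v \<in> W_space 0 0"
  shows "pW (- 1) v + qW (- 1) v = 0" "bW k (- 1) v = 0"
proof -
  have "x \<in> Pi_basis 0 \<Longrightarrow> p_mode 0 (basis x) + q_mode 0 (basis x) = 0" for x
    by (auto simp: Pi_basis_def p_mode_basis q_mode_basis osc_coeff_def osc_mon_def)
  note c = this
  show "pW (- 1) v + qW (- 1) v = 0"
  proof (rule linop_eqI_on[OF linop_add[OF linop_lift(1) linop_lift(1)] linop_zero])
    fix z assume "z \<in> Poly_Mapping.keys v"
    then have "fst z \<in> Pi_basis 0" using v by (auto simp: W_space_def spanned_def)
    from c[OF this] show "pW (- 1) (basis z) + qW (- 1) (basis z) = 0"
      by (cases z) (simp add: lift_basis p_series_def q_series_def module_hom.add[OF linop_tensor_left, symmetric]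
          module_hom.zero[OF linop_tensor_left])
  qed
  show "bW k (- 1) v = 0"
  proof (rule linop_eqI_on[OF linop_lift(2) linop_zero])
    fix z assume "z \<in> Poly_Mapping.keys v"
    then have "fst (snd z) = 0" using v by (auto simp: W_space_def spanned_def)
    then show "bW k (- 1) (basis z) = 0"
      by (cases z) (auto simp: lift_basis b_series_def b_mode_basis osc_coeff_def
          module_hom.zero[OF linop_tensor_right])
  qed
qed

lemma screening_eq:
  assumes "v \<in> W_space 0 0"
  shows "screening k v = screening_series k (- 1) v"
proof -
  have "screening k v = series_tensor (pq_charge (- (k + 2))) (b_vertex k) (- 1) v"
    unfolding screening_def
    by (rule series_tensor_cong_on[OF assms[unfolded W_space_def]])
      (simp only: a_series_pow_def pq_vertex_int_Pi[OF basis_Pi])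
  then show ?thesis
    by (simp only: series_tensor_eq[OF vfield_pq_charge vfield_b_vertex] screening_series_def)
qed

lemma linop_screening: "linop (screening k)"
  unfolding screening_def series_tensor_def by (rule linop_lin_ext)

lemma screening_W_space:
  assumes "v \<in> W_space 0 0"
  shows "screening k v \<in> W_space (- (k + 2)) (2 * (k + 2))"
proof -
  have b: "b_vertex k i (basis y) \<in> spanned {(2 * (k + 2), M) | M. True}" if "y \<in> {(0, M) | M. True}" for i y
    unfolding b_vertex_eq
  proof (rule b.vertex_spanned)
    show "basis y \<in> spanned {(0, M) | M. True}" using that by (simp only: spanned_basis)
    show "b_mode k n v \<in> spanned {(0, M) | M. True}" if "v \<in> spanned {(0, M) | M. True}" for n v
      by (rule spanned_linop[OF linop_modes(3) that]) (auto simp: b_mode_basis spanned_basis intro!: spanned_scale)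
    show "b_shift (2 * (k + 2)) v \<in> spanned {(2 * (k + 2), M) | M. True}" if "v \<in> spanned {(0, M) | M. True}" for v
      by (rule spanned_linop[OF linop_shifts(2) that]) (auto simp: b_shift_basis spanned_basis)
  qed
  have a: "a_series_pow (- (k + 2)) i (basis x) \<in> spanned (Pi_basis (- (k + 2)))" if "x \<in> Pi_basis 0" for i x
    using pq_charge_Pi_basis[OF basis_Pi[OF that], of "- (k + 2)" i]
    by (simp only: a_series_pow_def pq_vertex_int_Pi[OF basis_Pi[OF that]] add_0_right)
  show ?thesis
    unfolding screening_def series_tensor_def W_space_def
  proof (rule spanned_lin_ext[OF assms[unfolded W_space_def]])
    fix z :: w_basis assume "z \<in> Pi_basis 0 \<times> {(0, M) | M. True}"
    then obtain x y where z: "z = (x, y)" "x \<in> Pi_basis 0" "y \<in> {(0, M) | M. True}" by blast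
    show "(case z of (x, y) \<Rightarrow> Sum_any (\<lambda>i. a_series_pow (- (k + 2)) i (basis x) \<otimes>\<^sub>v
        b_vertex k (- 1 - i) (basis y))) \<in> spanned (Pi_basis (- (k + 2)) \<times> {(2 * (k + 2), M) | M. True})"
      unfolding z(1) prod.case by (intro spanned_Sum_any spanned_tensor a b z)
  qed
qed

lemma screening_current:
  assumes v: "v \<in> W_space 0 0"
  shows "screening k (current k x m v) = current k x m (screening k v)"
proof -
  note Sv = screening_W_space[OF v, of k]
  note eq = screening_eq[OF v, of k] screening_eq[OF current_W_space[OF v], of k k x m]
  let ?T = "screening_series k (- 1)"
  note linT = vfield_linop[OF vfield_screening, of k "- 1"]
  have "?T (current k x m v) = current k x m (screening k v)"
  proof (cases x)
    case E
    show ?thesis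
      unfolding E current_E[OF v] current_E[OF Sv] unfolding eq(1) by (simp only: commutingD[OF commuting_chW])
  next
    case H
    have "qW m (?T v) = ?T (qW m v) + (k + 2) *\<^sub>v screening_series k m v"
      "bW k m (?T v) = ?T (bW k m v) + (2 * (k + 2)) *\<^sub>v screening_series k m v"
      using screening_charge_q[of m k] screening_charge_b[of k m] by (simp_all add: charged_def)
    then show ?thesis
      unfolding H current_H[OF v] current_H[OF Sv] unfolding eq(1)
      by (simp only: module_hom.add[OF linT] module_hom.scale[OF linT] vec.scale_right_distrib vec.scale_scale)
        (simp add: vec.scale_left_distrib[symmetric])
  next
    case F
    show ?thesis
      unfolding F current_F[OF v] current_F[OF Sv] unfolding eq(1)
      by (rule W.f_current_screening[OF W_space_zero_modes[OF v], symmetric])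
  qed
  then show ?thesis by (simp only: eq(2))
qed

theorem proposition7p5:
  fixes k :: complex
  assumes "k \<noteq> - 2"
  shows "intertwining
    (W_space 0 0) (W_act k)
    (W_space (- (k + 2)) (2 * (k + 2))) (W_act k)
    (screening k)"
  unfolding intertwining_def
proof (intro conjI ballI allI)
  note lin = linop_screening[of k]
  fix x v assume v: "v \<in> W_space 0 0"
  have "screening k (W_act_basis k y v) = W_act_basis k y (screening k v)" for y
    by (cases y) (simp_all add: screening_current[OF v] module_hom.scale[OF lin])
  then show "screening k (W_act k x v) = W_act k x (screening k v)"
    by (simp add: W_act_def lin_ext_def module_hom.sum[OF lin] module_hom.scale[OF lin])
qed (erule screening_W_space
    | rule module_hom.add[OF linop_screening] module_hom.scale[OF linop_screening])+

end
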